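(* Let $n\in\mathbb N$, let $\mathfrak f_n$ be the standard filiform Lie algebra of dimension $n+2$, $\mathfrak a=\operatorname{span}\{H,I\}$ and $\mathfrak s_n=\mathfrak a\ltimes\mathfrak f_n$. (a) For every $p$ and every weight $\mu$ of $\mathfrak a$, the $\mathfrak a$-isotypic component $H^p(\mathfrak f_n)_{(\mu)}$ of weight $\mu$ of $H^p(\mathfrak f_n)=(\Lambda^pV_n^* )^E\oplus(\Lambda^{p-1}V_n^* )_E\otimes E^*$ is generated by the set of $\mathfrak{gl}(2)$-highest weight vectors of $\Lambda^pV_n^*$ of weight $\mu$ and by the set of $\mathfrak{gl}(2)$-lowest weight vectors of $\Lambda^{p-1}V_n^*$ of weight $\mu+(2,0)$ (a lowest weight vector $w$ contributing the class of $w\otimes E^*$). (b) For every $p$, a weight $\lambda$ of $\mathfrak s_n$ belongs to $\Gamma_\circ^p(\mathfrak s_n)$ if and only if $-\lambda$ is an $\mathfrak a$-weight of $H^p(\mathfrak f_n)$, $H^{p-1}(\mathfrak f_n)$ or $H^{p-2}(\mathfrak f_n)$. (c) In particular, with $\alpha=(2,0)$ and $\beta_k=(n-2k,1)$, all the vertices $$0,\ \alpha,\ \alpha+\beta_0,\ \alpha+\beta_0+\beta_1,\ \dots,\ \alpha+\beta_0+\dots+\beta_n,\ \beta_0+\dots+\beta_n,\ \beta_1+\dots+\beta_n,\ \dots,\ \beta_n$$ of the polygon $P_n$ belong to $\Gamma_\circ(\mathfrak s_n)$.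
   Context: $\mathbb K$ is an algebraically closed field of characteristic $0$. $V_n$ is the irreducible $\mathfrak{sl}(2)$-module with highest weight $n$ and basis of weight vectors $\{e_{n-2k}:k=0,\dots,n\}$; $\{E,H,F\}$ is the standard basis of $\mathfrak{sl}(2)$ and $I$ is the identity of $\mathfrak{gl}(2)$, which acts on $V_n$ as the identity, making $V_n$ a $\mathfrak{gl}(2)$-module. Inside $\mathfrak{gl}(2)\ltimes V_n$ ($V_n$ an abelian ideal), $\mathfrak f_n=\mathbb KE\ltimes V_n$, $\mathfrak a=\operatorname{span}\{H,I\}$, $\mathfrak s_n=\operatorname{span}\{H,I,E\}\ltimes V_n$. A character (weight) $\lambda$ of $\mathfrak s_n$ vanishes on $\mathfrak s_n'=\mathfrak f_n$ and is identified with the pair $(\lambda(H),\lambda(I))$; likewise weights of $\mathfrak a$. $\mathfrak a$ acts on $H^*(\mathfrak f_n)$ (cohomology with trivial coefficients) by the action induced from the contragredient action on $\Lambda\mathfrak f_n^*$. The superscript $E$ denotes invariants (kernel of $E$), the subscript $E$ coinvariants (cokernel of $E$), and $E^*\in\mathfrak f_n^*$ is the functional vanishing on $V_n$ with $E^*(E)=1$. $\Gamma_\circ^p(\mathfrak s_n)$ is the set of irreducible (hence one dimensional, i.e. characters) $\mathfrak s_n$-modules with $H^p(\mathfrak s_n,\lambda)\neq0$, and $\Gamma_\circ(\mathfrak s_n)=\bigcup_p\Gamma_\circ^p(\mathfrak s_n)$. $P_n$ is the $(2n+4)$-gon with the vertices listed in (c). Cohomology in negative degrees is zero. *)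

theory Defs
  imports
    "HOL-Analysis.Cartesian_Space"
    "HOL-Computational_Algebra.Polynomial"
    "HOL-Library.Function_Algebras"
    "HOL-Library.Set_Algebras"
begin

section \<open>The Lie algebra \<open>gl(2)\<close> extended by \<open>V\<^sub>n\<close>\<close>

text \<open>
  An element of the underlying type is a pair \<open>(A, v)\<close> of a \<open>2 \<times> 2\<close> matrix and a vector;
  the vector \<open>v\<close> stands for the combination of the weight vectors \<open>e\<^bsub>n-2k\<^esub>\<close> with
  coefficients \<open>v k\<close>.  The Lie algebra proper consists of the pairs with \<open>v\<close> supported
  on \<open>{..n}\<close>; all subalgebras below are subsets of it.
\<close>

type_synonym 'k glV = "('k^2^2) \<times> (nat \<Rightarrow> 'k)"

definition glV_scale :: "'k::field \<Rightarrow> 'k glV \<Rightarrow> 'k glV" where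
  "glV_scale c x = (map_matrix ((*) c) (fst x), \<lambda>k. c * snd x k)"

definition fun_scale :: "'k::field \<Rightarrow> ('x \<Rightarrow> 'k) \<Rightarrow> ('x \<Rightarrow> 'k)" where
  "fun_scale c f = (\<lambda>x. c * f x)"

interpretation glV: vector_space glV_scale
  by unfold_locales
    (auto simp: glV_scale_def map_matrix_def vec_eq_iff fun_eq_iff algebra_simps prod_eq_iff)

interpretation funs: vector_space fun_scale
  by unfold_locales (auto simp: fun_scale_def fun_eq_iff algebra_simps)

definition E_mat :: "'k::field^2^2" where "E_mat = vector [vector [0, 1], vector [0, 0]]"
definition F_mat :: "'k::field^2^2" where "F_mat = vector [vector [0, 0], vector [1, 0]]"
definition H_mat :: "'k::field^2^2" where "H_mat = vector [vector [1, 0], vector [0, - 1]]"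
definition I_mat :: "'k::field^2^2" where "I_mat = mat 1"

abbreviation E_el :: "'k::field glV" where "E_el \<equiv> (E_mat, 0)"
abbreviation F_el :: "'k::field glV" where "F_el \<equiv> (F_mat, 0)"
abbreviation H_el :: "'k::field glV" where "H_el \<equiv> (H_mat, 0)"
abbreviation I_el :: "'k::field glV" where "I_el \<equiv> (I_mat, 0)"

text \<open>
  The weight vectors are normalized so that \<open>E e\<^bsub>n-2k\<^esub> = e\<^bsub>n-2k+2\<^esub>\<close> for \<open>k > 0\<close> (which makes
  \<open>\<K>E \<ltimes> V\<^sub>n\<close> the standard filiform algebra in its usual basis),
  \<open>H e\<^bsub>n-2k\<^esub> = (n-2k) e\<^bsub>n-2k\<^esub>\<close> and \<open>F e\<^bsub>n-2k\<^esub> = (k+1)(n-k) e\<^bsub>n-2k-2\<^esub>\<close>.  The three functions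
  below give the coefficients of the image vector.
\<close>

definition E_op :: "(nat \<Rightarrow> 'k::field) \<Rightarrow> (nat \<Rightarrow> 'k)" where
  "E_op v = (\<lambda>k. v (Suc k))"

definition H_op :: "nat \<Rightarrow> (nat \<Rightarrow> 'k::field) \<Rightarrow> (nat \<Rightarrow> 'k)" where
  "H_op n v = (\<lambda>k. (of_nat n - 2 * of_nat k) * v k)"

definition F_op :: "nat \<Rightarrow> (nat \<Rightarrow> 'k::field) \<Rightarrow> (nat \<Rightarrow> 'k)" where
  "F_op n v = (\<lambda>k. of_nat k * (of_nat n - of_nat k + 1) * v (k - 1))"

text \<open>
  A matrix \<open>(a, b; c, d)\<close> equals \<open>b E + c F + (a-d)/2 H + (a+d)/2 I\<close>, and \<open>I\<close> acts as the identity.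
\<close>

definition gl_act :: "nat \<Rightarrow> 'k::field^2^2 \<Rightarrow> (nat \<Rightarrow> 'k) \<Rightarrow> (nat \<Rightarrow> 'k)" where
  "gl_act n A v =
     fun_scale (A$1$2) (E_op v) + fun_scale (A$2$1) (F_op n v)
     + fun_scale ((A$1$1 - A$2$2) / 2) (H_op n v) + fun_scale ((A$1$1 + A$2$2) / 2) v"

definition bracket :: "nat \<Rightarrow> 'k::field glV \<Rightarrow> 'k glV \<Rightarrow> 'k glV" where
  "bracket n x y =
     (fst x ** fst y - fst y ** fst x, gl_act n (fst x) (snd y) - gl_act n (fst y) (snd x))"

definition V :: "nat \<Rightarrow> 'k::field glV set" where
  "V n = {(0, v) | v. \<forall>k>n. v k = 0}"

definition filiform :: "nat \<Rightarrow> 'k::field glV set" where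
  "filiform n = glV.span (insert E_el (V n))"

definition torus :: "'k::field glV set" where
  "torus = glV.span {H_el, I_el}"

definition solv :: "nat \<Rightarrow> 'k::field glV set" where
  "solv n = glV.span ({H_el, I_el, E_el} \<union> V n)"


subsection \<open>Sanity checks\<close>

lemmas gl_unfold = bracket_def gl_act_def fun_scale_def E_op_def F_op_def H_op_def
  matrix_matrix_mult_def sum_2 vec_eq_iff forall_2 fun_eq_iff

lemma bracket_self: "bracket n x x = 0"
  by (simp add: bracket_def prod_eq_iff)

lemma bracket_add_left: "bracket n (x + y) z = bracket n x z + bracket n y z"
  by (auto simp: prod_eq_iff gl_unfold algebra_simps add_divide_distrib diff_divide_distrib)

lemma bracket_scale_left: "bracket n (glV_scale c x) z = glV_scale c (bracket n x z)"
  by (auto simp: prod_eq_iff gl_unfold glV_scale_def map_matrix_def algebra_simps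
      add_divide_distrib diff_divide_distrib)

lemma bracket_anticomm: "bracket n x y = - bracket n y x"
  by (simp add: bracket_def prod_eq_iff)

lemma gl_act_commutator:
  fixes v :: "nat \<Rightarrow> 'k::field_char_0"
  shows "gl_act n (A ** B - B ** A) v = gl_act n A (gl_act n B v) - gl_act n B (gl_act n A v)"
proof
  fix k
  define h i h' i' where "h = (A$1$1 - A$2$2) / 2" and "i = (A$1$1 + A$2$2) / 2"
    and "h' = (B$1$1 - B$2$2) / 2" and "i' = (B$1$1 + B$2$2) / 2"
  note coords = h_def[symmetric] i_def[symmetric] h'_def[symmetric] i'_def[symmetric]
  let ?C = "A ** B - B ** A"
  have entries: "A$1$1 = i + h" "A$2$2 = i - h" "B$1$1 = i' + h'" "B$2$2 = i' - h'"
    by (simp_all add: h_def i_def h'_def i'_def field_simps)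
  have C: "?C$1$2 = 2 * (h * B$1$2 - h' * A$1$2)" "?C$2$1 = 2 * (h' * A$2$1 - h * B$2$1)"
    "(?C$1$1 - ?C$2$2) / 2 = A$1$2 * B$2$1 - B$1$2 * A$2$1" "(?C$1$1 + ?C$2$2) / 2 = 0"
    by (simp_all add: matrix_matrix_mult_def sum_2 entries algebra_simps diff_divide_distrib)
  show "gl_act n ?C v k = (gl_act n A (gl_act n B v) - gl_act n B (gl_act n A v)) k"
    unfolding gl_act_def C coords
    by (cases k) (simp_all add: fun_scale_def E_op_def F_op_def H_op_def algebra_simps)
qed

lemma gl_act_diff: "gl_act n A (v - w) = gl_act n A v - gl_act n A w"
  by (simp add: gl_unfold algebra_simps add_divide_distrib diff_divide_distrib)

lemma matrix_diff_rdistrib: "(B - C) ** A = B ** A - C ** (A :: 'k::field^2^2)"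
  by (simp add: matrix_matrix_mult_def sum_2 vec_eq_iff algebra_simps)

lemma matrix_diff_ldistrib: "A ** (B - C) = A ** B - A ** (C :: 'k::field^2^2)"
  by (simp add: matrix_matrix_mult_def sum_2 vec_eq_iff algebra_simps)

lemma bracket_jacobi:
  fixes x y z :: "'k::field_char_0 glV"
  shows "bracket n x (bracket n y z) + bracket n y (bracket n z x) + bracket n z (bracket n x y) = 0"
proof -
  have "fst x ** (fst y ** fst z - fst z ** fst y) - (fst y ** fst z - fst z ** fst y) ** fst x
      + (fst y ** (fst z ** fst x - fst x ** fst z) - (fst z ** fst x - fst x ** fst z) ** fst y)
      + (fst z ** (fst x ** fst y - fst y ** fst x) - (fst x ** fst y - fst y ** fst x) ** fst z) = 0"
    by (simp add: matrix_diff_ldistrib matrix_diff_rdistrib matrix_mul_assoc)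
  then show ?thesis
    by (simp add: bracket_def prod_eq_iff gl_act_commutator gl_act_diff)
qed

lemma V_ideal:
  fixes x :: "'k::field glV"
  assumes "x \<in> V n"
  shows "bracket n y x \<in> V n"
proof -
  obtain v where v: "x = (0, v)" "\<forall>k>n. v k = 0" using assms by (auto simp: V_def)
  have "gl_act n (fst y) v k = 0" if "k > n" for k
  proof (cases "k = Suc n")
    case True
    with v(2) show ?thesis by (simp add: gl_unfold)
  next
    case False
    with that v(2) show ?thesis by (simp add: gl_unfold)
  qed
  moreover have "gl_act n 0 w = (0 :: nat \<Rightarrow> 'k)" for w by (simp add: gl_unfold)
  ultimately show ?thesis by (simp add: V_def v(1) bracket_def matrix_matrix_mult_def vec_eq_iff)
qed

lemma bracket_E_V: "bracket n E_el (0, v) = (0, E_op v)"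
  by (simp add: prod_eq_iff gl_unfold E_mat_def)

lemma bracket_F_V: "bracket n F_el (0, v) = (0, F_op n v)"
  by (simp add: prod_eq_iff gl_unfold F_mat_def)

lemma bracket_H_V: "bracket n H_el (0, v) = (0, H_op n (v :: nat \<Rightarrow> 'k::field_char_0))"
  by (simp add: prod_eq_iff gl_unfold H_mat_def)

lemma bracket_I_V: "bracket n I_el (0, v) = (0, v :: nat \<Rightarrow> 'k::field_char_0)"
  by (simp add: prod_eq_iff gl_unfold I_mat_def mat_def)

lemma V_irreducible:
  fixes W :: "'k::field_char_0 glV set"
  assumes W: "glV.subspace W" "W \<subseteq> V n" "W \<noteq> {0}"
    and WE: "\<And>w. w \<in> W \<Longrightarrow> bracket n E_el w \<in> W"
    and WF: "\<And>w. w \<in> W \<Longrightarrow> bracket n F_el w \<in> W"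
  shows "W = V n"
proof
  define e :: "nat \<Rightarrow> nat \<Rightarrow> 'k" where "e j = (\<lambda>k. if k = j then 1 else 0)" for j
  have scale: "(0, \<lambda>k. c * v k) \<in> W" if "(0, v) \<in> W" for c v
    using glV.subspace_scale[OF W(1) that, of c]
    by (simp add: glV_scale_def map_matrix_def zero_vec_def)
  obtain w where "w \<in> W" "w \<noteq> 0"
    using W(1,3) glV.subspace_0 by blast
  then obtain v where v: "(0, v) \<in> W" "v \<noteq> 0" "\<forall>k>n. v k = 0"
    using W(2) by (auto simp: V_def zero_prod_def)
  define m where "m = Max {k. v k \<noteq> 0}"
  have fin: "finite {k. v k \<noteq> 0}" "{k. v k \<noteq> 0} \<noteq> {}"
    using v(2,3) by (auto simp: fun_eq_iff intro!: finite_subset[of _ "{..n}"] leI)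
  have vm: "v m \<noteq> 0" using Max_in[OF fin] by (simp add: m_def)
  have above: "v k = 0" if "k > m" for k
    using Max_ge[OF fin(1), of k] that by (auto simp: m_def)
  have shift: "(0, \<lambda>k. v (j + k)) \<in> W" for j
  proof (induction j)
    case (Suc j)
    then show ?case using WE[OF Suc] by (simp add: bracket_E_V E_op_def)
  qed (use v(1) in simp)
  have "(\<lambda>k. inverse (v m) * v (m + k)) = e 0"
    using vm above by (auto simp: e_def fun_eq_iff)
  then have e0: "(0, e 0) \<in> W" using scale[OF shift, of "inverse (v m)" m] by simp
  have e: "(0, e j) \<in> W" if "j \<le> n" for j
    using that
  proof (induction j)
    case (Suc j)
    let ?c = "of_nat (Suc j) * of_nat (n - j) :: 'k"
    have "?c \<noteq> 0" using Suc.prems by (simp del: of_nat_Suc)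
    moreover have "F_op n (e j) = (\<lambda>k. ?c * e (Suc j) k)"
      using Suc.prems by (auto simp: F_op_def e_def fun_eq_iff of_nat_diff)
    ultimately have "(\<lambda>k. inverse ?c * F_op n (e j) k) = e (Suc j)"
      by (simp add: fun_eq_iff field_simps del: of_nat_Suc)
    moreover have "(0, F_op n (e j)) \<in> W"
      using WF[of "(0, e j)"] Suc by (simp add: bracket_F_V)
    ultimately show ?case using scale[of "F_op n (e j)" "inverse ?c"] by (simp del: of_nat_Suc)
  qed (use e0 in simp)
  show "V n \<subseteq> W"
  proof
    fix x :: "'k glV" assume "x \<in> V n"
    then obtain u where u: "x = (0, u)" "\<forall>k>n. u k = 0" by (auto simp: V_def)
    have "(0, \<lambda>k. if k < j then u k else 0) \<in> W" if "j \<le> Suc n" for j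
      using that
    proof (induction j)
      case 0
      then show ?case using glV.subspace_0[OF W(1)] by (simp add: zero_prod_def zero_fun_def)
    next
      case (Suc j)
      have "(0, \<lambda>k. if k < Suc j then u k else 0)
          = (0, \<lambda>k. if k < j then u k else 0) + ((0, \<lambda>k. u j * e j k) :: 'k glV)"
        by (auto simp: prod_eq_iff fun_eq_iff e_def less_Suc_eq)
      moreover have "(0, \<lambda>k. if k < j then u k else 0) \<in> W" "(0, \<lambda>k. u j * e j k) \<in> W"
        using Suc scale[OF e, of j "u j"] by simp_all
      ultimately show ?case by (simp only: glV.subspace_add[OF W(1)])
    qed
    from this[of "Suc n"] have "(0, \<lambda>k. if k < Suc n then u k else 0) \<in> W" by simp
    moreover have "(\<lambda>k. if k < Suc n then u k else 0) = u"
      using u(2) by (auto simp: fun_eq_iff)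
    ultimately show "x \<in> W" using u(1) by simp
  qed
qed (fact W(2))


section \<open>Lie algebra cohomology with one-dimensional coefficients\<close>

text \<open>
  A \<open>p\<close>-cochain on a subalgebra \<open>L\<close> is an alternating multilinear form, represented as a
  function on lists that vanishes outside the lists of length \<open>p\<close> over \<open>L\<close>.  For negative \<open>p\<close>
  there is only the zero cochain.
\<close>

definition cochains :: "'k::field glV set \<Rightarrow> int \<Rightarrow> ('k glV list \<Rightarrow> 'k) set" where
  "cochains L p = {\<omega>.
     (\<forall>xs. \<not> (int (length xs) = p \<and> set xs \<subseteq> L) \<longrightarrow> \<omega> xs = 0) \<and>
     (\<forall>xs i. set xs \<subseteq> L \<and> i < length xs \<longrightarrow>
        (\<forall>x\<in>L. \<forall>y\<in>L. \<omega> (xs[i := x + y]) = \<omega> (xs[i := x]) + \<omega> (xs[i := y])) \<and>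
        (\<forall>c. \<forall>x\<in>L. \<omega> (xs[i := glV_scale c x]) = c * \<omega> (xs[i := x]))) \<and>
     (\<forall>xs i j. i < j \<and> j < length xs \<and> xs ! i = xs ! j \<longrightarrow> \<omega> xs = 0)}"

definition omit :: "nat \<Rightarrow> 'x list \<Rightarrow> 'x list" where
  "omit i xs = take i xs @ drop (Suc i) xs"

definition characters :: "nat \<Rightarrow> 'k::field glV set \<Rightarrow> ('k glV \<Rightarrow> 'k) set" where
  "characters n L = {l.
     (\<forall>x\<in>L. \<forall>y\<in>L. l (x + y) = l x + l y) \<and> (\<forall>c. \<forall>x\<in>L. l (glV_scale c x) = c * l x) \<and>
     (\<forall>x\<in>L. \<forall>y\<in>L. l (bracket n x y) = 0) \<and> (\<forall>x. x \<notin> L \<longrightarrow> l x = 0)}"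

text \<open>The Chevalley-Eilenberg differential with coefficients in the character \<open>l\<close> of \<open>L\<close>.\<close>

definition CE_d ::
  "nat \<Rightarrow> 'k::field glV set \<Rightarrow> ('k glV \<Rightarrow> 'k) \<Rightarrow> ('k glV list \<Rightarrow> 'k) \<Rightarrow> ('k glV list \<Rightarrow> 'k)" where
  "CE_d n L l \<omega> xs = (if set xs \<subseteq> L then
       (\<Sum>i<length xs. (- 1) ^ i * l (xs ! i) * \<omega> (omit i xs))
     + (\<Sum>j<length xs. \<Sum>i<j. (- 1) ^ (i + j) * \<omega> (bracket n (xs ! i) (xs ! j) # omit i (omit j xs)))
     else 0)"

definition cocycles :: "nat \<Rightarrow> 'k::field glV set \<Rightarrow> ('k glV \<Rightarrow> 'k) \<Rightarrow> int \<Rightarrow> ('k glV list \<Rightarrow> 'k) set" where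
  "cocycles n L l p = {\<omega> \<in> cochains L p. CE_d n L l \<omega> = 0}"

definition coboundaries :: "nat \<Rightarrow> 'k::field glV set \<Rightarrow> ('k glV \<Rightarrow> 'k) \<Rightarrow> int \<Rightarrow> ('k glV list \<Rightarrow> 'k) set" where
  "coboundaries n L l p = CE_d n L l ` cochains L (p - 1)"

text \<open>
  A quotient space \<open>Z/B\<close> is the set of cosets \<open>z +o B\<close>.  Its zero element is \<open>B\<close>, and cosets are
  added with the addition of sets.  A linear map \<open>T\<close> from \<open>Z\<close> to \<open>Z'\<close> taking \<open>B\<close> to \<open>B'\<close> induces
  \<open>quot_map T B'\<close>; this also gives scalar multiplication, and \<open>quot_span B\<close> is linear span.
\<close>

definition quot :: "'x::ab_group_add set \<Rightarrow> 'x set \<Rightarrow> 'x set set" where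
  "quot Z B = (\<lambda>z. z +o B) ` Z"

definition quot_map :: "('x \<Rightarrow> 'y::ab_group_add) \<Rightarrow> 'y set \<Rightarrow> 'x set \<Rightarrow> 'y set" where
  "quot_map T B C = T ` C + B"

definition quot_span :: "('x \<Rightarrow> 'k::field) set \<Rightarrow> ('x \<Rightarrow> 'k) set set \<Rightarrow> ('x \<Rightarrow> 'k) set set" where
  "quot_span B S = quot (funs.span (\<Union> S)) B"

definition cohomology ::
  "nat \<Rightarrow> 'k::field glV set \<Rightarrow> ('k glV \<Rightarrow> 'k) \<Rightarrow> int \<Rightarrow> ('k glV list \<Rightarrow> 'k) set set" where
  "cohomology n L l p = quot (cocycles n L l p) (coboundaries n L l p)"

text \<open>The contragredient of the adjoint action of \<open>x\<close> on forms on an ideal \<open>L\<close>.\<close>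

definition contra :: "nat \<Rightarrow> 'k::field glV set \<Rightarrow> 'k glV \<Rightarrow> ('k glV list \<Rightarrow> 'k) \<Rightarrow> ('k glV list \<Rightarrow> 'k)" where
  "contra n L x \<omega> xs =
     (if set xs \<subseteq> L then - (\<Sum>i<length xs. \<omega> (xs[i := bracket n x (xs ! i)])) else 0)"


section \<open>The cohomology of the filiform algebra\<close>

abbreviation Hfil :: "nat \<Rightarrow> int \<Rightarrow> ('k::field glV list \<Rightarrow> 'k) set set" where
  "Hfil n p \<equiv> cohomology n (filiform n) 0 p"

abbreviation Bfil :: "nat \<Rightarrow> int \<Rightarrow> ('k::field glV list \<Rightarrow> 'k) set" where
  "Bfil n p \<equiv> coboundaries n (filiform n) 0 p"

text \<open>Weights of \<open>torus\<close> are given by their values at \<open>H\<close> and \<open>I\<close>.\<close>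

definition isotypic :: "nat \<Rightarrow> int \<Rightarrow> 'k::field \<times> 'k \<Rightarrow> ('k glV list \<Rightarrow> 'k) set set" where
  "isotypic n p \<mu> = {C \<in> Hfil n p.
     quot_map (contra n (filiform n) H_el) (Bfil n p) C = quot_map (fun_scale (fst \<mu>)) (Bfil n p) C \<and>
     quot_map (contra n (filiform n) I_el) (Bfil n p) C = quot_map (fun_scale (snd \<mu>)) (Bfil n p) C}"

definition cohom_weights :: "nat \<Rightarrow> int \<Rightarrow> ('k::field \<times> 'k) set" where
  "cohom_weights n p = {\<mu>. \<exists>C\<in>isotypic n p \<mu>. C \<noteq> Bfil n p}"

text \<open>\<open>\<Lambda>\<^sup>pV\<^sub>n\<^sup>*\<close> is the space of alternating \<open>p\<close>-forms on \<open>V\<^sub>n\<close>.\<close>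

abbreviation Lam :: "nat \<Rightarrow> int \<Rightarrow> ('k::field glV list \<Rightarrow> 'k) set" where
  "Lam n p \<equiv> cochains (V n) p"

definition E_image :: "nat \<Rightarrow> int \<Rightarrow> ('k::field glV list \<Rightarrow> 'k) set" where
  "E_image n p = contra n (V n) E_el ` Lam n p"

definition E_invariants :: "nat \<Rightarrow> int \<Rightarrow> ('k::field glV list \<Rightarrow> 'k) set" where
  "E_invariants n p = {u \<in> Lam n p. contra n (V n) E_el u = 0}"

definition E_coinvariants :: "nat \<Rightarrow> int \<Rightarrow> ('k::field glV list \<Rightarrow> 'k) set set" where
  "E_coinvariants n p = quot (Lam n p) (E_image n p)"

definition weight_vectors :: "nat \<Rightarrow> int \<Rightarrow> 'k::field \<times> 'k \<Rightarrow> ('k glV list \<Rightarrow> 'k) set" where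
  "weight_vectors n p \<mu> = {u \<in> Lam n p. u \<noteq> 0 \<and>
     contra n (V n) H_el u = fun_scale (fst \<mu>) u \<and> contra n (V n) I_el u = fun_scale (snd \<mu>) u}"

definition highest_weight_vectors :: "nat \<Rightarrow> int \<Rightarrow> 'k::field \<times> 'k \<Rightarrow> ('k glV list \<Rightarrow> 'k) set" where
  "highest_weight_vectors n p \<mu> = {u \<in> weight_vectors n p \<mu>. contra n (V n) E_el u = 0}"

definition lowest_weight_vectors :: "nat \<Rightarrow> int \<Rightarrow> 'k::field \<times> 'k \<Rightarrow> ('k glV list \<Rightarrow> 'k) set" where
  "lowest_weight_vectors n p \<mu> = {u \<in> weight_vectors n p \<mu>. contra n (V n) F_el u = 0}"

text \<open>
  The inclusion of \<open>\<Lambda>V\<^sub>n\<^sup>*\<close> into \<open>\<Lambda>\<ff>\<^sub>n\<^sup>*\<close> is pullback along the projection \<open>\<ff>\<^sub>n \<rightarrow> V\<^sub>n\<close> with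
  kernel \<open>\<K>E\<close>, and \<open>w \<otimes> E\<^sup>*\<close> is the form \<open>w \<and> E\<^sup>*\<close>.
\<close>

definition extend :: "nat \<Rightarrow> ('k::field glV list \<Rightarrow> 'k) \<Rightarrow> ('k glV list \<Rightarrow> 'k)" where
  "extend n w xs = (if set xs \<subseteq> filiform n then w (map (\<lambda>x. (0, snd x)) xs) else 0)"

definition E_star :: "nat \<Rightarrow> 'k::field glV list \<Rightarrow> 'k" where
  "E_star n xs = (if length xs = 1 \<and> set xs \<subseteq> filiform n then fst (hd xs) $ 1 $ 2 else 0)"

definition wedge1 :: "('x list \<Rightarrow> 'k::field) \<Rightarrow> ('x list \<Rightarrow> 'k) \<Rightarrow> ('x list \<Rightarrow> 'k)" where
  "wedge1 w \<phi> xs = (\<Sum>i<length xs. (- 1) ^ (length xs - 1 - i) * w (omit i xs) * \<phi> [xs ! i])"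

definition tensor_E_star :: "nat \<Rightarrow> ('k::field glV list \<Rightarrow> 'k) \<Rightarrow> ('k glV list \<Rightarrow> 'k)" where
  "tensor_E_star n w = wedge1 (extend n w) (E_star n)"

text \<open>
  The decomposition of \<open>H\<^sup>p(\<ff>\<^sub>n)\<close>: a pair \<open>(u, C)\<close> stands for \<open>u \<oplus> (C \<otimes> E\<^sup>*)\<close>.
\<close>

definition decomp ::
  "nat \<Rightarrow> int \<Rightarrow> ('k::field glV list \<Rightarrow> 'k) \<times> ('k glV list \<Rightarrow> 'k) set \<Rightarrow> ('k glV list \<Rightarrow> 'k) set" where
  "decomp n p = (\<lambda>(u, C). (extend n u +o Bfil n p) + quot_map (tensor_E_star n) (Bfil n p) C)"

text \<open>
  The action of \<open>x \<in> \<aa>\<close> on a class of \<open>w \<otimes> E\<^sup>*\<close>, namely \<open>xw \<otimes> E\<^sup>* + w \<otimes> xE\<^sup>*\<close>, where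
  \<open>xE\<^sup>* = (xE\<^sup>*)(E) E\<^sup>*\<close>; the factor \<open>E\<^sup>*\<close> is left out.
\<close>

definition coinv_act ::
  "nat \<Rightarrow> int \<Rightarrow> 'k::field glV \<Rightarrow> ('k glV list \<Rightarrow> 'k) set \<Rightarrow> ('k glV list \<Rightarrow> 'k) set" where
  "coinv_act n q x = quot_map
     (\<lambda>w. contra n (V n) x w + fun_scale (contra n (filiform n) x (E_star n) [E_el]) w) (E_image n q)"


section \<open>Characters of the solvable algebra with nontrivial cohomology\<close>

definition Gam :: "nat \<Rightarrow> int \<Rightarrow> ('k::field glV \<Rightarrow> 'k) set" where
  "Gam n p = {l \<in> characters n (solv n). cohomology n (solv n) l p \<noteq> {coboundaries n (solv n) l p}}"

definition Gam_all :: "nat \<Rightarrow> ('k::field glV \<Rightarrow> 'k) set" where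
  "Gam_all n = (\<Union>p. Gam n p)"

definition weight_pair :: "('k::field glV \<Rightarrow> 'k) \<Rightarrow> 'k \<times> 'k" where
  "weight_pair l = (l H_el, l I_el)"

definition alpha :: "'k::field \<times> 'k" where
  "alpha = (2, 0)"

definition beta :: "nat \<Rightarrow> nat \<Rightarrow> 'k::field \<times> 'k" where
  "beta n k = (of_nat n - 2 * of_nat k, 1)"

definition polygon_vertices :: "nat \<Rightarrow> ('k::field \<times> 'k) list" where
  "polygon_vertices n =
     0 # map (\<lambda>k. alpha + (\<Sum>i<k. beta n i)) [0..<n + 2] @ map (\<lambda>k. \<Sum>i=k..n. beta n i) [0..<n + 1]"

end

theory Submission
  imports Defs
begin

text \<open>
  The forms on a Lie algebra \<open>g\<close> with a codimension one ideal \<open>L\<close> and a complementary line \<open>\<K>x\<close>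
  are pairs \<open>(u, w)\<close> of forms on \<open>L\<close>: \<open>u\<close> is the restriction of the form and \<open>w\<close> the restriction of
  its contraction with \<open>x\<close>.  By Cartan's formula the differential becomes
  \<open>d (u, w) = (d u, \<theta>\<^sub>x u - d w)\<close>, so the complex of \<open>g\<close> is the mapping cone of the Lie derivative
  \<open>\<theta>\<^sub>x\<close> on the complex of \<open>L\<close> (locale \<open>extension\<close>).  This is used for
  \<open>V\<^sub>n \<subset> \<ff>\<^sub>n \<subset> \<K>I \<ltimes> \<ff>\<^sub>n \<subset> \<ss>\<^sub>n\<close>.

  In the first step \<open>d\<close> vanishes on \<open>\<Lambda>V\<^sub>n\<^sup>*\<close>, because \<open>V\<^sub>n\<close> is abelian, so the cohomology is the kernel
  of \<open>E\<close> plus the cokernel of \<open>E\<close> one degree lower.  The kernel in a given weight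
  consists by definition of highest weight vectors.  For the cokernel one needs that
  a weight vector is a lowest weight vector modulo the image of \<open>E\<close>
  (\<open>image_plus_lowest\<close>), an \<open>sl(2)\<close> argument by induction on the
  nilpotency degree of \<open>F\<close>; and that a class of a given weight is represented by a weight
  vector, which holds because \<open>H\<close> and \<open>I\<close> are diagonalizable (\<open>joint_eigenvector\<close>).
  The shift by \<open>(2, 0)\<close> is the weight of \<open>E\<^sup>*\<close> with its sign reversed.

  In the last two steps \<open>\<theta>\<^sub>x\<close> is diagonalizable.  Then its kernel and its
  cokernel on cohomology are both represented by invariant forms, and a cone has cohomology in degree \<open>p\<close> exactly when the
  \<open>x\<close>-invariant forms have some in degree \<open>p\<close> or \<open>p - 1\<close> (\<open>nontrivial_cone\<close>).  Applied with
  \<open>x = I\<close> and \<open>x = H\<close> this gives the degrees \<open>p\<close>, \<open>p - 1\<close>, \<open>p - 2\<close>, and being invariant with coefficients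
  in \<open>\<lambda>\<close> means having weight \<open>-\<lambda>\<close>.

  For the vertices it remains to find weights of the cohomology.  The form
  \<open>e\<^sub>k\<^sup>* \<and> \<dots> \<and> e\<^sub>n\<^sup>*\<close>, with \<open>e\<^sub>j\<close> short for the weight vector \<open>e\<^bsub>n-2j\<^esub>\<close>, has the
  largest possible sum of indices, hence is killed by \<open>E\<close>; and \<open>e\<^sub>0\<^sup>* \<and> \<dots> \<and> e\<^bsub>k-1\<^esub>\<^sup>*\<close> is
  not in the image of \<open>E\<close>, because every form in that image vanishes on \<open>(e\<^sub>0, \<dots>, e\<^bsub>k-1\<^esub>)\<close>.
\<close>

section \<open>Alternating forms\<close>

type_synonym 'k form = "'k glV list \<Rightarrow> 'k"

lemma bracket_add_right: "bracket n x (y + z) = bracket n x y + bracket n x z"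
  using bracket_anticomm[of n x "y + z"] bracket_anticomm[of n x y] bracket_anticomm[of n x z]
  by (simp add: bracket_add_left)

lemma bracket_scale_right: "bracket n x (glV_scale c y) = glV_scale c (bracket n x y)"
  using bracket_anticomm[of n x "glV_scale c y"] bracket_anticomm[of n x y]
  by (simp add: bracket_scale_left)

lemma bracket_zero [simp]: "bracket n 0 x = 0" "bracket n x 0 = 0"
  using bracket_scale_left[of n 0 0 x] bracket_scale_right[of n x 0 0] by simp_all

definition interior :: "'x \<Rightarrow> ('x list \<Rightarrow> 'k) \<Rightarrow> ('x list \<Rightarrow> 'k)" where
  "interior x \<omega> = (\<lambda>ys. \<omega> (x # ys))"

lemma interior_apply [simp]: "interior x \<omega> ys = \<omega> (x # ys)"
  by (simp add: interior_def)

lemma cochain_outside: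
  "\<omega> \<in> cochains L p \<Longrightarrow> \<not> (int (length xs) = p \<and> set xs \<subseteq> L) \<Longrightarrow> \<omega> xs = 0"
  unfolding cochains_def by blast

lemma cochainsI:
  assumes "\<And>xs. \<not> (int (length xs) = p \<and> set xs \<subseteq> L) \<Longrightarrow> \<omega> xs = 0"
    and "\<And>xs i x y. \<lbrakk>set xs \<subseteq> L; i < length xs; x \<in> L; y \<in> L\<rbrakk> \<Longrightarrow>
      \<omega> (xs[i := x + y]) = \<omega> (xs[i := x]) + \<omega> (xs[i := y])"
    and "\<And>xs i x c. \<lbrakk>set xs \<subseteq> L; i < length xs; x \<in> L\<rbrakk> \<Longrightarrow> \<omega> (xs[i := glV_scale c x]) = c * \<omega> (xs[i := x])"
    and "\<And>xs i j. \<lbrakk>i < j; j < length xs; xs ! i = xs ! j\<rbrakk> \<Longrightarrow> \<omega> xs = 0"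
  shows "\<omega> \<in> cochains L p"
  unfolding cochains_def mem_Collect_eq
  by (intro conjI allI impI ballI; (elim conjE)?; rule assms; assumption)

lemma cochain_negative: "\<omega> \<in> cochains L p \<Longrightarrow> p < 0 \<Longrightarrow> \<omega> = 0"
  by (rule ext) (auto dest: cochain_outside)

lemma cochain_add:
  assumes "\<omega> \<in> cochains L p" "set as \<subseteq> L" "set bs \<subseteq> L" "x \<in> L" "y \<in> L"
  shows "\<omega> (as @ (x + y) # bs) = \<omega> (as @ x # bs) + \<omega> (as @ y # bs)"
proof -
  have "set (as @ x # bs) \<subseteq> L \<and> length as < length (as @ x # bs)" using assms by simp
  then have "\<omega> ((as @ x # bs)[length as := x + y])
      = \<omega> ((as @ x # bs)[length as := x]) + \<omega> ((as @ x # bs)[length as := y])"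
    using assms(1,4,5) unfolding cochains_def by blast
  then show ?thesis by simp
qed

lemma cochain_scale:
  assumes "\<omega> \<in> cochains L p" "set as \<subseteq> L" "set bs \<subseteq> L" "x \<in> L"
  shows "\<omega> (as @ glV_scale c x # bs) = c * \<omega> (as @ x # bs)"
proof -
  have "set (as @ x # bs) \<subseteq> L \<and> length as < length (as @ x # bs)" using assms by simp
  then have "\<omega> ((as @ x # bs)[length as := glV_scale c x]) = c * \<omega> ((as @ x # bs)[length as := x])"
    using assms(1,4) unfolding cochains_def by blast
  then show ?thesis by simp
qed

lemmas cochain_add_Cons = cochain_add[where as = "[]", simplified]
lemmas cochain_scale_Cons = cochain_scale[where as = "[]", simplified]

lemma cochain_repeat:
  assumes "\<omega> \<in> cochains L p" "i < j" "j < length xs" "xs ! i = xs ! j"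
  shows "\<omega> xs = 0"
  using assms unfolding cochains_def by blast

lemma cochain_repeat2:
  assumes "\<omega> \<in> cochains L p"
  shows "\<omega> (as @ x # x # bs) = 0"
  by (rule cochain_repeat[OF assms, of "length as" "Suc (length as)"]) (auto simp: nth_append)

lemma cochain_not_distinct: "\<omega> \<in> cochains L p \<Longrightarrow> \<not> distinct xs \<Longrightarrow> \<omega> xs = 0"
  unfolding distinct_conv_nth by (metis cochain_repeat nat_neq_iff)

lemma cochain_swap:
  assumes "\<omega> \<in> cochains L p" "glV.subspace L" "set as \<subseteq> L" "set bs \<subseteq> L" "x \<in> L" "y \<in> L"
  shows "\<omega> (as @ x # y # bs) = - \<omega> (as @ y # x # bs)"
proof -
  have xy: "x + y \<in> L" using assms(2,5,6) by (rule glV.subspace_add)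
  have "0 = \<omega> (as @ (x + y) # (x + y) # bs)" by (simp add: cochain_repeat2[OF assms(1)])
  also have "\<dots> = \<omega> (as @ x # (x + y) # bs) + \<omega> (as @ y # (x + y) # bs)"
    using assms xy by (intro cochain_add) auto
  also have "\<omega> (as @ x # (x + y) # bs) = \<omega> (as @ x # x # bs) + \<omega> (as @ x # y # bs)"
    using assms cochain_add[of \<omega> L p "as @ [x]" bs x y] by simp
  also have "\<omega> (as @ y # (x + y) # bs) = \<omega> (as @ y # x # bs) + \<omega> (as @ y # y # bs)"
    using assms cochain_add[of \<omega> L p "as @ [y]" bs x y] by simp
  finally show ?thesis by (simp add: cochain_repeat2[OF assms(1)] eq_neg_iff_add_eq_0 add.commute)
qed

lemma cochain_move:
  assumes "\<omega> \<in> cochains L p" "glV.subspace L" "set as \<subseteq> L" "set bs \<subseteq> L" "set cs \<subseteq> L" "x \<in> L"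
  shows "\<omega> (as @ x # bs @ cs) = (- 1) ^ length bs * \<omega> (as @ bs @ x # cs)"
  using assms(3,4)
proof (induction bs arbitrary: as)
  case (Cons b bs)
  have "\<omega> (as @ x # b # bs @ cs) = - \<omega> (as @ b # x # bs @ cs)"
    using Cons.prems assms by (intro cochain_swap) auto
  also have "\<omega> (as @ b # x # bs @ cs) = (- 1) ^ length bs * \<omega> (as @ b # bs @ x # cs)"
    using Cons.prems Cons.IH[of "as @ [b]"] by simp
  finally show ?case by simp
qed simp

lemmas cochain_move_front = cochain_move[where as = "[]", simplified]

lemma cochain_replace:
  assumes "\<omega> \<in> cochains L p" "glV.subspace L" "set xs \<subseteq> L" "y \<in> L" "i < length xs"
  shows "\<omega> (xs[i := y]) = (- 1) ^ i * \<omega> (y # omit i xs)"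
proof -
  have "set (take i xs) \<subseteq> L" "set (drop (Suc i) xs) \<subseteq> L"
    using assms(3) set_take_subset set_drop_subset by fastforce+
  then have "\<omega> (y # omit i xs) = (- 1) ^ i * \<omega> (take i xs @ y # drop (Suc i) xs)"
    using cochain_move_front[OF assms(1,2) _ _ assms(4)] assms(5) by (simp add: omit_def min_absorb2)
  then show ?thesis using assms(5) by (simp add: upd_conv_take_nth_drop flip: power_mult_distrib)
qed

lemma cochain_add_form:
  "\<omega> \<in> cochains L p \<Longrightarrow> \<eta> \<in> cochains L p \<Longrightarrow> \<omega> + \<eta> \<in> cochains L p"
  unfolding cochains_def mem_Collect_eq plus_fun_apply
  by (intro conjI; (elim conjE; simp add: algebra_simps)?)

lemma cochain_scale_form: "\<omega> \<in> cochains L p \<Longrightarrow> fun_scale c \<omega> \<in> cochains L p"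
  unfolding cochains_def mem_Collect_eq fun_scale_def
  by (intro conjI; (elim conjE; simp add: algebra_simps)?)

lemma cochain_zero_form [simp]: "0 \<in> cochains L p"
  by (simp add: cochains_def)

lemma subspace_cochains: "funs.subspace (cochains L p)"
  unfolding funs.subspace_def by (auto intro: cochain_add_form cochain_scale_form)

lemma cochain_interior:
  assumes "\<omega> \<in> cochains L p" "x \<in> L"
  shows "interior x \<omega> \<in> cochains L (p - 1)"
proof -
  have "interior x \<omega> xs = 0" if "\<not> (int (length xs) = p - 1 \<and> set xs \<subseteq> L)" for xs
    using that cochain_outside[OF assms(1), of "x # xs"] by auto
  moreover have "interior x \<omega> (xs[i := y + z]) = interior x \<omega> (xs[i := y]) + interior x \<omega> (xs[i := z])
      \<and> interior x \<omega> (xs[i := glV_scale c y]) = c * interior x \<omega> (xs[i := y])"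
    if "set xs \<subseteq> L" "i < length xs" "y \<in> L" "z \<in> L" for xs i y z c
  proof -
    have "set (x # xs) \<subseteq> L \<and> Suc i < length (x # xs)" using that assms by simp
    then have "\<omega> ((x # xs)[Suc i := y + z]) = \<omega> ((x # xs)[Suc i := y]) + \<omega> ((x # xs)[Suc i := z])"
      and "\<omega> ((x # xs)[Suc i := glV_scale c y]) = c * \<omega> ((x # xs)[Suc i := y])"
      using assms(1) that(3,4) unfolding cochains_def by blast+
    then show ?thesis by simp
  qed
  moreover have "interior x \<omega> xs = 0" if "i < j" "j < length xs" "xs ! i = xs ! j" for xs i j
    using that cochain_repeat[OF assms(1), of "Suc i" "Suc j" "x # xs"] by simp
  ultimately show ?thesis unfolding cochains_def by blast
qed

text \<open>
  Forms are often given by recursion on the first argument.  Moving an argument that repeats the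
  first one into the second place reduces the alternating law to the premise \<open>alt\<close>.
\<close>

lemma cochainI_Cons:
  assumes L: "glV.subspace L"
    and outside: "\<And>xs. \<not> (int (length xs) = p \<and> set xs \<subseteq> L) \<Longrightarrow> \<omega> xs = 0"
    and tail: "\<And>x. x \<in> L \<Longrightarrow> interior x \<omega> \<in> cochains L (p - 1)"
    and add: "\<And>x y xs. \<lbrakk>x \<in> L; y \<in> L; set xs \<subseteq> L\<rbrakk> \<Longrightarrow> \<omega> ((x + y) # xs) = \<omega> (x # xs) + \<omega> (y # xs)"
    and scale: "\<And>c x xs. \<lbrakk>x \<in> L; set xs \<subseteq> L\<rbrakk> \<Longrightarrow> \<omega> (glV_scale c x # xs) = c * \<omega> (x # xs)"
    and alt: "\<And>x xs. \<lbrakk>x \<in> L; set xs \<subseteq> L\<rbrakk> \<Longrightarrow> \<omega> (x # x # xs) = 0"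
  shows "\<omega> \<in> cochains L p"
proof -
  have lin: "\<omega> (xs[i := x + y]) = \<omega> (xs[i := x]) + \<omega> (xs[i := y])
      \<and> \<omega> (xs[i := glV_scale c x]) = c * \<omega> (xs[i := x])"
    if "set xs \<subseteq> L" "i < length xs" "x \<in> L" "y \<in> L" for xs i x y c
  proof (cases xs)
    case (Cons z zs)
    show ?thesis
    proof (cases i)
      case 0
      with Cons that show ?thesis by (simp add: add scale)
    next
      case (Suc j)
      have "set zs \<subseteq> L \<and> j < length zs" using that Cons Suc by simp
      moreover have "interior z \<omega> \<in> cochains L (p - 1)" using tail that Cons by simp
      ultimately have "interior z \<omega> (zs[j := x + y]) = interior z \<omega> (zs[j := x]) + interior z \<omega> (zs[j := y])
          \<and> interior z \<omega> (zs[j := glV_scale c x]) = c * interior z \<omega> (zs[j := x])"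
        using that(3,4) unfolding cochains_def by blast
      then show ?thesis using Cons Suc by simp
    qed
  qed (use that in simp)
  have rep: "\<omega> xs = 0" if "i < j" "j < length xs" "xs ! i = xs ! j" for xs i j
  proof (cases "set xs \<subseteq> L")
    case True
    obtain z zs where xs: "xs = z # zs" using \<open>j < length xs\<close> by (cases xs) auto
    have z: "z \<in> L" "set zs \<subseteq> L" using True xs by auto
    note zs = tail[OF z(1)]
    show ?thesis
    proof (cases i)
      case 0
      then obtain k where k: "j = Suc k" "k < length zs" "zs ! k = z"
        using \<open>i < j\<close> \<open>j < length xs\<close> \<open>xs ! i = xs ! j\<close> xs by (cases j) auto
      have sub: "set (take k zs) \<subseteq> L" "set (drop (Suc k) zs) \<subseteq> L"
        using z(2) set_take_subset set_drop_subset by fastforce+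
      have "interior z \<omega> (z # take k zs @ drop (Suc k) zs)
          = (- 1) ^ length (take k zs) * interior z \<omega> (take k zs @ z # drop (Suc k) zs)"
        by (rule cochain_move_front[OF zs L sub z(1)])
      also have "take k zs @ z # drop (Suc k) zs = zs" using k id_take_nth_drop by metis
      finally show ?thesis using alt[OF z(1), of "take k zs @ drop (Suc k) zs"] sub xs by simp
    next
      case (Suc k)
      then show ?thesis using cochain_repeat[OF zs, of k "j - 1" zs] that xs by (cases j) auto
    qed
  qed (use outside in blast)
  show ?thesis using outside lin rep unfolding cochains_def by blast
qed

lemma cochain_zero_arg:
  assumes "\<omega> \<in> cochains L p" "0 \<in> set xs"
  shows "\<omega> xs = 0"
proof (cases "set xs \<subseteq> L")
  case True
  obtain as bs where "xs = as @ 0 # bs" using assms(2) by (meson split_list)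
  then show ?thesis using cochain_scale[OF assms(1), of as bs 0 0] True by simp
qed (use assms(1) cochain_outside in blast)

text \<open>Forms are compared on spanning sets, so no basis and no expansion in coordinates is needed.\<close>

lemma cochain_eqI_span:
  assumes \<omega>: "\<omega> \<in> cochains (glV.span S) p" "\<eta> \<in> cochains (glV.span S) p"
    and eq: "\<And>xs. set xs \<subseteq> S \<Longrightarrow> \<omega> xs = \<eta> xs"
  shows "\<omega> = \<eta>"
proof
  fix xs
  let ?L = "glV.span S"
  have *: "\<omega> (as @ bs) = \<eta> (as @ bs)" if "set as \<subseteq> ?L" "set bs \<subseteq> S" for as bs
    using that
  proof (induction as arbitrary: bs rule: rev_induct)
    case (snoc a as)
    have as: "set as \<subseteq> ?L" and a: "a \<in> ?L" using snoc.prems by auto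
    have bs: "set bs \<subseteq> ?L" using snoc.prems glV.span_superset by blast
    have "a \<in> ?L \<and> \<omega> (as @ a # bs) = \<eta> (as @ a # bs)" using a
    proof (induction rule: glV.span_induct_alt)
      case base
      show ?case using cochain_zero_arg[OF \<omega>(1), of "(as @ [0]) @ bs"]
          cochain_zero_arg[OF \<omega>(2), of "(as @ [0]) @ bs"] glV.span_zero by simp
    next
      case (step c x y)
      have mem: "x \<in> ?L" "glV_scale c x \<in> ?L" "y \<in> ?L"
        using step(1) glV.span_base[of x S] glV.span_scale[of x S c] step(2) by auto
      have "\<omega> (as @ x # bs) = \<eta> (as @ x # bs)"
        using snoc.IH[of "x # bs"] as snoc.prems(2) step(1) by simp
      then show ?case using step(2) mem(2,3) by (simp add: cochain_add[OF \<omega>(1) as bs mem(2,3)]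
          cochain_add[OF \<omega>(2) as bs mem(2,3)] cochain_scale[OF \<omega>(1) as bs mem(1)]
          cochain_scale[OF \<omega>(2) as bs mem(1)] glV.span_add)
    qed
    then show ?case by simp
  qed (use eq in simp)
  show "\<omega> xs = \<eta> xs"
  proof (cases "set xs \<subseteq> ?L")
    case True
    then show ?thesis using *[of xs "[]"] by simp
  next
    case False
    then show ?thesis using \<omega> cochain_outside by metis
  qed
qed

section \<open>Cartan calculus\<close>

lemma fun_scale_apply [simp]: "fun_scale c f x = c * f x"
  by (simp add: fun_scale_def)

lemma cochain_diff_form: "\<omega> \<in> cochains L p \<Longrightarrow> \<eta> \<in> cochains L p \<Longrightarrow> \<omega> - \<eta> \<in> cochains L p"
  by (rule funs.subspace_diff[OF subspace_cochains])

lemma interior_linear [simp]: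
  "interior x (\<omega> + \<eta>) = interior x \<omega> + interior x \<eta>"
  "interior x (\<omega> - \<eta>) = interior x \<omega> - (interior x \<eta> :: 'x list \<Rightarrow> 'k::field)"
  "interior x (fun_scale c \<omega>) = fun_scale c (interior x \<omega>)"
  "interior x 0 = (0 :: 'x list \<Rightarrow> 'k)"
  by (simp_all add: fun_eq_iff)

lemma interior_add:
  assumes "\<omega> \<in> cochains L p" "x \<in> L" "y \<in> L" "glV.subspace L"
  shows "interior (x + y) \<omega> = interior x \<omega> + interior y \<omega>"
proof
  fix xs show "interior (x + y) \<omega> xs = (interior x \<omega> + interior y \<omega>) xs"
  proof (cases "set xs \<subseteq> L")
    case True
    then show ?thesis using cochain_add_Cons[OF assms(1)] assms(2,3) by simp
  next
    case False
    then have "\<omega> (z # xs) = 0" for z using cochain_outside[OF assms(1)] by auto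
    then show ?thesis by simp
  qed
qed

lemma interior_scale:
  assumes "\<omega> \<in> cochains L p" "x \<in> L"
  shows "interior (glV_scale c x) \<omega> = fun_scale c (interior x \<omega>)"
proof
  fix xs show "interior (glV_scale c x) \<omega> xs = fun_scale c (interior x \<omega>) xs"
  proof (cases "set xs \<subseteq> L")
    case True
    then show ?thesis using cochain_scale_Cons[OF assms(1)] assms(2) by simp
  next
    case False
    then have "\<omega> (z # xs) = 0" for z using cochain_outside[OF assms(1)] by auto
    then show ?thesis by simp
  qed
qed

lemma interior_zero: "\<omega> \<in> cochains L p \<Longrightarrow> interior 0 \<omega> = 0"
  using cochain_zero_arg by (fastforce simp: fun_eq_iff)

lemma interior_interior: "\<omega> \<in> cochains L p \<Longrightarrow> interior x (interior x \<omega>) = 0"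
  using cochain_repeat2[where as = "[]"] by (fastforce simp: fun_eq_iff)

lemma omit_Cons [simp]: "omit 0 (x # xs) = xs" "omit (Suc i) (x # xs) = x # omit i xs"
  by (simp_all add: omit_def)

lemma length_omit: "i < length xs \<Longrightarrow> length (omit i xs) = length xs - 1"
  by (simp add: omit_def)

lemma set_omit_subset: "set (omit i xs) \<subseteq> set xs"
  unfolding omit_def using set_take_subset set_drop_subset by fastforce

definition normalizes :: "nat \<Rightarrow> 'k::field glV \<Rightarrow> 'k glV set \<Rightarrow> bool" where
  "normalizes n x L \<longleftrightarrow> (\<forall>y\<in>L. bracket n x y \<in> L)"

lemma normalizes_span:
  assumes "\<And>s. s \<in> S \<Longrightarrow> bracket n x s \<in> glV.span S"
  shows "normalizes n x (glV.span S)"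
  unfolding normalizes_def
proof
  fix y assume "y \<in> glV.span S"
  then show "bracket n x y \<in> glV.span S"
  proof (induction rule: glV.span_induct_alt)
    case (step c s y)
    then show ?case using assms
      by (simp add: bracket_add_right bracket_scale_right glV.span_add glV.span_scale)
  qed (simp add: glV.span_zero)
qed

lemma contra_outside: "\<not> set xs \<subseteq> L \<Longrightarrow> contra n L x \<omega> xs = 0"
  by (auto simp: contra_def)

lemma contra_Nil [simp]: "contra n L x \<omega> [] = 0"
  by (simp add: contra_def)

lemma contra_linear:
  "contra n L x (\<omega> + \<eta>) = contra n L x \<omega> + contra n L x \<eta>"
  "contra n L x (\<omega> - \<eta>) = contra n L x \<omega> - contra n L x \<eta>"
  "contra n L x (fun_scale c \<omega>) = fun_scale c (contra n L x \<omega>)"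
  "contra n L x 0 = 0"
  by (simp_all add: fun_eq_iff contra_def sum.distrib sum_subtractf sum_distrib_left)

lemma contra_Cons:
  assumes "y \<in> L" "set ys \<subseteq> L"
  shows "contra n L x \<omega> (y # ys) = contra n L x (interior y \<omega>) ys - \<omega> (bracket n x y # ys)"
  using assms by (simp add: contra_def sum.lessThan_Suc_shift del: sum.lessThan_Suc)

lemma contra_interior:
  assumes "\<omega> \<in> cochains L p" "y \<in> L"
  shows "interior y (contra n L x \<omega>) = contra n L x (interior y \<omega>) - interior (bracket n x y) \<omega>"
proof
  fix ys show "interior y (contra n L x \<omega>) ys
      = (contra n L x (interior y \<omega>) - interior (bracket n x y) \<omega>) ys"
  proof (cases "set ys \<subseteq> L")
    case True
    then show ?thesis using contra_Cons[OF assms(2)] by simp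
  next
    case False
    then have "\<omega> (z # ys) = 0" for z using cochain_outside[OF assms(1)] by auto
    then show ?thesis using False by (simp add: contra_outside)
  qed
qed

text \<open>
  An operator whose commutator with every \<^const>\<open>interior\<close> is known is controlled by its effect
  in lower degree.  Membership in \<^const>\<open>cochains\<close> is proved by this rule, identities between
  operators by induction on the list of arguments.
\<close>

lemma degree_induct [consumes 1, case_names negative step]:
  assumes "\<omega> \<in> cochains L p"
    and "\<And>p \<omega>. p < 0 \<Longrightarrow> \<omega> \<in> cochains L p \<Longrightarrow> P p \<omega>"
    and "\<And>p \<omega>. 0 \<le> p \<Longrightarrow> \<omega> \<in> cochains L p \<Longrightarrow> (\<And>\<eta>. \<eta> \<in> cochains L (p - 1) \<Longrightarrow> P (p - 1) \<eta>) \<Longrightarrow> P p \<omega>"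
  shows "P p (\<omega> :: 'k::field form)"
proof -
  have "p < int k \<Longrightarrow> \<omega> \<in> cochains L p \<Longrightarrow> P p \<omega>" for k p \<omega>
  proof (induction k arbitrary: p \<omega>)
    case (Suc k)
    show ?case
    proof (cases "p < 0")
      case False
      show ?thesis by (rule assms(3)) (use False Suc in auto)
    qed (use assms(2) Suc in auto)
  qed (use assms(2) in auto)
  from this[of p "nat (p + 1)"] show ?thesis using assms(1) by auto
qed

lemma cochain_contra:
  assumes "\<omega> \<in> cochains L p" "glV.subspace L" "normalizes n x L"
  shows "contra n L x \<omega> \<in> cochains L p"
  using assms(1)
proof (induction rule: degree_induct)
  case (negative p \<omega>)
  have "contra n L x 0 \<in> cochains L p" by (simp add: contra_linear)
  then show ?case by (simp only: cochain_negative[OF negative(2,1)])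
next
  case (step p \<omega>)
  note L = assms(2)
  have br: "bracket n x y \<in> L" if "y \<in> L" for y using that assms(3) by (simp add: normalizes_def)
  show ?case
  proof (rule cochainI_Cons[OF L])
    show "contra n L x \<omega> xs = 0" if "\<not> (int (length xs) = p \<and> set xs \<subseteq> L)" for xs
    proof (cases "set xs \<subseteq> L")
      case True
      with that have "\<omega> (xs[i := y]) = 0" for i y using cochain_outside[OF step(2)] by simp
      then show ?thesis by (simp add: contra_def)
    qed (rule contra_outside)
    show "interior y (contra n L x \<omega>) \<in> cochains L (p - 1)" if "y \<in> L" for y
      using that step br by (simp add: contra_interior cochain_diff_form cochain_interior)
    show "contra n L x \<omega> ((y + z) # ys) = contra n L x \<omega> (y # ys) + contra n L x \<omega> (z # ys)"
      if "y \<in> L" "z \<in> L" "set ys \<subseteq> L" for y z ys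
      using that by (simp add: contra_Cons glV.subspace_add[OF L] interior_add[OF step(2) _ _ L]
          contra_linear bracket_add_right cochain_add_Cons[OF step(2)] br)
    show "contra n L x \<omega> (glV_scale c y # ys) = c * contra n L x \<omega> (y # ys)"
      if "y \<in> L" "set ys \<subseteq> L" for c y ys
      using that by (simp add: contra_Cons glV.subspace_scale[OF L] interior_scale[OF step(2)]
          contra_linear bracket_scale_right cochain_scale_Cons[OF step(2)] br algebra_simps)
    show "contra n L x \<omega> (y # y # ys) = 0" if "y \<in> L" "set ys \<subseteq> L" for y ys
      using that cochain_swap[OF step(2) L, of "[]" ys y "bracket n x y"] br
      by (simp add: contra_Cons interior_interior[OF step(2)] contra_linear)
  qed
qed

lemma cochain_add_update:
  assumes "\<omega> \<in> cochains L p" "set xs \<subseteq> L" "i < length xs" "x \<in> L" "y \<in> L"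
  shows "\<omega> (xs[i := x + y]) = \<omega> (xs[i := x]) + \<omega> (xs[i := y])"
  using assms unfolding cochains_def by blast

lemma cochain_scale_update:
  assumes "\<omega> \<in> cochains L p" "set xs \<subseteq> L" "i < length xs" "x \<in> L"
  shows "\<omega> (xs[i := glV_scale c x]) = c * \<omega> (xs[i := x])"
  using assms unfolding cochains_def by blast

lemma contra_add_left:
  assumes "\<omega> \<in> cochains L p" "normalizes n x L" "normalizes n y L"
  shows "contra n L (x + y) \<omega> = contra n L x \<omega> + contra n L y \<omega>"
proof
  fix xs
  have "\<omega> (xs[i := bracket n (x + y) (xs ! i)])
      = \<omega> (xs[i := bracket n x (xs ! i)]) + \<omega> (xs[i := bracket n y (xs ! i)])"
    if "set xs \<subseteq> L" "i < length xs" for i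
  proof -
    have "xs ! i \<in> L" using that by auto
    then show ?thesis unfolding bracket_add_left
      using assms(2,3) by (intro cochain_add_update[OF assms(1) that]) (auto simp: normalizes_def)
  qed
  then show "contra n L (x + y) \<omega> xs = (contra n L x \<omega> + contra n L y \<omega>) xs"
    by (simp add: contra_def sum.distrib)
qed

lemma contra_scale_left:
  assumes "\<omega> \<in> cochains L p" "normalizes n x L"
  shows "contra n L (glV_scale c x) \<omega> = fun_scale c (contra n L x \<omega>)"
proof
  fix xs
  have "\<omega> (xs[i := bracket n (glV_scale c x) (xs ! i)]) = c * \<omega> (xs[i := bracket n x (xs ! i)])"
    if "set xs \<subseteq> L" "i < length xs" for i
  proof -
    have "xs ! i \<in> L" using that by auto
    then show ?thesis unfolding bracket_scale_left
      using assms(2) by (intro cochain_scale_update[OF assms(1) that]) (auto simp: normalizes_def)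
  qed
  then show "contra n L (glV_scale c x) \<omega> xs = fun_scale c (contra n L x \<omega>) xs"
    by (simp add: contra_def sum_distrib_left)
qed

lemma normalizes_bracket:
  fixes x y :: "'k::field_char_0 glV"
  assumes "glV.subspace L" "normalizes n x L" "normalizes n y L"
  shows "normalizes n (bracket n x y) L"
    and "bracket n (bracket n x y) z = bracket n x (bracket n y z) - bracket n y (bracket n x z)"
proof -
  show *: "bracket n (bracket n x y) z = bracket n x (bracket n y z) - bracket n y (bracket n x z)" for z
  proof -
    have "bracket n z x = - bracket n x z" "bracket n z (bracket n x y) = - bracket n (bracket n x y) z"
      by (rule bracket_anticomm)+
    moreover have "bracket n y (- bracket n x z) = - bracket n y (bracket n x z)"
      using bracket_add_right[of n y "bracket n x z" "- bracket n x z"] by (simp add: add_eq_0_iff)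
    ultimately show ?thesis
      using bracket_jacobi[of n x y z] by (simp add: algebra_simps add_eq_0_iff)
  qed
  show "normalizes n (bracket n x y) L"
    using assms by (simp add: normalizes_def * glV.subspace_diff)
qed

lemma interior_diff:
  assumes "\<omega> \<in> cochains L p" "x \<in> L" "y \<in> L" "glV.subspace L"
  shows "interior (x - y) \<omega> = interior x \<omega> - interior y \<omega>"
  using interior_add[OF assms(1) glV.subspace_diff[OF assms(4,2,3)] assms(3,4)] by simp

text \<open>
  Contracting both sides with \<open>z\<close> gives the same identity for the contracted form and, besides, two terms
  that agree by the Jacobi identity.
\<close>

lemma contra_commutator:
  fixes x y :: "'k::field_char_0 glV"
  assumes "\<omega> \<in> cochains L p" and L: "glV.subspace L" and nx: "normalizes n x L" and ny: "normalizes n y L"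
  shows "contra n L x (contra n L y \<omega>) - contra n L y (contra n L x \<omega>) = contra n L (bracket n x y) \<omega>"
proof
  fix xs
  show "(contra n L x (contra n L y \<omega>) - contra n L y (contra n L x \<omega>)) xs
      = contra n L (bracket n x y) \<omega> xs"
    using assms(1)
  proof (induction xs arbitrary: \<omega> p)
    case (Cons z zs)
    show ?case
    proof (cases "z \<in> L")
      case True
      let ?c = "\<lambda>x. contra n L x" and ?b = "bracket n"
      have b: "?b x z \<in> L" "?b y z \<in> L" "?b x (?b y z) \<in> L" "?b y (?b x z) \<in> L"
        using True nx ny by (auto simp: normalizes_def)
      note c = cochain_contra[OF Cons.prems L]
      have "interior z (?c x (?c y \<omega>) - ?c y (?c x \<omega>))
          = ?c x (?c y (interior z \<omega>)) - ?c y (?c x (interior z \<omega>))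
            - (interior (?b x (?b y z)) \<omega> - interior (?b y (?b x z)) \<omega>)"
        by (simp add: contra_interior[OF Cons.prems] contra_interior[OF c] contra_linear True nx ny b)
      also have "interior (?b x (?b y z)) \<omega> - interior (?b y (?b x z)) \<omega>
          = interior (?b (?b x y) z) \<omega>"
        unfolding normalizes_bracket(2)[OF L nx ny] using interior_diff[OF Cons.prems b(3,4) L] by simp
      finally have eq: "interior z (?c x (?c y \<omega>) - ?c y (?c x \<omega>))
          = ?c x (?c y (interior z \<omega>)) - ?c y (?c x (interior z \<omega>)) - interior (?b (?b x y) z) \<omega>" .
      have "interior z (?c x (?c y \<omega>) - ?c y (?c x \<omega>)) zs
          = (?c x (?c y (interior z \<omega>)) - ?c y (?c x (interior z \<omega>))) zs - interior (?b (?b x y) z) \<omega> zs"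
        unfolding eq by simp
      also have "\<dots> = interior z (?c (?b x y) \<omega>) zs"
        unfolding contra_interior[OF Cons.prems True] minus_apply[of _ _ zs]
        by (rule arg_cong2[where f = "(-)"], rule Cons.IH[OF cochain_interior[OF Cons.prems True], simplified minus_apply], rule refl)
      finally show ?thesis by simp
    qed (simp add: contra_outside)
  qed simp
qed

text \<open>
  The action of \<open>x\<close> on forms with values in the one-dimensional module \<open>l\<close>.
\<close>

definition lie_der :: "nat \<Rightarrow> 'k::field glV set \<Rightarrow> ('k glV \<Rightarrow> 'k) \<Rightarrow> 'k glV \<Rightarrow> ('k form) \<Rightarrow> ('k form)"
  where "lie_der n L l x \<omega> = contra n L x \<omega> + fun_scale (l x) \<omega>"

lemma lie_der_linear:
  "lie_der n L l x (\<omega> + \<eta>) = lie_der n L l x \<omega> + lie_der n L l x \<eta>"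
  "lie_der n L l x (\<omega> - \<eta>) = lie_der n L l x \<omega> - lie_der n L l x \<eta>"
  "lie_der n L l x (fun_scale c \<omega>) = fun_scale c (lie_der n L l x \<omega>)"
  "lie_der n L l x 0 = 0"
  by (simp_all add: lie_der_def contra_linear fun_eq_iff algebra_simps)

lemma cochain_lie_der:
  assumes "\<omega> \<in> cochains L p" "glV.subspace L" "normalizes n x L"
  shows "lie_der n L l x \<omega> \<in> cochains L p"
  using assms by (simp add: lie_der_def cochain_contra cochain_add_form cochain_scale_form)

lemma lie_der_interior:
  assumes "\<omega> \<in> cochains L p" "y \<in> L"
  shows "interior y (lie_der n L l x \<omega>) = lie_der n L l x (interior y \<omega>) - interior (bracket n x y) \<omega>"
  using contra_interior[OF assms] by (simp add: lie_der_def)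

lemma lie_der_commutator:
  fixes x y :: "'k::field_char_0 glV"
  assumes "\<omega> \<in> cochains L p" "glV.subspace L" "normalizes n x L" "normalizes n y L" "l (bracket n x y) = 0"
  shows "lie_der n L l x (lie_der n L l y \<omega>) - lie_der n L l y (lie_der n L l x \<omega>)
    = lie_der n L l (bracket n x y) \<omega>"
  using contra_commutator[OF assms(1-4)] assms(5)
  by (simp add: lie_der_def contra_linear fun_eq_iff algebra_simps)

lemma CE_d_linear:
  "CE_d n L l (\<omega> + \<eta>) = CE_d n L l \<omega> + CE_d n L l \<eta>"
  "CE_d n L l (\<omega> - \<eta>) = CE_d n L l \<omega> - CE_d n L l \<eta>"
  "CE_d n L l (fun_scale c \<omega>) = fun_scale c (CE_d n L l \<omega>)"
  "CE_d n L l 0 = 0"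
  by (simp_all add: fun_eq_iff CE_d_def sum.distrib sum_subtractf sum_distrib_left algebra_simps)

lemma CE_d_Nil [simp]: "CE_d n L l \<omega> [] = 0"
  by (simp add: CE_d_def)

lemma CE_d_outside: "\<not> set xs \<subseteq> L \<Longrightarrow> CE_d n L l \<omega> xs = 0"
  by (auto simp: CE_d_def)

locale lie_character =
  fixes n :: nat and L :: "'k::field_char_0 glV set" and l :: "'k glV \<Rightarrow> 'k"
  assumes subspace: "glV.subspace L"
    and closed: "\<And>x y. x \<in> L \<Longrightarrow> y \<in> L \<Longrightarrow> bracket n x y \<in> L"
    and l_add: "\<And>x y. x \<in> L \<Longrightarrow> y \<in> L \<Longrightarrow> l (x + y) = l x + l y"
    and l_scale: "\<And>c x. x \<in> L \<Longrightarrow> l (glV_scale c x) = c * l x"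
    and l_bracket: "\<And>x y. x \<in> L \<Longrightarrow> y \<in> L \<Longrightarrow> l (bracket n x y) = 0"
begin

lemma normalizes: "x \<in> L \<Longrightarrow> normalizes n x L"
  by (simp add: normalizes_def closed)

text \<open>
  Cartan's formula \<open>\<iota>\<^sub>x d + d \<iota>\<^sub>x = \<theta>\<^sub>x\<close>.  In the double sum defining \<open>d\<close> the terms that
  involve the first argument \<open>x\<close> make up \<open>\<theta>\<^sub>x\<close>; in the others \<open>x\<close> moves past one bracket, which accounts
  for the sign.
\<close>

lemma cartan:
  assumes \<omega>: "\<omega> \<in> cochains L p" and x: "x \<in> L"
  shows "interior x (CE_d n L l \<omega>) = lie_der n L l x \<omega> - CE_d n L l (interior x \<omega>)"
proof
  fix xs
  show "interior x (CE_d n L l \<omega>) xs = (lie_der n L l x \<omega> - CE_d n L l (interior x \<omega>)) xs"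
  proof (cases "set xs \<subseteq> L")
    case True
    let ?m = "length xs"
    have nth: "xs ! i \<in> L" if "i < ?m" for i using that True by auto
    have omit: "set (omit i (omit j xs)) \<subseteq> L" for i j
      using True set_omit_subset[of i "omit j xs"] set_omit_subset[of j xs] by simp
    have "(\<Sum>i<length (x # xs). (- 1) ^ i * l ((x # xs) ! i) * \<omega> (omit i (x # xs)))
        = l x * \<omega> xs - (\<Sum>i<?m. (- 1) ^ i * l (xs ! i) * interior x \<omega> (omit i xs))"
      by (simp add: sum.lessThan_Suc_shift sum_negf del: sum.lessThan_Suc)
    moreover have "(\<Sum>j<length (x # xs). \<Sum>i<j. (- 1) ^ (i + j) *
          \<omega> (bracket n ((x # xs) ! i) ((x # xs) ! j) # omit i (omit j (x # xs))))
        = (\<Sum>j<?m. - ((- 1) ^ j * \<omega> (bracket n x (xs ! j) # omit j xs)))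
          + (\<Sum>j<?m. \<Sum>i<j. (- 1) ^ (i + j) * \<omega> (bracket n (xs ! i) (xs ! j) # x # omit i (omit j xs)))"
      by (simp add: sum.lessThan_Suc_shift sum.distrib sum_negf sum_subtractf del: sum.lessThan_Suc)
    moreover have "(\<Sum>j<?m. - ((- 1) ^ j * \<omega> (bracket n x (xs ! j) # omit j xs))) = contra n L x \<omega> xs"
      using True by (simp add: contra_def sum_negf cochain_replace[OF \<omega> subspace True closed[OF x nth]])
    moreover have "(\<Sum>j<?m. \<Sum>i<j. (- 1) ^ (i + j) * \<omega> (bracket n (xs ! i) (xs ! j) # x # omit i (omit j xs)))
        = (\<Sum>j<?m. \<Sum>i<j. - ((- 1) ^ (i + j) * interior x \<omega> (bracket n (xs ! i) (xs ! j) # omit i (omit j xs))))"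
    proof (intro sum.cong refl)
      fix j i assume "j \<in> {..<?m}" "i \<in> {..<j}"
      then have "bracket n (xs ! i) (xs ! j) \<in> L" using nth closed by simp
      from cochain_swap[OF \<omega> subspace _ omit this x, of "[]" i j]
      show "(- 1) ^ (i + j) * \<omega> (bracket n (xs ! i) (xs ! j) # x # omit i (omit j xs))
          = - ((- 1) ^ (i + j) * interior x \<omega> (bracket n (xs ! i) (xs ! j) # omit i (omit j xs)))"
        by simp
    qed
    ultimately show ?thesis
      using True x by (simp only: CE_d_def interior_apply lie_der_def) (simp add: CE_d_def sum_negf)
  next
    case False
    then show ?thesis using cochain_outside[OF \<omega>]
      by (simp add: CE_d_outside lie_der_def contra_outside)
  qed
qed

text \<open>
  By Cartan's formula, applied twice, \<open>d\<omega>\<close> with its first two arguments equal to \<open>x\<close> is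
  \<open>\<iota>\<^sub>x \<theta>\<^sub>x \<omega> - \<theta>\<^sub>x \<iota>\<^sub>x \<omega> = - \<iota>\<^bsub>[x,x]\<^esub> \<omega> = 0\<close>; the rest is induction on the degree.
\<close>

lemma cochain_CE_d:
  assumes "\<omega> \<in> cochains L p"
  shows "CE_d n L l \<omega> \<in> cochains L (p + 1)"
  using assms
proof (induction rule: degree_induct)
  case (negative p \<omega>)
  have "CE_d n L l 0 \<in> cochains L (p + 1)" by (simp add: CE_d_linear)
  then show ?case by (simp only: cochain_negative[OF negative(2,1)])
next
  case (step p \<omega>)
  have IH: "CE_d n L l \<eta> \<in> cochains L p" if "\<eta> \<in> cochains L (p - 1)" for \<eta>
    using step(3)[OF that] by simp
  have Cons: "CE_d n L l \<omega> (x # xs) = contra n L x \<omega> xs + l x * \<omega> xs - CE_d n L l (interior x \<omega>) xs"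
    if "x \<in> L" for x xs
    using fun_cong[OF cartan[OF step(2) that], of xs] by (simp add: lie_der_def)
  show ?case
  proof (rule cochainI_Cons[OF subspace])
    show "CE_d n L l \<omega> xs = 0" if "\<not> (int (length xs) = p + 1 \<and> set xs \<subseteq> L)" for xs
    proof (cases "set xs \<subseteq> L")
      case True
      with that have len: "int (length xs) \<noteq> p + 1" by simp
      have "\<omega> (omit i xs) = 0" if "i < length xs" for i
        using that len cochain_outside[OF step(2), of "omit i xs"] by (simp add: length_omit)
      moreover have "\<omega> (y # omit i (omit j xs)) = 0" if "i < j" "j < length xs" for i j y
        using that len cochain_outside[OF step(2), of "y # omit i (omit j xs)"] by (simp add: length_omit)
      ultimately show ?thesis by (simp add: CE_d_def)
    qed (rule CE_d_outside)
    show "interior x (CE_d n L l \<omega>) \<in> cochains L (p + 1 - 1)" if "x \<in> L" for x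
      using that by (simp add: cartan[OF step(2)] cochain_diff_form cochain_lie_der[OF step(2) subspace]
          normalizes IH cochain_interior[OF step(2)])
    show "CE_d n L l \<omega> ((x + y) # xs) = CE_d n L l \<omega> (x # xs) + CE_d n L l \<omega> (y # xs)"
      if "x \<in> L" "y \<in> L" "set xs \<subseteq> L" for x y xs
      using that by (simp add: Cons glV.subspace_add[OF subspace] l_add CE_d_linear
          contra_add_left[OF step(2)] normalizes interior_add[OF step(2) _ _ subspace] algebra_simps)
    show "CE_d n L l \<omega> (glV_scale c x # xs) = c * CE_d n L l \<omega> (x # xs)"
      if "x \<in> L" "set xs \<subseteq> L" for c x xs
      using that by (simp add: Cons glV.subspace_scale[OF subspace] l_scale CE_d_linear
          contra_scale_left[OF step(2)] normalizes interior_scale[OF step(2)] algebra_simps)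
    show "CE_d n L l \<omega> (x # x # xs) = 0" if x: "x \<in> L" and xs: "set xs \<subseteq> L" for x xs
    proof -
      have "CE_d n L l (interior x \<omega>) (x # xs) = lie_der n L l x (interior x \<omega>) xs"
        using fun_cong[OF cartan[OF cochain_interior[OF step(2) x] x], of xs]
        by (simp add: interior_interior[OF step(2)] CE_d_linear)
      also have "\<dots> = lie_der n L l x \<omega> (x # xs)"
        using fun_cong[OF lie_der_interior[OF step(2) x], of n l x xs]
        by (simp add: bracket_self interior_zero[OF step(2)])
      finally show ?thesis using Cons[OF x, of "x # xs"] by (simp add: lie_der_def)
    qed
  qed
qed

text \<open>
  The element \<open>x\<close> only has to normalize \<open>L\<close>; below it is \<open>H\<close> or \<open>I\<close> acting on the forms of an
  ideal.
\<close>

lemma lie_der_CE_d: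
  assumes "\<omega> \<in> cochains L p" and x: "normalizes n x L" and lx: "\<And>y. y \<in> L \<Longrightarrow> l (bracket n x y) = 0"
  shows "lie_der n L l x (CE_d n L l \<omega>) = CE_d n L l (lie_der n L l x \<omega>)"
proof
  let ?\<theta> = "lie_der n L l" and ?d = "CE_d n L l"
  fix xs show "?\<theta> x (?d \<omega>) xs = ?d (?\<theta> x \<omega>) xs"
    using assms(1)
  proof (induction xs arbitrary: \<omega> p)
    case Nil
    then show ?case by (simp add: lie_der_def)
  next
    case (Cons z zs)
    show ?case
    proof (cases "z \<in> L")
      case z: True
      have xz: "bracket n x z \<in> L" using x z by (simp add: normalizes_def)
      note \<omega> = Cons.prems
      have "interior z (?\<theta> x (?d \<omega>)) = ?\<theta> x (interior z (?d \<omega>)) - interior (bracket n x z) (?d \<omega>)"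
        by (rule lie_der_interior[OF cochain_CE_d[OF \<omega>] z])
      also have "\<dots> = ?\<theta> x (?\<theta> z \<omega>) - ?\<theta> x (?d (interior z \<omega>))
          - ?\<theta> (bracket n x z) \<omega> + ?d (interior (bracket n x z) \<omega>)"
        by (simp add: cartan[OF \<omega>] z xz lie_der_linear)
      also have "?\<theta> (bracket n x z) \<omega> = ?\<theta> x (?\<theta> z \<omega>) - ?\<theta> z (?\<theta> x \<omega>)"
        by (rule lie_der_commutator[OF \<omega> subspace x normalizes[OF z], of l, OF lx[OF z], symmetric])
      also have "?\<theta> x (?\<theta> z \<omega>) - ?\<theta> x (?d (interior z \<omega>)) - (?\<theta> x (?\<theta> z \<omega>) - ?\<theta> z (?\<theta> x \<omega>))
          + ?d (interior (bracket n x z) \<omega>)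
          = ?\<theta> z (?\<theta> x \<omega>) - ?\<theta> x (?d (interior z \<omega>)) + ?d (interior (bracket n x z) \<omega>)"
        by (rule ext) simp
      finally have 1: "interior z (?\<theta> x (?d \<omega>)) = ?\<theta> z (?\<theta> x \<omega>) - ?\<theta> x (?d (interior z \<omega>))
          + ?d (interior (bracket n x z) \<omega>)" .
      have "interior z (?d (?\<theta> x \<omega>)) = ?\<theta> z (?\<theta> x \<omega>) - ?d (interior z (?\<theta> x \<omega>))"
        by (rule cartan[OF cochain_lie_der[OF \<omega> subspace x] z])
      also have "\<dots> = ?\<theta> z (?\<theta> x \<omega>) - ?d (?\<theta> x (interior z \<omega>)) + ?d (interior (bracket n x z) \<omega>)"
        unfolding lie_der_interior[OF \<omega> z] CE_d_linear by (rule ext) simp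
      finally have 2: "interior z (?d (?\<theta> x \<omega>)) = ?\<theta> z (?\<theta> x \<omega>) - ?d (?\<theta> x (interior z \<omega>))
          + ?d (interior (bracket n x z) \<omega>)" .
      have "interior z (?\<theta> x (?d \<omega>)) zs = interior z (?d (?\<theta> x \<omega>)) zs"
        unfolding 1 2 plus_fun_apply minus_apply Cons.IH[OF cochain_interior[OF \<omega> z]] ..
      then show ?thesis by simp
    qed (simp add: lie_der_def contra_outside CE_d_outside)
  qed
qed

end

section \<open>Extensions by one dimension\<close>

definition restrict_form :: "'x set \<Rightarrow> ('x list \<Rightarrow> 'k::zero) \<Rightarrow> ('x list \<Rightarrow> 'k)" where
  "restrict_form L \<omega> xs = (if set xs \<subseteq> L then \<omega> xs else 0)"

lemma restrict_form_linear:
  "restrict_form L (\<omega> + \<eta>) = restrict_form L \<omega> + (restrict_form L \<eta> :: 'x list \<Rightarrow> 'k::field)"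
  "restrict_form L (\<omega> - \<eta>) = restrict_form L \<omega> - (restrict_form L \<eta> :: 'x list \<Rightarrow> 'k::field)"
  "restrict_form L (fun_scale c \<omega>) = fun_scale c (restrict_form L \<omega>)"
  "restrict_form L 0 = (0 :: 'x list \<Rightarrow> 'k::field)"
  by (simp_all add: fun_eq_iff restrict_form_def)

lemma cochain_restrict:
  assumes "\<omega> \<in> cochains g p" "L \<subseteq> g" "glV.subspace L"
  shows "restrict_form L \<omega> \<in> cochains L p"
proof (rule cochainsI)
  have lin: "restrict_form L \<omega> (xs[i := x + y]) = restrict_form L \<omega> (xs[i := x]) + restrict_form L \<omega> (xs[i := y])"
    "restrict_form L \<omega> (xs[i := glV_scale c x]) = c * restrict_form L \<omega> (xs[i := x])"
    if "set xs \<subseteq> L" "i < length xs" "x \<in> L" "y \<in> L" for xs i x y c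
  proof -
    have "set (xs[i := z]) \<subseteq> L" if "z \<in> L" for z
      using \<open>set xs \<subseteq> L\<close> that by (rule set_update_subsetI)
    moreover have "x + y \<in> L" "glV_scale c x \<in> L"
      using assms(3) that by (auto intro: glV.subspace_add glV.subspace_scale)
    moreover have "set xs \<subseteq> g" "x \<in> g" "y \<in> g" using that assms(2) by auto
    ultimately show "restrict_form L \<omega> (xs[i := x + y]) = restrict_form L \<omega> (xs[i := x]) + restrict_form L \<omega> (xs[i := y])"
      "restrict_form L \<omega> (xs[i := glV_scale c x]) = c * restrict_form L \<omega> (xs[i := x])"
      using that(2-4) cochain_add_update[OF assms(1), of xs i x y]
        cochain_scale_update[OF assms(1), of xs i x c]
      by (simp_all add: restrict_form_def)
  qed
  show "restrict_form L \<omega> (xs[i := x + y]) = restrict_form L \<omega> (xs[i := x]) + restrict_form L \<omega> (xs[i := y])"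
    if "set xs \<subseteq> L" "i < length xs" "x \<in> L" "y \<in> L" for xs i x y by (rule lin(1)[OF that])
  show "restrict_form L \<omega> (xs[i := glV_scale c x]) = c * restrict_form L \<omega> (xs[i := x])"
    if "set xs \<subseteq> L" "i < length xs" "x \<in> L" for xs i x c by (rule lin(2)[OF that that(3)])
  show "restrict_form L \<omega> xs = 0" if "\<not> (int (length xs) = p \<and> set xs \<subseteq> L)" for xs
    using that assms(2) cochain_outside[OF assms(1), of xs] by (auto simp: restrict_form_def)
  show "restrict_form L \<omega> xs = 0" if "i < j" "j < length xs" "xs ! i = xs ! j" for xs i j
    using cochain_repeat[OF assms(1) that] by (simp add: restrict_form_def)
qed

lemma contra_restrict:
  assumes "L \<subseteq> g" "normalizes n x L"
  shows "restrict_form L (contra n g x \<omega>) = contra n L x (restrict_form L \<omega>)"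
proof
  fix xs
  have "set (xs[i := bracket n x (xs ! i)]) \<subseteq> L" if "set xs \<subseteq> L" "i < length xs" for i
  proof (rule set_update_subsetI)
    have "xs ! i \<in> L" using that nth_mem by blast
    then show "bracket n x (xs ! i) \<in> L" using assms(2) by (simp add: normalizes_def)
  qed (use that in simp)
  then show "restrict_form L (contra n g x \<omega>) xs = contra n L x (restrict_form L \<omega>) xs"
    using assms(1) by (auto simp: restrict_form_def contra_def)
qed

lemma lie_der_restrict:
  assumes "L \<subseteq> g" "normalizes n x L"
  shows "restrict_form L (lie_der n g l x \<omega>) = lie_der n L l x (restrict_form L \<omega>)"
  by (simp add: lie_der_def restrict_form_linear contra_restrict[OF assms])

lemma CE_d_restrict:
  assumes "L \<subseteq> g" and closed: "\<And>x y. x \<in> L \<Longrightarrow> y \<in> L \<Longrightarrow> bracket n x y \<in> L"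
  shows "restrict_form L (CE_d n g l \<omega>) = CE_d n L l (restrict_form L \<omega>)"
proof
  fix xs
  show "restrict_form L (CE_d n g l \<omega>) xs = CE_d n L l (restrict_form L \<omega>) xs"
  proof (cases "set xs \<subseteq> L")
    case True
    have omit: "set (omit i ys) \<subseteq> L" if "set ys \<subseteq> L" for i ys
      using that set_omit_subset[of i ys] by simp
    have "bracket n (xs ! i) (xs ! j) \<in> L" if "i < j" "j < length xs" for i j
      using True that by (intro closed) auto
    then show ?thesis using True assms(1) omit by (auto simp: restrict_form_def CE_d_def)
  qed (simp add: restrict_form_def CE_d_def)
qed

subsection \<open>Wedge product with a one-form\<close>

definition one_form :: "'k::field glV set \<Rightarrow> ('k glV \<Rightarrow> 'k) \<Rightarrow> ('k form)" where
  "one_form g \<xi> xs = (if length xs = 1 \<and> set xs \<subseteq> g then \<xi> (hd xs) else 0)"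

lemma wedge1_linear:
  "wedge1 (\<omega> + \<eta>) \<phi> = wedge1 \<omega> \<phi> + wedge1 \<eta> \<phi>"
  "wedge1 (\<omega> - \<eta>) \<phi> = wedge1 \<omega> \<phi> - wedge1 \<eta> \<phi>"
  "wedge1 (fun_scale c \<omega>) \<phi> = fun_scale c (wedge1 \<omega> \<phi>)"
  "wedge1 0 \<phi> = 0"
  by (simp_all add: fun_eq_iff wedge1_def sum.distrib sum_subtractf sum_distrib_left algebra_simps)

lemma wedge1_Nil [simp]: "wedge1 \<omega> \<phi> [] = 0"
  by (simp add: wedge1_def)

lemma wedge1_Cons:
  "wedge1 \<omega> \<phi> (x # xs) = (- 1) ^ length xs * \<omega> xs * \<phi> [x] + wedge1 (interior x \<omega>) \<phi> xs"
  by (simp add: wedge1_def interior_def sum.lessThan_Suc_shift del: sum.lessThan_Suc)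

lemma cochain_wedge1:
  assumes "\<omega> \<in> cochains g p" and g: "glV.subspace g"
    and add: "\<And>x y. x \<in> g \<Longrightarrow> y \<in> g \<Longrightarrow> \<xi> (x + y) = \<xi> x + \<xi> y"
    and scale: "\<And>c x. x \<in> g \<Longrightarrow> \<xi> (glV_scale c x) = c * \<xi> x"
  shows "wedge1 \<omega> (one_form g \<xi>) \<in> cochains g (p + 1)"
  using assms(1)
proof (induction rule: degree_induct)
  case (negative p \<omega>)
  have "wedge1 0 (one_form g \<xi>) \<in> cochains g (p + 1)" by (simp add: wedge1_linear)
  then show ?case by (simp only: cochain_negative[OF negative(2,1)])
next
  case (step p \<omega>)
  let ?\<phi> = "one_form g \<xi>"
  have \<phi>: "?\<phi> [x] = \<xi> x" if "x \<in> g" for x using that by (simp add: one_form_def)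
  have interior: "interior x (wedge1 \<omega> ?\<phi>)
      = fun_scale ((- 1) ^ nat p * ?\<phi> [x]) \<omega> + wedge1 (interior x \<omega>) ?\<phi>" if "x \<in> g" for x
  proof
    fix xs show "interior x (wedge1 \<omega> ?\<phi>) xs
        = (fun_scale ((- 1) ^ nat p * ?\<phi> [x]) \<omega> + wedge1 (interior x \<omega>) ?\<phi>) xs"
      using cochain_outside[OF step(2), of xs] by (cases "int (length xs) = p") (auto simp: wedge1_Cons)
  qed
  show ?case
  proof (rule cochainI_Cons[OF g])
    show "wedge1 \<omega> ?\<phi> xs = 0" if "\<not> (int (length xs) = p + 1 \<and> set xs \<subseteq> g)" for xs
    proof -
      have "\<omega> (omit i xs) = 0 \<or> ?\<phi> [xs ! i] = 0" if i: "i < length xs" for i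
      proof (rule ccontr)
        assume *: "\<not> ?thesis"
        then have 1: "int (length (omit i xs)) = p" "set (omit i xs) \<subseteq> g"
          using cochain_outside[OF step(2), of "omit i xs"] by auto
        have 2: "xs ! i \<in> g" using * by (simp add: one_form_def split: if_splits)
        have "xs = take i xs @ xs ! i # drop (Suc i) xs" using i by (rule id_take_nth_drop)
        then have "set xs = set (take i xs @ xs ! i # drop (Suc i) xs)" by metis
        then have "set xs \<subseteq> g" using 1(2) 2 by (simp add: omit_def)
        then show False using \<open>\<not> (int (length xs) = p + 1 \<and> set xs \<subseteq> g)\<close> 1(1) i by (simp add: length_omit)
      qed
      then show ?thesis unfolding wedge1_def by (intro sum.neutral) auto
    qed
    show "interior x (wedge1 \<omega> ?\<phi>) \<in> cochains g (p + 1 - 1)" if "x \<in> g" for x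
    proof -
      have "wedge1 (interior x \<omega>) ?\<phi> \<in> cochains g p"
        using step(3)[OF cochain_interior[OF step(2) that]] by (simp only: diff_add_cancel)
      then show ?thesis
        using step(2) by (simp add: interior[OF that] cochain_add_form cochain_scale_form)
    qed
    show "wedge1 \<omega> ?\<phi> ((x + y) # xs) = wedge1 \<omega> ?\<phi> (x # xs) + wedge1 \<omega> ?\<phi> (y # xs)"
      if "x \<in> g" "y \<in> g" "set xs \<subseteq> g" for x y xs
      using that by (simp add: wedge1_Cons interior_add[OF step(2) _ _ g] wedge1_linear \<phi>
          glV.subspace_add[OF g] add algebra_simps)
    show "wedge1 \<omega> ?\<phi> (glV_scale c x # xs) = c * wedge1 \<omega> ?\<phi> (x # xs)"
      if "x \<in> g" "set xs \<subseteq> g" for c x xs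
      using that by (simp add: wedge1_Cons interior_scale[OF step(2)] wedge1_linear \<phi>
          glV.subspace_scale[OF g] scale algebra_simps)
    show "wedge1 \<omega> ?\<phi> (x # x # xs) = 0" if "x \<in> g" "set xs \<subseteq> g" for x xs
      by (simp add: wedge1_Cons interior_interior[OF step(2)] wedge1_linear)
  qed
qed

lemma wedge1_kernel:
  assumes "\<And>x. x \<in> set xs \<Longrightarrow> \<phi> [x] = 0"
  shows "wedge1 \<omega> \<phi> xs = 0"
  unfolding wedge1_def using assms by (intro sum.neutral) auto

subsection \<open>Coordinates of a form\<close>

text \<open>
  The functional \<open>\<xi>\<close> is the coordinate along \<open>x\<close> in \<open>g = L \<oplus> \<K>x\<close>.  A form \<open>\<omega>\<close> on \<open>g\<close> has the coordinates
  \<open>restrict_form L \<omega>\<close> and \<open>head \<omega>\<close>.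
\<close>

locale extension = lie_character n g l
  for n :: nat and g :: "'k::field_char_0 glV set" and l :: "'k glV \<Rightarrow> 'k" +
  fixes L :: "'k glV set" and x :: "'k glV" and \<xi> :: "'k glV \<Rightarrow> 'k"
  assumes sub: "glV.subspace L" "L \<subseteq> g"
    and ideal: "\<And>y z. y \<in> g \<Longrightarrow> z \<in> L \<Longrightarrow> bracket n y z \<in> L"
    and x: "x \<in> g"
    and \<xi>_add: "\<And>y z. \<xi> (y + z) = \<xi> y + \<xi> z"
    and \<xi>_scale: "\<And>c y. \<xi> (glV_scale c y) = c * \<xi> y"
    and \<xi>_x: "\<xi> x = 1"
    and \<xi>_L: "\<And>y. y \<in> L \<Longrightarrow> \<xi> y = 0"
    and complement: "\<And>y. y \<in> g \<Longrightarrow> y - glV_scale (\<xi> y) x \<in> L"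
begin

sublocale L: lie_character n L l
proof unfold_locales
  show "glV.subspace L" by (rule sub(1))
  show "bracket n y z \<in> L" if "y \<in> L" "z \<in> L" for y z
    by (rule ideal[OF subsetD[OF sub(2) that(1)] that(2)])
  show "l (y + z) = l y + l z" if "y \<in> L" "z \<in> L" for y z
    by (rule l_add[OF subsetD[OF sub(2) that(1)] subsetD[OF sub(2) that(2)]])
  show "l (glV_scale c y) = c * l y" if "y \<in> L" for c y
    by (rule l_scale[OF subsetD[OF sub(2) that]])
  show "l (bracket n y z) = 0" if "y \<in> L" "z \<in> L" for y z
    by (rule l_bracket[OF subsetD[OF sub(2) that(1)] subsetD[OF sub(2) that(2)]])
qed

definition proj :: "'k glV \<Rightarrow> 'k glV" where "proj y = y - glV_scale (\<xi> y) x"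

definition pull :: "('k form) \<Rightarrow> ('k form)" where
  "pull u xs = (if set xs \<subseteq> g then u (map proj xs) else 0)"

definition head :: "('k form) \<Rightarrow> ('k form)" where
  "head \<omega> = restrict_form L (interior x \<omega>)"

definition wedge :: "('k form) \<Rightarrow> ('k form)" where
  "wedge w = wedge1 (pull w) (one_form g \<xi>)"

lemma g_span: "g = glV.span (insert x L)"
proof
  show "glV.span (insert x L) \<subseteq> g" using x sub by (intro glV.span_minimal subspace) auto
  show "g \<subseteq> glV.span (insert x L)"
  proof
    fix y assume "y \<in> g"
    then have "y - glV_scale (\<xi> y) x \<in> L" by (rule complement)
    then show "y \<in> glV.span (insert x L)"
      by (metis glV.eq_span_insert_eq glV.span_add_eq glV.span_base glV.span_scale insertI1 insertI2 diff_add_cancel)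
  qed
qed

lemma normalizes_L: "y \<in> g \<Longrightarrow> normalizes n y L"
  by (simp add: normalizes_def ideal)

lemma coords_cochain:
  assumes "\<omega> \<in> cochains g p"
  shows "restrict_form L \<omega> \<in> cochains L p" "head \<omega> \<in> cochains L (p - 1)"
  unfolding head_def using cochain_restrict[OF _ sub(2,1)] cochain_interior[OF assms x] assms by auto

lemma head_linear:
  "head (\<omega> + \<eta>) = head \<omega> + head \<eta>"
  "head (\<omega> - \<eta>) = head \<omega> - head \<eta>"
  "head (fun_scale c \<omega>) = fun_scale c (head \<omega>)"
  "head 0 = 0"
  by (simp_all add: head_def restrict_form_linear)

lemma restrict_CE_d: "restrict_form L (CE_d n g l \<omega>) = CE_d n L l (restrict_form L \<omega>)"
  by (rule CE_d_restrict[OF sub(2)]) (rule L.closed)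

text \<open>
  Together with \<open>restrict_CE_d\<close> this identifies the forms on \<open>g\<close> with the mapping cone of
  \<open>lie_der n L l x\<close>.
\<close>

lemma head_CE_d:
  assumes "\<omega> \<in> cochains g p"
  shows "head (CE_d n g l \<omega>) = lie_der n L l x (restrict_form L \<omega>) - CE_d n L l (head \<omega>)"
  unfolding head_def cartan[OF assms x] restrict_form_linear
  by (simp add: lie_der_restrict[OF sub(2) normalizes_L[OF x]] restrict_CE_d)

lemma restrict_lie_der:
  "normalizes n y L \<Longrightarrow> restrict_form L (lie_der n g l y \<omega>) = lie_der n L l y (restrict_form L \<omega>)"
  by (rule lie_der_restrict[OF sub(2)])

lemma head_lie_der:
  assumes "\<omega> \<in> cochains g p" "normalizes n y L" "bracket n y x = glV_scale c x"
  shows "head (lie_der n g l y \<omega>) = lie_der n L l y (head \<omega>) - fun_scale c (head \<omega>)"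
  unfolding head_def lie_der_interior[OF assms(1) x] assms(3) interior_scale[OF assms(1) x]
  by (simp add: restrict_form_linear lie_der_restrict[OF sub(2) assms(2)])

text \<open>
  A form is determined by its values on lists from \<open>L \<union> {x}\<close>, where \<open>x\<close> may be assumed to occur at most
  once and then to come first.
\<close>

lemma form_eqI:
  assumes \<omega>: "\<omega> \<in> cochains g p" "\<eta> \<in> cochains g p"
    and eq: "restrict_form L \<omega> = restrict_form L \<eta>" "head \<omega> = head \<eta>"
  shows "\<omega> = \<eta>"
proof (rule cochain_eqI_span[where S = "insert x L"])
  show "\<omega> \<in> cochains (glV.span (insert x L)) p" "\<eta> \<in> cochains (glV.span (insert x L)) p"
    using \<omega> unfolding g_span by simp_all
  fix xs assume xs: "set xs \<subseteq> insert x L"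
  have L: "\<omega> ys = \<eta> ys" "\<omega> (x # ys) = \<eta> (x # ys)" if "set ys \<subseteq> L" for ys
    using that fun_cong[OF eq(1), of ys] fun_cong[OF eq(2), of ys]
    by (simp_all add: restrict_form_def head_def)
  show "\<omega> xs = \<eta> xs"
  proof (cases "x \<in> set xs")
    case False
    then show ?thesis using xs L(1) by blast
  next
    case True
    then obtain as bs where split: "xs = as @ x # bs" by (meson split_list)
    have g: "set as \<subseteq> g" "set bs \<subseteq> g" using xs split x sub(2) by auto
    have move: "\<zeta> xs = (- 1) ^ length as * \<zeta> (x # as @ bs)" if "\<zeta> \<in> cochains g p" for \<zeta>
      using cochain_move_front[OF that subspace g x] split by (simp flip: power_mult_distrib)
    show ?thesis
    proof (cases "x \<in> set as \<union> set bs")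
      case True
      then have "\<not> distinct xs" using split by auto
      then show ?thesis using \<omega> by (simp add: cochain_not_distinct)
    next
      case False
      then have "set (as @ bs) \<subseteq> L" using xs split by auto
      then show ?thesis using L(2) by (simp only: move[OF \<omega>(1)] move[OF \<omega>(2)])
    qed
  qed
qed

lemma proj_simps:
  "proj (y + z) = proj y + proj z" "proj (glV_scale c y) = glV_scale c (proj y)"
  "proj x = 0" "y \<in> L \<Longrightarrow> proj y = y" "y \<in> g \<Longrightarrow> proj y \<in> L"
  by (simp_all add: proj_def \<xi>_add \<xi>_scale \<xi>_x \<xi>_L complement glV.scale_left_distrib
      glV.scale_right_diff_distrib)

lemma cochain_pull:
  assumes "u \<in> cochains L p"
  shows "pull u \<in> cochains g p"
proof (rule cochainsI)
  have lin: "pull u (xs[i := y + z]) = pull u (xs[i := y]) + pull u (xs[i := z])"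
    "pull u (xs[i := glV_scale c y]) = c * pull u (xs[i := y])"
    if "set xs \<subseteq> g" "i < length xs" "y \<in> g" "z \<in> g" for xs i y z c
  proof -
    have "set (xs[i := v]) \<subseteq> g" if "v \<in> g" for v
      using \<open>set xs \<subseteq> g\<close> that by (rule set_update_subsetI)
    moreover have "y + z \<in> g" "glV_scale c y \<in> g"
      using subspace that by (auto intro: glV.subspace_add glV.subspace_scale)
    moreover have "set (map proj xs) \<subseteq> L" using that by (auto simp: proj_simps)
    ultimately show "pull u (xs[i := y + z]) = pull u (xs[i := y]) + pull u (xs[i := z])"
      "pull u (xs[i := glV_scale c y]) = c * pull u (xs[i := y])"
      using that cochain_add_update[OF assms, of "map proj xs" i "proj y" "proj z"]
        cochain_scale_update[OF assms, of "map proj xs" i "proj y" c]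
      by (auto simp: pull_def map_update proj_simps)
  qed
  show "pull u (xs[i := y + z]) = pull u (xs[i := y]) + pull u (xs[i := z])"
    if "set xs \<subseteq> g" "i < length xs" "y \<in> g" "z \<in> g" for xs i y z by (rule lin(1)[OF that])
  show "pull u (xs[i := glV_scale c y]) = c * pull u (xs[i := y])"
    if "set xs \<subseteq> g" "i < length xs" "y \<in> g" for xs i y c by (rule lin(2)[OF that that(3)])
  show "pull u xs = 0" if "\<not> (int (length xs) = p \<and> set xs \<subseteq> g)" for xs
    using that cochain_outside[OF assms, of "map proj xs"] by (auto simp: pull_def)
  show "pull u xs = 0" if "i < j" "j < length xs" "xs ! i = xs ! j" for xs i j
    using cochain_repeat[OF assms, of i j "map proj xs"] that by (simp add: pull_def)
qed

lemma coords_pull: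
  assumes "u \<in> cochains L p"
  shows "restrict_form L (pull u) = u" "head (pull u) = 0"
proof -
  have "map proj xs = xs" if "set xs \<subseteq> L" for xs
    using that by (intro map_idI proj_simps(4)) (rule subsetD)
  then show "restrict_form L (pull u) = u"
    using sub cochain_outside[OF assms] by (fastforce simp: fun_eq_iff restrict_form_def pull_def)
  show "head (pull u) = 0"
    using cochain_zero_arg[OF assms]
    by (simp add: fun_eq_iff restrict_form_def pull_def head_def interior_def proj_simps)
qed

lemma cochain_wedge: "w \<in> cochains L p \<Longrightarrow> wedge w \<in> cochains g (p + 1)"
  unfolding wedge_def by (rule cochain_wedge1[OF cochain_pull subspace]) (auto simp: \<xi>_add \<xi>_scale)

lemma coords_wedge:
  assumes "w \<in> cochains L p"
  shows "restrict_form L (wedge w) = 0" "head (wedge w) = fun_scale ((- 1) ^ nat p) w"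
proof -
  have *: "wedge1 \<omega> (one_form g \<xi>) xs = 0" if "set xs \<subseteq> L" for \<omega> xs
    using that \<xi>_L by (intro wedge1_kernel) (auto simp: one_form_def)
  then show "restrict_form L (wedge w) = 0"
    by (simp add: fun_eq_iff restrict_form_def wedge_def)
  show "head (wedge w) = fun_scale ((- 1) ^ nat p) w"
  proof
    fix xs show "head (wedge w) xs = fun_scale ((- 1) ^ nat p) w xs"
    proof (cases "set xs \<subseteq> L")
      case True
      then have "head (wedge w) xs = (- 1) ^ length xs * restrict_form L (pull w) xs * \<xi> x"
        using x * by (simp add: head_def restrict_form_def wedge_def wedge1_Cons one_form_def interior_def)
      also have "\<dots> = fun_scale ((- 1) ^ nat p) w xs"
        unfolding coords_pull[OF assms] using cochain_outside[OF assms, of xs]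
        by (cases "int (length xs) = p") (auto simp: \<xi>_x)
      finally show ?thesis .
    qed (use cochain_outside[OF assms] in \<open>simp add: head_def restrict_form_def\<close>)
  qed
qed

lemma coords_surj:
  assumes "u \<in> cochains L p" "w \<in> cochains L (p - 1)"
  obtains \<omega> where "\<omega> \<in> cochains g p" "restrict_form L \<omega> = u" "head \<omega> = w"
proof
  let ?w = "fun_scale ((- 1) ^ nat (p - 1)) w"
  have w: "?w \<in> cochains L (p - 1)" using assms(2) by (rule cochain_scale_form)
  show "pull u + wedge ?w \<in> cochains g p"
    using cochain_pull[OF assms(1)] cochain_wedge[OF w] by (simp add: cochain_add_form)
  show "restrict_form L (pull u + wedge ?w) = u"
    by (simp add: restrict_form_linear coords_pull[OF assms(1)] coords_wedge[OF w])
  show "head (pull u + wedge ?w) = w"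
    by (simp add: head_linear coords_pull[OF assms(1)] coords_wedge[OF w])
qed

end

section \<open>Projection to the kernel of a diagonalizable operator\<close>

abbreviation fun_linear :: "(('x \<Rightarrow> 'k::field) \<Rightarrow> ('y \<Rightarrow> 'k)) \<Rightarrow> bool" where
  "fun_linear \<equiv> module_hom fun_scale fun_scale"

lemma fun_linearI:
  "(\<And>a b. T (a + b) = T a + T b) \<Longrightarrow> (\<And>c a. T (fun_scale c a) = fun_scale c (T a)) \<Longrightarrow> fun_linear T"
  by (simp add: module_hom_iff funs.module_axioms)

text \<open>
  The operator \<open>\<Prod>\<^sub>t (1 - \<theta> / t)\<close>.  When \<open>\<theta>\<close> is diagonalizable and \<open>ts\<close> lists its nonzero eigenvalues, it
  projects to the kernel along the image.  As a polynomial in \<open>\<theta>\<close> it commutes with whatever \<open>\<theta>\<close>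
  commutes with.
\<close>

primrec kernel_proj :: "(('x \<Rightarrow> 'k::field) \<Rightarrow> ('x \<Rightarrow> 'k)) \<Rightarrow> 'k list \<Rightarrow> ('x \<Rightarrow> 'k) \<Rightarrow> ('x \<Rightarrow> 'k)" where
  "kernel_proj \<theta> [] a = a"
| "kernel_proj \<theta> (t # ts) a = kernel_proj \<theta> ts (a - fun_scale (1 / t) (\<theta> a))"

text \<open>
  The polynomial \<open>(1 - \<Prod>\<^sub>t (1 - \<theta> / t)) / \<theta>\<close>, which shows that \<open>a\<close> and its projection differ by an
  element of every \<open>\<theta>\<close>-stable subspace containing \<open>\<theta> a\<close>.
\<close>

primrec kernel_residue :: "(('x \<Rightarrow> 'k::field) \<Rightarrow> ('x \<Rightarrow> 'k)) \<Rightarrow> 'k list \<Rightarrow> ('x \<Rightarrow> 'k) \<Rightarrow> ('x \<Rightarrow> 'k)" where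
  "kernel_residue \<theta> [] a = 0"
| "kernel_residue \<theta> (t # ts) a = kernel_residue \<theta> ts (a - fun_scale (1 / t) (\<theta> a)) + fun_scale (1 / t) a"

lemma kernel_proj_commute:
  assumes D: "fun_linear D" and M: "funs.subspace M" "\<And>a. a \<in> M \<Longrightarrow> \<theta> a \<in> M"
    and comm: "\<And>a. a \<in> M \<Longrightarrow> D (\<theta> a) = \<theta>' (D a)" and "a \<in> M"
  shows "D (kernel_proj \<theta> ts a) = kernel_proj \<theta>' ts (D a)" "D (kernel_residue \<theta> ts a) = kernel_residue \<theta>' ts (D a)"
proof -
  note lin = module_hom.add[OF D] module_hom.diff[OF D] module_hom.scale[OF D] module_hom.zero[OF D]
  have step: "a - fun_scale c (\<theta> a) \<in> M" if "a \<in> M" for a c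
    using that M by (simp add: funs.subspace_diff funs.subspace_scale)
  show "D (kernel_proj \<theta> ts a) = kernel_proj \<theta>' ts (D a)" using assms(5)
    by (induction ts arbitrary: a) (simp_all add: step lin comm)
  show "D (kernel_residue \<theta> ts a) = kernel_residue \<theta>' ts (D a)" using assms(5)
    by (induction ts arbitrary: a) (simp_all add: step lin comm)
qed

lemma kernel_proj_in:
  assumes M: "funs.subspace M" "\<And>a. a \<in> M \<Longrightarrow> \<theta> a \<in> M" and "a \<in> M"
  shows "kernel_proj \<theta> ts a \<in> M" "kernel_residue \<theta> ts a \<in> M"
proof -
  have step: "a - fun_scale c (\<theta> a) \<in> M" if "a \<in> M" for a c
    using that M by (simp add: funs.subspace_diff funs.subspace_scale)
  show "kernel_proj \<theta> ts a \<in> M" using assms(3) by (induction ts arbitrary: a) (simp_all add: step)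
  show "kernel_residue \<theta> ts a \<in> M" using assms(3)
    by (induction ts arbitrary: a)
      (simp_all add: step M funs.subspace_add funs.subspace_scale funs.subspace_0)
qed

lemma kernel_proj_fix: "\<theta> a = 0 \<Longrightarrow> kernel_proj \<theta> ts a = a"
  by (induction ts) simp_all

lemma kernel_proj_eq:
  assumes "fun_linear \<theta>"
  shows "kernel_proj \<theta> ts a = a - kernel_residue \<theta> ts (\<theta> a)"
proof (induction ts arbitrary: a)
  case (Cons t ts)
  note lin = module_hom.diff[OF assms] module_hom.scale[OF assms]
  have "kernel_proj \<theta> (t # ts) a = a - fun_scale (1 / t) (\<theta> a) - kernel_residue \<theta> ts (\<theta> a - fun_scale (1 / t) (\<theta> (\<theta> a)))"
    by (simp only: kernel_proj.simps Cons lin)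
  then show ?case by (simp only: kernel_residue.simps diff_diff_eq add.commute)
qed simp

lemma fun_linear_kernel_proj:
  assumes "fun_linear \<theta>"
  shows "fun_linear (kernel_proj \<theta> ts)" "fun_linear (kernel_residue \<theta> ts)"
proof -
  have eq: "a + b - fun_scale t (\<theta> (a + b)) = (a - fun_scale t (\<theta> a)) + (b - fun_scale t (\<theta> b))"
    "fun_scale c a - fun_scale t (\<theta> (fun_scale c a)) = fun_scale c (a - fun_scale t (\<theta> a))" for a b c t
    unfolding module_hom.add[OF assms] module_hom.scale[OF assms] by (rule ext; simp add: algebra_simps)+
  have "kernel_proj \<theta> ts (a + b) = kernel_proj \<theta> ts a + kernel_proj \<theta> ts b \<and> kernel_proj \<theta> ts (fun_scale c a) = fun_scale c (kernel_proj \<theta> ts a)" for a b c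
    by (induction ts arbitrary: a b) (simp_all add: eq)
  then show *: "fun_linear (kernel_proj \<theta> ts)" by (intro fun_linearI) auto
  have "kernel_residue \<theta> ts (a + b) = kernel_residue \<theta> ts a + kernel_residue \<theta> ts b \<and> kernel_residue \<theta> ts (fun_scale c a) = fun_scale c (kernel_residue \<theta> ts a)" for a b c
  proof (induction ts arbitrary: a b)
    case (Cons t ts)
    then show ?case
      by (simp only: kernel_residue.simps eq funs.scale_right_distrib funs.scale_scale mult.commute ac_simps simp_thms)
  qed simp
  then show "fun_linear (kernel_residue \<theta> ts)" by (intro fun_linearI) auto
qed

lemma fun_linear_lie_der: "fun_linear (lie_der n L l x)"
  by (rule fun_linearI) (simp_all add: lie_der_linear)

lemma fun_linear_CE_d: "fun_linear (CE_d n L l)"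
  by (rule fun_linearI) (simp_all add: CE_d_linear)

lemma contra_eigenbasis:
  assumes a: "a \<in> cochains L q" and L: "b ` set js \<subseteq> L"
    and eigen: "\<And>j. j \<in> set js \<Longrightarrow> bracket n x (b j) = glV_scale (\<kappa> j) (b j)"
  shows "contra n L x a (map b js) = - sum_list (map \<kappa> js) * a (map b js)"
proof -
  have "a ((map b js)[i := bracket n x (map b js ! i)]) = \<kappa> (js ! i) * a (map b js)" if "i < length js" for i
  proof -
    have "b (js ! i) \<in> L" using L nth_mem[OF that] by blast
    then have "a ((map b js)[i := glV_scale (\<kappa> (js ! i)) (b (js ! i))]) = \<kappa> (js ! i) * a ((map b js)[i := b (js ! i)])"
      using that L by (intro cochain_scale_update[OF a]) simp_all
    then show ?thesis using that eigen[OF nth_mem[OF that]] by (simp flip: map_update)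
  qed
  then have "contra n L x a (map b js) = - (\<Sum>i<length js. \<kappa> (js ! i) * a (map b js))"
    using L by (simp add: contra_def)
  also have "(\<Sum>i<length js. \<kappa> (js ! i) * a (map b js)) = sum_list (map \<kappa> js) * a (map b js)"
    by (simp add: sum_list_sum_nth sum_distrib_right atLeast0LessThan)
  finally show ?thesis by simp
qed

text \<open>
  On a list of eigenvectors \<open>\<theta>\<close> multiplies the value of a form by a scalar.  Finitely many lists are relevant
  in degrees up to \<open>p\<close>, so one list \<open>ts\<close> serves all these degrees.
\<close>

lemma lie_der_diagonal:
  fixes p :: int
  assumes L: "L = glV.span S" and fin: "finite S"
    and eigenvectors: "\<And>s. s \<in> S \<Longrightarrow> \<exists>c. bracket n x s = glV_scale c s"
  shows "\<exists>ts. \<forall>q\<le>p. \<forall>a\<in>cochains L q. lie_der n L l x (kernel_proj (lie_der n L l x) ts a) = 0"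
proof -
  let ?\<theta> = "lie_der n L l x"
  obtain \<kappa> where eigen: "\<And>s. s \<in> S \<Longrightarrow> bracket n x s = glV_scale (\<kappa> s) s"
    using eigenvectors by metis
  define wt where "wt ss = l x - sum_list (map \<kappa> ss)" for ss
  have sub: "glV.subspace L" by (simp add: L)
  have SL: "S \<subseteq> L" by (simp add: L glV.span_superset)
  have nz: "normalizes n x L"
    unfolding L by (rule normalizes_span) (simp add: eigen glV.span_base glV.span_scale)
  have \<theta>: "?\<theta> a ss = wt ss * a ss" if "a \<in> cochains L q" "set ss \<subseteq> S" for a q ss
  proof -
    have "contra n L x a (map (\<lambda>s. s) ss) = - sum_list (map \<kappa> ss) * a (map (\<lambda>s. s) ss)"
      using that SL by (intro contra_eigenbasis) (auto intro: eigen)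
    then show ?thesis by (simp add: lie_der_def wt_def algebra_simps)
  qed
  have kernel_proj: "kernel_proj ?\<theta> ts a \<in> cochains L q
      \<and> (set ss \<subseteq> S \<longrightarrow> kernel_proj ?\<theta> ts a ss = prod_list (map (\<lambda>t. 1 - wt ss / t) ts) * a ss)"
    if "a \<in> cochains L q" for a q ss ts
    using that
  proof (induction ts arbitrary: a)
    case (Cons t ts)
    define b where "b = a - fun_scale (1 / t) (?\<theta> a)"
    have "b \<in> cochains L q"
      using Cons.prems sub nz by (simp add: b_def cochain_diff_form cochain_scale_form cochain_lie_der)
    note IH = Cons.IH[OF this]
    have "b ss = (1 - wt ss / t) * a ss" if "set ss \<subseteq> S"
      using \<theta>[OF Cons.prems that] by (simp add: b_def algebra_simps)
    then show ?case using IH by (simp flip: b_def)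
  qed simp
  define T where "T = wt ` {ss. set ss \<subseteq> S \<and> length ss \<le> nat p} - {0}"
  have "finite T" unfolding T_def using fin by (intro finite_Diff finite_imageI finite_lists_length_le)
  then obtain ts where ts: "set ts = T" using finite_list by blast
  have "?\<theta> (kernel_proj ?\<theta> ts a) = 0" if "q \<le> p" "a \<in> cochains L q" for q a
  proof (rule cochain_eqI_span[where S = S and p = q])
    show "?\<theta> (kernel_proj ?\<theta> ts a) \<in> cochains (glV.span S) q"
      using kernel_proj[OF that(2)] sub nz by (simp add: cochain_lie_der flip: L)
    fix ss assume ss: "set ss \<subseteq> S"
    have "wt ss = 0 \<or> wt ss \<in> T \<or> a ss = 0"
    proof (cases "int (length ss) = q")
      case True
      then show ?thesis using ss that(1) by (auto simp: T_def)
    qed (use cochain_outside[OF that(2)] in auto)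
    then have "wt ss * (prod_list (map (\<lambda>t. 1 - wt ss / t) ts) * a ss) = 0"
    proof (elim disjE)
      assume "wt ss \<in> T"
      then have "wt ss \<noteq> 0" "wt ss \<in> set ts" using ts by (auto simp: T_def)
      then have "1 - wt ss / wt ss \<in> set (map (\<lambda>t. 1 - wt ss / t) ts)" by (metis (mono_tags) image_eqI list.set_map)
      then have "prod_list (map (\<lambda>t. 1 - wt ss / t) ts) = 0"
        using \<open>wt ss \<noteq> 0\<close> by (simp add: prod_list_zero_iff)
      then show ?thesis by simp
    qed auto
    then show "?\<theta> (kernel_proj ?\<theta> ts a) ss = 0 ss"
      using \<theta>[of "kernel_proj ?\<theta> ts a" q ss] kernel_proj[OF that(2), where ts = ts and ss = ss] ss by simp
  qed simp
  then show ?thesis by blast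
qed

section \<open>The mapping cone of a diagonalizable operator\<close>

text \<open>
  Cohomology of a complex in degree \<open>p\<close> is nonzero iff some cocycle is not a coboundary.
\<close>

definition nontrivial :: "(int \<Rightarrow> ('x \<Rightarrow> 'k::field) set) \<Rightarrow> (('x \<Rightarrow> 'k) \<Rightarrow> ('x \<Rightarrow> 'k)) \<Rightarrow> int \<Rightarrow> bool" where
  "nontrivial M d p \<longleftrightarrow> (\<exists>z\<in>M p. d z = 0 \<and> z \<notin> d ` M (p - 1))"

text \<open>
  The space \<open>X\<close> is the mapping cone of \<open>\<theta>\<close> on \<open>(M, d)\<close>, with coordinates \<open>r\<close> and \<open>h\<close>.  Let \<open>\<pi>\<close> be the
  projection to the kernel of \<open>\<theta>\<close>.  A cocycle \<open>(a, b)\<close>, that is \<open>d a = 0\<close> and \<open>\<theta> a = d b\<close>, is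
  cohomologous to its invariant part \<open>(\<pi> a, \<pi> b)\<close>, and on invariants the differential of the cone is
  \<open>(d, -d)\<close>.
\<close>

lemma nontrivial_cone:
  fixes M :: "int \<Rightarrow> ('x \<Rightarrow> 'k::field) set" and X :: "int \<Rightarrow> ('y \<Rightarrow> 'k) set"
  assumes M: "\<And>q. funs.subspace (M q)"
    and d: "fun_linear d" "\<And>q a. a \<in> M q \<Longrightarrow> d a \<in> M (q + 1)"
    and \<theta>: "fun_linear \<theta>" "\<And>q a. a \<in> M q \<Longrightarrow> \<theta> a \<in> M q"
    and comm: "\<And>q a. a \<in> M q \<Longrightarrow> d (\<theta> a) = \<theta> (d a)"
    and diag: "\<And>q a. q \<le> p \<Longrightarrow> a \<in> M q \<Longrightarrow> \<theta> (kernel_proj \<theta> ts a) = 0"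
    and X: "\<And>q. 0 \<in> X q" "\<And>q \<omega>. \<omega> \<in> X q \<Longrightarrow> D \<omega> \<in> X (q + 1)"
    and r: "\<And>q \<omega>. \<omega> \<in> X q \<Longrightarrow> r \<omega> \<in> M q" "r 0 = 0"
    and h: "\<And>q \<omega>. \<omega> \<in> X q \<Longrightarrow> h \<omega> \<in> M (q - 1)" "h 0 = 0"
    and inj: "\<And>q \<omega> \<eta>. \<lbrakk>\<omega> \<in> X q; \<eta> \<in> X q; r \<omega> = r \<eta>; h \<omega> = h \<eta>\<rbrakk> \<Longrightarrow> \<omega> = \<eta>"
    and surj: "\<And>q u w. \<lbrakk>u \<in> M q; w \<in> M (q - 1)\<rbrakk> \<Longrightarrow> \<exists>\<omega>\<in>X q. r \<omega> = u \<and> h \<omega> = w"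
    and rD: "\<And>q \<omega>. \<omega> \<in> X q \<Longrightarrow> r (D \<omega>) = d (r \<omega>)"
    and hD: "\<And>q \<omega>. \<omega> \<in> X q \<Longrightarrow> h (D \<omega>) = \<theta> (r \<omega>) - d (h \<omega>)"
  defines "K \<equiv> \<lambda>q. {a \<in> M q. \<theta> a = 0}"
  shows "nontrivial X D p \<longleftrightarrow> nontrivial K d p \<or> nontrivial K d (p - 1)"
proof -
  let ?\<pi> = "kernel_proj \<theta> ts" and ?h = "kernel_residue \<theta> ts"
  have d0: "d 0 = 0" "\<theta> 0 = 0" "?\<pi> 0 = 0"
    by (rule module_hom.zero[OF d(1)] module_hom.zero[OF \<theta>(1)]
        module_hom.zero[OF fun_linear_kernel_proj(1)[OF \<theta>(1)]])+
  have \<pi>d: "d (?\<pi> a) = ?\<pi> (d a)" "d (?h a) = ?h (d a)" if "a \<in> M q" for a q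
    by (rule kernel_proj_commute[where M = "M q" and \<theta> = \<theta>, OF d(1) M]; use \<theta>(2) comm that in blast)+
  have \<pi>\<theta>: "\<theta> (?\<pi> a) = ?\<pi> (\<theta> a)" "\<theta> (?h a) = ?h (\<theta> a)" if "a \<in> M q" for a q
    by (rule kernel_proj_commute[where M = "M q" and \<theta> = \<theta>, OF \<theta>(1) M]; use \<theta>(2) that in blast)+
  have \<pi>M: "?\<pi> a \<in> M q" "?h a \<in> M q" if "a \<in> M q" for a q
    using kernel_proj_in[OF M \<theta>(2) that] by auto
  have \<pi>h: "?\<pi> a = a - ?h (\<theta> a)" for a by (rule kernel_proj_eq[OF \<theta>(1)])
  have \<pi>K: "?\<pi> a \<in> K q" if "a \<in> M q" "q \<le> p" for a q
    using that \<pi>M diag by (simp add: K_def)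
  show ?thesis
  proof
    assume "nontrivial X D p"
    then obtain \<omega> where \<omega>: "\<omega> \<in> X p" "D \<omega> = 0" "\<omega> \<notin> D ` X (p - 1)" by (auto simp: nontrivial_def)
    define a b where "a = r \<omega>" and "b = h \<omega>"
    have ab: "a \<in> M p" "b \<in> M (p - 1)" using \<omega>(1) r h by (auto simp: a_def b_def)
    have da: "d a = 0" using rD[OF \<omega>(1)] \<omega>(2) r(2) by (simp add: a_def)
    have \<theta>a: "\<theta> a = d b" using hD[OF \<omega>(1)] \<omega>(2) h(2) by (simp add: a_def b_def)
    show "nontrivial K d p \<or> nontrivial K d (p - 1)"
    proof (rule ccontr)
      assume no: "\<not> ?thesis"
      have "d (?\<pi> a) = 0" using \<pi>d(1)[OF ab(1)] da d0 by simp
      then have "?\<pi> a \<in> d ` K (p - 1)" using no \<pi>K[OF ab(1)] by (auto simp: nontrivial_def)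
      then obtain a' where a': "a' \<in> K (p - 1)" "?\<pi> a = d a'" by auto
      have "d (?\<pi> b) = \<theta> (?\<pi> a)" using \<pi>d(1)[OF ab(2)] \<pi>\<theta>(1)[OF ab(1)] \<theta>a by simp
      then have "d (?\<pi> b) = 0" using diag[OF _ ab(1)] by simp
      then have "?\<pi> b \<in> d ` K (p - 1 - 1)" using no \<pi>K[OF ab(2)] by (auto simp: nontrivial_def)
      then obtain b' where b': "b' \<in> K (p - 1 - 1)" "?\<pi> b = d b'" by auto
      \<comment> \<open>\<open>a - \<pi> a = h (\<theta> a) = h (d b) = d (h b)\<close>, and \<open>\<theta> (h b) = b - \<pi> b\<close>\<close>
      define c where "c = a' + ?h b"
      have c: "c \<in> M (p - 1)" using a'(1) \<pi>M[OF ab(2)] M by (simp add: c_def K_def funs.subspace_add)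
      have dc: "d c = a"
        using \<pi>h[of a] \<pi>d(2)[OF ab(2)] by (simp add: c_def module_hom.add[OF d(1)] \<theta>a flip: a'(2))
      have \<theta>c: "\<theta> c = b - ?\<pi> b"
        using \<pi>h[of b] \<pi>\<theta>(2)[OF ab(2)] a'(1) by (simp add: c_def module_hom.add[OF \<theta>(1)] K_def)
      have "- b' \<in> M (p - 1 - 1)" using b'(1) M by (simp add: K_def funs.subspace_neg)
      then obtain \<eta> where \<eta>: "\<eta> \<in> X (p - 1)" "r \<eta> = c" "h \<eta> = - b'" using surj[OF c] by blast
      have "D \<eta> = \<omega>"
      proof (rule inj[of _ p])
        show "D \<eta> \<in> X p" using X(2)[OF \<eta>(1)] by simp
        show "r (D \<eta>) = r \<omega>" using rD[OF \<eta>(1)] \<eta>(2) dc by (simp add: a_def)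
        show "h (D \<eta>) = h \<omega>"
          using hD[OF \<eta>(1)] \<eta>(2,3) \<theta>c b'(2) by (simp add: b_def module_hom.neg[OF d(1)])
      qed (rule \<omega>(1))
      then show False using \<omega>(3) \<eta>(1) by blast
    qed
  next
    assume "nontrivial K d p \<or> nontrivial K d (p - 1)"
    then show "nontrivial X D p"
    proof
      assume "nontrivial K d p"
      then obtain z where z: "z \<in> M p" "\<theta> z = 0" "d z = 0" "z \<notin> d ` K (p - 1)"
        by (auto simp: nontrivial_def K_def)
      obtain \<omega> where \<omega>: "\<omega> \<in> X p" "r \<omega> = z" "h \<omega> = 0"
        using surj[OF z(1)] M funs.subspace_0 by blast
      have "D \<omega> = 0"
        by (rule inj[OF X(2)[OF \<omega>(1)] X(1)])
          (simp_all add: rD[OF \<omega>(1)] hD[OF \<omega>(1)] \<omega>(2,3) z(2,3) d0 r(2) h(2))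
      moreover have "\<omega> \<notin> D ` X (p - 1)"
      proof
        assume "\<omega> \<in> D ` X (p - 1)"
        then obtain \<eta> where \<eta>: "\<eta> \<in> X (p - 1)" "\<omega> = D \<eta>" by auto
        have "z = ?\<pi> z" by (rule kernel_proj_fix[of \<theta>, OF z(2), symmetric])
        also have "z = d (r \<eta>)" using rD[OF \<eta>(1)] \<eta>(2) \<omega>(2) by simp
        also have "?\<pi> (d (r \<eta>)) = d (?\<pi> (r \<eta>))" using \<pi>d(1)[OF r(1)[OF \<eta>(1)]] by simp
        finally show False using z(4) \<pi>K[OF r(1)[OF \<eta>(1)]] \<open>z = d (r \<eta>)\<close> by auto
      qed
      ultimately show ?thesis using \<omega>(1) by (auto simp: nontrivial_def)
    next
      assume "nontrivial K d (p - 1)"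
      then obtain z where z: "z \<in> M (p - 1)" "\<theta> z = 0" "d z = 0" "z \<notin> d ` K (p - 1 - 1)"
        by (auto simp: nontrivial_def K_def)
      obtain \<omega> where \<omega>: "\<omega> \<in> X p" "r \<omega> = 0" "h \<omega> = z"
        using surj[OF _ z(1)] M funs.subspace_0 by blast
      have "D \<omega> = 0"
        by (rule inj[OF X(2)[OF \<omega>(1)] X(1)])
          (simp_all add: rD[OF \<omega>(1)] hD[OF \<omega>(1)] \<omega>(2,3) z(2,3) d0 r(2) h(2))
      moreover have "\<omega> \<notin> D ` X (p - 1)"
      proof
        assume "\<omega> \<in> D ` X (p - 1)"
        then obtain \<eta> where \<eta>: "\<eta> \<in> X (p - 1)" "\<omega> = D \<eta>" by auto
        note \<eta>M = r(1)[OF \<eta>(1)] h(1)[OF \<eta>(1)]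
        have eq: "z = \<theta> (r \<eta>) - d (h \<eta>)" using hD[OF \<eta>(1)] \<eta>(2) \<omega>(3) by simp
        have "z = ?\<pi> z" by (rule kernel_proj_fix[of \<theta>, OF z(2), symmetric])
        also have "\<dots> = \<theta> (?\<pi> (r \<eta>)) - d (?\<pi> (h \<eta>))"
          unfolding eq module_hom.diff[OF fun_linear_kernel_proj(1)[OF \<theta>(1)]]
          by (simp only: \<pi>d(1)[OF \<eta>M(2)] \<pi>\<theta>(1)[OF \<eta>M(1)])
        also have "\<dots> = d (- ?\<pi> (h \<eta>))"
          using diag[OF _ \<eta>M(1)] by (simp add: module_hom.neg[OF d(1)])
        finally have "z = d (- ?\<pi> (h \<eta>))" .
        moreover have "- ?\<pi> (h \<eta>) \<in> K (p - 1 - 1)"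
          using \<pi>K[OF \<eta>M(2)] M by (simp add: K_def funs.subspace_neg module_hom.neg[OF \<theta>(1)])
        ultimately show False using z(4) by blast
      qed
      ultimately show ?thesis using \<omega>(1) by (auto simp: nontrivial_def)
    qed
  qed
qed

section \<open>Lowest weight vectors complement the image of \<open>E\<close>\<close>

locale sl2_rep =
  fixes E F :: "('x \<Rightarrow> 'k::field_char_0) \<Rightarrow> ('x \<Rightarrow> 'k)" and W :: "'k \<Rightarrow> ('x \<Rightarrow> 'k) set"
  assumes lin: "fun_linear E" "fun_linear F"
    and W: "funs.subspace (W \<nu>)"
    and E_W: "u \<in> W \<nu> \<Longrightarrow> E u \<in> W (\<nu> + 2)"
    and F_W: "u \<in> W \<nu> \<Longrightarrow> F u \<in> W (\<nu> - 2)"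
    and comm: "u \<in> W \<nu> \<Longrightarrow> E (F u) - F (E u) = fun_scale \<nu> u"
    and E_nil: "u \<in> W \<nu> \<Longrightarrow> \<exists>k. (E ^^ k) u = 0"
    and F_nil: "u \<in> W \<nu> \<Longrightarrow> \<exists>k. (F ^^ k) u = 0"
begin

text \<open>
  This exchange turns statements on highest weight vectors into ones on lowest weight vectors.
\<close>

lemma swap: "sl2_rep F E (\<lambda>\<nu>. W (- \<nu>))"
proof unfold_locales
  fix u :: "'x \<Rightarrow> 'k" and \<nu> assume u: "u \<in> W (- \<nu>)"
  show "F u \<in> W (- (\<nu> + 2))" using F_W[OF u] by (simp add: algebra_simps)
  show "E u \<in> W (- (\<nu> - 2))" using E_W[OF u] by (simp add: algebra_simps)
  have "F (E u) - E (F u) = - fun_scale (- \<nu>) u" unfolding comm[OF u, symmetric] by simp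
  then show "F (E u) - E (F u) = fun_scale \<nu> u" by simp
  show "\<exists>k. (F ^^ k) u = 0" by (rule F_nil[OF u])
  show "\<exists>k. (E ^^ k) u = 0" by (rule E_nil[OF u])
qed (rule module_hom.add[OF lin(1)] module_hom.add[OF lin(2)] module_hom.scale[OF lin(1)]
    module_hom.scale[OF lin(2)] W)+

lemma pow_scale: "(E ^^ k) (fun_scale c u) = fun_scale c ((E ^^ k) u)"
    "(F ^^ k) (fun_scale c u) = fun_scale c ((F ^^ k) u)"
  by (induction k) (simp_all add: module_hom.scale[OF lin(1)] module_hom.scale[OF lin(2)])

lemma pow_diff: "(F ^^ k) (u - v) = (F ^^ k) u - (F ^^ k) v"
  by (induction k) (simp_all only: funpow.simps o_apply id_apply module_hom.diff[OF lin(2)])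

lemma pow_zero: "(E ^^ k) 0 = 0" "(F ^^ k) 0 = 0"
  by (induction k) (simp_all add: module_hom.zero[OF lin(1)] module_hom.zero[OF lin(2)])

lemma pow_W:
  assumes "u \<in> W \<nu>"
  shows "(E ^^ k) u \<in> W (\<nu> + 2 * of_nat k)" "(F ^^ k) u \<in> W (\<nu> - 2 * of_nat k)"
proof -
  show "(E ^^ k) u \<in> W (\<nu> + 2 * of_nat k)"
  proof (induction k)
    case (Suc k)
    then show ?case using E_W[OF Suc] by (simp add: algebra_simps)
  qed (use assms in simp)
  show "(F ^^ k) u \<in> W (\<nu> - 2 * of_nat k)"
  proof (induction k)
    case (Suc k)
    then show ?case using F_W[OF Suc] by (simp add: algebra_simps)
  qed (use assms in simp)
qed

lemma E_F_pow:
  assumes "u \<in> W \<nu>"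
  shows "E ((F ^^ Suc k) u) = (F ^^ Suc k) (E u) + fun_scale (of_nat (Suc k) * (\<nu> - of_nat k)) ((F ^^ k) u)"
proof (induction k)
  case 0
  then show ?case using comm[OF assms] by (simp add: algebra_simps)
next
  case (Suc k)
  let ?v = "(F ^^ Suc k) u"
  have "E (F ?v) = F (E ?v) + fun_scale (\<nu> - 2 * of_nat (Suc k)) ?v"
    using comm[OF pow_W(2)[OF assms, of "Suc k"]] by (simp add: algebra_simps)
  also have "F (E ?v) = (F ^^ Suc (Suc k)) (E u) + fun_scale (of_nat (Suc k) * (\<nu> - of_nat k)) ?v"
    unfolding Suc module_hom.add[OF lin(2)] module_hom.scale[OF lin(2)] by simp
  finally have "E ((F ^^ Suc (Suc k)) u) = (F ^^ Suc (Suc k)) (E u)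
      + fun_scale (of_nat (Suc k) * (\<nu> - of_nat k) + (\<nu> - 2 * of_nat (Suc k))) ?v"
    by (simp only: funpow.simps o_apply funs.scale_left_distrib add.assoc)
  also have "of_nat (Suc k) * (\<nu> - of_nat k) + (\<nu> - 2 * of_nat (Suc k))
      = of_nat (Suc (Suc k)) * (\<nu> - of_nat (Suc k))"
    by (simp add: algebra_simps)
  finally show ?case .
qed

lemma string_up_down:
  assumes "u \<in> W \<nu>" "E u = 0"
  shows "(E ^^ k) ((F ^^ k) u) = fun_scale (\<Prod>j<k. of_nat (Suc j) * (\<nu> - of_nat j)) u"
proof (induction k)
  case (Suc k)
  have "(E ^^ Suc k) ((F ^^ Suc k) u) = (E ^^ k) (E ((F ^^ Suc k) u))"
    by (simp only: funpow_Suc_right o_apply)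
  also have "\<dots> = fun_scale (of_nat (Suc k) * (\<nu> - of_nat k)) ((E ^^ k) ((F ^^ k) u))"
    unfolding E_F_pow[OF assms(1)] assms(2) pow_zero by (simp add: pow_scale del: of_nat_Suc)
  finally show ?case by (simp only: Suc funs.scale_scale prod.lessThan_Suc mult.commute)
qed simp

text \<open>
  If \<open>F\<^sup>k u = 0\<close> then \<open>F\<^bsup>k+1\<^esup> (E u) = 0\<close> by \<open>E_F_pow\<close>, and the weight of \<open>E u\<close> is larger by \<open>2\<close>; so
  \<open>E u = 0\<close> by induction on the nilpotency degree of \<open>E\<close>, and for a highest weight vector
  \<open>E\<^sup>k F\<^sup>k\<close> is a nonzero multiple of the identity.  Weights that are not integers are covered because the
  scalars \<open>\<nu> - j\<close> do not vanish for them either.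
\<close>

lemma F_pow_injective:
  assumes "u \<in> W \<nu>" "(F ^^ k) u = 0" "\<And>z. \<nu> = of_int z \<Longrightarrow> int k \<le> z"
  shows "u = 0"
proof -
  obtain e where "(E ^^ e) u = 0" using E_nil[OF assms(1)] by blast
  then show ?thesis using assms
  proof (induction e arbitrary: u \<nu> k)
    case (Suc e)
    have "(F ^^ Suc k) u = F ((F ^^ k) u)" by simp
    also have "\<dots> = 0" by (simp only: Suc.prems(3) module_hom.zero[OF lin(2)])
    finally have Fk: "(F ^^ Suc k) u = 0" .
    have "(F ^^ Suc k) (E u) = 0"
      using E_F_pow[OF Suc.prems(2), of k]
      by (simp only: Fk Suc.prems(3) module_hom.zero[OF lin(1)] funs.scale_zero_right add_0_right)
    moreover have "int (Suc k) \<le> z" if "\<nu> + 2 = of_int z" for z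
      using Suc.prems(4)[of "z - 2"] that by (simp add: algebra_simps)
    moreover have "(E ^^ e) (E u) = 0" using Suc.prems(1) by (simp only: funpow_Suc_right o_apply)
    ultimately have "E u = 0" using Suc.IH[OF _ E_W[OF Suc.prems(2)]] by blast
    then have "0 = fun_scale (\<Prod>j<k. of_nat (Suc j) * (\<nu> - of_nat j)) u"
      using string_up_down[OF Suc.prems(2), of k] by (simp only: Suc.prems(3) pow_zero)
    moreover have "(\<Prod>j<k. of_nat (Suc j) * (\<nu> - of_nat j)) \<noteq> 0"
    proof -
      have "\<nu> \<noteq> of_nat j" if "j < k" for j
        using Suc.prems(4)[of "int j"] that by auto
      then show ?thesis by (simp del: of_nat_Suc)
    qed
    ultimately show ?case by (metis funs.scale_eq_0_iff)
  qed simp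
qed

text \<open>
  Induction on \<open>k\<close> with \<open>F\<^sup>k u = 0\<close>.  If \<open>F\<^bsup>k+1\<^esup> u = 0\<close>, then \<open>v = F\<^sup>k u\<close> is a lowest weight vector.  Subtracting
  a multiple of \<open>E\<^sup>k v\<close> from \<open>u\<close> makes \<open>F\<^sup>k u\<close> vanish, provided that \<open>F\<^sup>k E\<^sup>k v\<close> is a nonzero multiple of \<open>v\<close>;
  this is so by the bound on \<open>\<nu>\<close> that \<open>F_pow_injective\<close> gives for \<open>u \<noteq> 0\<close>.
\<close>

theorem image_plus_lowest:
  assumes "u \<in> W \<nu>"
  shows "\<exists>a\<in>W (\<nu> - 2). \<exists>b\<in>W \<nu>. F b = 0 \<and> u = E a + b"
proof -
  obtain k where "(F ^^ k) u = 0" using F_nil[OF assms] by blast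
  then show ?thesis using assms
  proof (induction k arbitrary: u)
    case 0
    have "0 \<in> W (\<nu> - 2)" "0 \<in> W \<nu>" using W funs.subspace_0 by blast+
    moreover have u: "u = 0" using 0(1) by (simp only: funpow.simps id_apply)
    moreover have "F 0 = 0" "0 = E 0 + 0" by (simp_all add: module_hom.zero[OF lin(1)] module_hom.zero[OF lin(2)])
    ultimately show ?case by metis
  next
    case (Suc k)
    define v where "v = (F ^^ k) u"
    have v: "v \<in> W (\<nu> - 2 * of_nat k)" "F v = 0"
      using pow_W(2)[OF Suc.prems(2), of k] Suc.prems(1) by (simp_all only: v_def funpow.simps o_apply)
    show ?case
    proof (cases "k = 0 \<or> v = 0")
      case True
      then show ?thesis
      proof
        assume "k = 0"
        then have "F u = 0" using v(2) by (simp add: v_def)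
        moreover have "0 \<in> W (\<nu> - 2)" using W funs.subspace_0 by blast
        moreover have "u = E 0 + u" by (simp add: module_hom.zero[OF lin(1)])
        ultimately show ?thesis using Suc.prems(2) by metis
      qed (use Suc in \<open>simp add: v_def\<close>)
    next
      case False
      define c where "c = (\<Prod>j<k. of_nat (Suc j) * ((2 * of_nat k - \<nu>) - of_nat j))"
      interpret sw: sl2_rep F E "\<lambda>\<nu>. W (- \<nu>)" by (rule swap)
      have FE: "(F ^^ k) ((E ^^ k) v) = fun_scale c v"
        using sw.string_up_down[of v "2 * of_nat k - \<nu>" k] v by (simp add: c_def)
      have "u \<noteq> 0" using False pow_zero by (auto simp: v_def)
      then obtain z where z: "\<nu> = of_int z" "z \<le> int k"
        using F_pow_injective[OF Suc.prems(2,1)] by force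
      have "(2 * of_nat k - \<nu>) - of_nat j \<noteq> 0" if "j < k" for j
      proof -
        have "(2 * of_nat k - \<nu>) - of_nat j = (of_int (2 * int k - z - int j) :: 'k)" by (simp add: z)
        moreover have "2 * int k - z - int j \<noteq> 0" using z that by simp
        ultimately show ?thesis by (simp only: of_int_eq_0_iff not_False_eq_True)
      qed
      then have c: "c \<noteq> 0" by (simp add: c_def del: of_nat_Suc)
      define w where "w = fun_scale (1 / c) ((E ^^ (k - 1)) v)"
      have Ew: "E w = fun_scale (1 / c) ((E ^^ k) v)"
        using False by (cases k) (simp_all add: w_def module_hom.scale[OF lin(1)])
      have "(\<nu> - 2 * of_nat k) + 2 * of_nat (k - 1) = \<nu> - 2"
        using False by (simp add: of_nat_diff algebra_simps)
      then have "(E ^^ (k - 1)) v \<in> W (\<nu> - 2)"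
        using pow_W(1)[OF v(1), of "k - 1"] by (simp only:)
      then have w: "w \<in> W (\<nu> - 2)" using W by (simp add: w_def funs.subspace_scale)
      have Ew_W: "E w \<in> W \<nu>" using E_W[OF w] by simp
      have "(F ^^ k) (u - E w) = 0"
        unfolding pow_diff Ew pow_scale FE using c by (simp add: v_def)
      moreover have "u - E w \<in> W \<nu>" using Suc.prems(2) Ew_W W by (simp add: funs.subspace_diff)
      ultimately obtain a b where ab: "a \<in> W (\<nu> - 2)" "b \<in> W \<nu>" "F b = 0" "u - E w = E a + b"
        using Suc.IH by blast
      have "u = E (a + w) + b" using ab(4) by (simp add: module_hom.add[OF lin(1)] algebra_simps)
      moreover have "a + w \<in> W (\<nu> - 2)" using ab(1) w W by (simp add: funs.subspace_add)
      ultimately show ?thesis using ab by blast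
    qed
  qed
qed

end

section \<open>The concrete algebras\<close>

definition basis_vec :: "nat \<Rightarrow> 'k::field glV" where
  "basis_vec j = (0, \<lambda>k. if k = j then 1 else 0)"

lemma glV_scale_vec: "glV_scale c (0, v) = (0, \<lambda>k. c * v k)"
  by (simp add: glV_scale_def map_matrix_def vec_eq_iff)

lemma bracket_basis_vec:
  fixes n :: nat
  shows "bracket n E_el (basis_vec (Suc j)) = (basis_vec j :: 'k::field_char_0 glV)" "bracket n E_el (basis_vec 0) = (0 :: 'k glV)"
    and "bracket n F_el (basis_vec j) = glV_scale (of_nat (Suc j) * (of_nat n - of_nat j)) (basis_vec (Suc j) :: 'k glV)"
    and "bracket n H_el (basis_vec j) = glV_scale (of_nat n - 2 * of_nat j) (basis_vec j :: 'k glV)"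
    and "bracket n I_el (basis_vec j) = (basis_vec j :: 'k glV)"
  by (auto simp: basis_vec_def bracket_E_V bracket_F_V bracket_H_V bracket_I_V glV_scale_vec fun_eq_iff
      E_op_def F_op_def H_op_def zero_prod_def)

lemma bracket_generators:
  fixes n :: nat
  shows "bracket n E_el F_el = (H_el :: 'k::field_char_0 glV)"
    and "bracket n H_el E_el = glV_scale 2 (E_el :: 'k glV)"
    and "bracket n H_el F_el = glV_scale (- 2) (F_el :: 'k glV)"
    and "bracket n I_el E_el = (0 :: 'k glV)" "bracket n I_el F_el = (0 :: 'k glV)"
    and "bracket n H_el I_el = (0 :: 'k glV)"
  by (simp_all add: prod_eq_iff gl_unfold glV_scale_def map_matrix_def E_mat_def F_mat_def H_mat_def I_mat_def
      mat_def)

lemma subspace_V: "glV.subspace (V n)"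
  unfolding glV.subspace_def V_def
  by (auto simp: zero_prod_def glV_scale_vec)

lemma V_span: "(V n :: 'k::field glV set) = glV.span (basis_vec ` {..n})"
proof
  have *: "(0, v) \<in> glV.span (basis_vec ` {..n})" if "m \<le> Suc n" "\<forall>k\<ge>m. v k = 0" for m and v :: "nat \<Rightarrow> 'k"
    using that
  proof (induction m arbitrary: v)
    case 0
    then have "(0, v) = (0 :: 'k glV)" by (simp add: zero_prod_def fun_eq_iff)
    then show ?case by (simp only: glV.span_zero)
  next
    case (Suc m)
    have "(0, v) = (0, v(m := 0)) + glV_scale (v m) (basis_vec m)"
      by (auto simp: basis_vec_def glV_scale_vec fun_eq_iff)
    moreover have "(0, v(m := 0)) \<in> glV.span (basis_vec ` {..n})"
      using Suc.prems by (intro Suc.IH) (auto simp: Suc_le_eq)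
    moreover have "glV_scale (v m) (basis_vec m) \<in> glV.span (basis_vec ` {..n})"
      using Suc.prems by (intro glV.span_scale glV.span_base) auto
    ultimately show ?case by (simp only: glV.span_add)
  qed
  show "V n \<subseteq> (glV.span (basis_vec ` {..n}) :: 'k glV set)"
  proof
    fix x :: "'k glV" assume "x \<in> V n"
    then obtain v where "x = (0, v)" "\<forall>k>n. v k = 0" by (auto simp: V_def)
    then show "x \<in> glV.span (basis_vec ` {..n})" using *[of "Suc n" v] by (simp add: Suc_le_eq)
  qed
  show "glV.span (basis_vec ` {..n}) \<subseteq> (V n :: 'k glV set)"
    by (intro glV.span_minimal subspace_V) (auto simp: basis_vec_def V_def)
qed

lemma span_insert_span: "glV.span (insert x (glV.span S)) = glV.span (insert x S)"
proof
  show "glV.span (insert x (glV.span S)) \<subseteq> glV.span (insert x S)"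
    using glV.span_mono[of S "insert x S"] by (intro glV.span_minimal) (auto simp: glV.span_base)
  show "glV.span (insert x S) \<subseteq> glV.span (insert x (glV.span S))"
    by (intro glV.span_mono insert_mono glV.span_superset)
qed

lemma filiform_span: "filiform n = glV.span (insert E_el (basis_vec ` {..n}))"
  by (simp add: filiform_def V_span span_insert_span)

lemma filiform_eigenbasis:
  assumes "s \<in> insert E_el (basis_vec ` {..n})"
  shows "\<exists>c. bracket n H_el s = glV_scale c (s :: 'k::field_char_0 glV)"
    "\<exists>c. bracket n I_el s = glV_scale c (s :: 'k glV)"
proof -
  consider "s = E_el" | j where "s = basis_vec j" using assms by blast
  then have "(\<exists>c. bracket n H_el s = glV_scale c s) \<and> (\<exists>c. bracket n I_el s = glV_scale c s)"
  proof cases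
    case 1
    then have "bracket n H_el s = glV_scale 2 s" "bracket n I_el s = glV_scale 0 s" by (simp_all add: bracket_generators)
    then show ?thesis by blast
  next
    case 2
    then have "bracket n H_el s = glV_scale (of_nat n - 2 * of_nat j) s" "bracket n I_el s = glV_scale 1 s"
      by (simp_all add: bracket_basis_vec)
    then show ?thesis by blast
  qed
  then show "\<exists>c. bracket n H_el s = glV_scale c s" "\<exists>c. bracket n I_el s = glV_scale c s" by blast+
qed

text \<open>
  The algebra \<open>\<K>I \<ltimes> \<ff>\<^sub>n\<close>, the intermediate step between \<open>\<ff>\<^sub>n\<close> and \<open>\<ss>\<^sub>n\<close>.
\<close>

definition filiform_I :: "nat \<Rightarrow> 'k::field glV set" where
  "filiform_I n = glV.span (insert I_el (filiform n))"

lemma filiform_I_span: "filiform_I n = glV.span (insert I_el (insert E_el (basis_vec ` {..n})))"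
  by (simp add: filiform_I_def filiform_span span_insert_span)

lemma solv_span: "(solv n :: 'k::field glV set) = glV.span (insert H_el (filiform_I n))"
proof -
  have "(solv n :: 'k glV set) = glV.span (V n \<union> {H_el, I_el, E_el})" by (simp add: solv_def Un_commute)
  also have "\<dots> = glV.span (insert H_el (insert I_el (insert E_el (V n))))"
    by simp
  also have "\<dots> = glV.span (insert H_el (filiform_I n))"
  proof -
    have "filiform_I n = (glV.span (insert I_el (insert E_el (V n))) :: 'k glV set)"
      unfolding filiform_I_def filiform_def by (rule span_insert_span)
    then show ?thesis by (simp only: span_insert_span)
  qed
  finally show ?thesis .
qed

lemma normalizes_V: "normalizes n x (V n)"
  by (simp add: normalizes_def V_ideal)

lemma bracket_V_V:
  fixes y z :: "'k::field glV"
  assumes "y \<in> V n" "z \<in> V n"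
  shows "bracket n y z = 0"
proof -
  have "gl_act n 0 w = (0 :: nat \<Rightarrow> 'k)" for w by (simp add: gl_unfold)
  then show ?thesis using assms
    by (auto simp: V_def bracket_def matrix_matrix_mult_def vec_eq_iff zero_prod_def)
qed

lemma normalizes_filiform:
  fixes x :: "'k::field glV"
  assumes "bracket n x E_el = glV_scale c E_el"
  shows "normalizes n x (filiform n)"
  unfolding filiform_def
proof (rule normalizes_span)
  fix s :: "'k glV" assume "s \<in> insert E_el (V n)"
  then show "bracket n x s \<in> glV.span (insert E_el (V n))"
    using assms V_ideal[of s n x] by (auto simp: glV.span_scale glV.span_base)
qed

lemma extensionI:
  fixes x :: "'k::field_char_0 glV"
  assumes L: "glV.subspace L" and closed: "\<And>y z. y \<in> L \<Longrightarrow> z \<in> L \<Longrightarrow> bracket n y z \<in> L"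
    and x: "normalizes n x L" and g: "g = glV.span (insert x L)"
    and \<xi>: "\<And>y z. \<xi> (y + z) = \<xi> y + \<xi> z" "\<And>c y. \<xi> (glV_scale c y) = c * \<xi> y"
      "\<xi> x = 1" "\<And>y. y \<in> L \<Longrightarrow> \<xi> y = 0"
    and l: "\<And>y z. \<lbrakk>y \<in> g; z \<in> g\<rbrakk> \<Longrightarrow> l (y + z) = l y + l z" "\<And>c y. y \<in> g \<Longrightarrow> l (glV_scale c y) = c * l y"
      "\<And>y z. \<lbrakk>y \<in> g; z \<in> g\<rbrakk> \<Longrightarrow> l (bracket n y z) = 0"
  shows "extension n g l L x \<xi>"
proof -
  have sub: "L \<subseteq> g" "x \<in> g" "glV.subspace g"
    unfolding g by (auto simp: glV.span_base)
  have complement: "y - glV_scale (\<xi> y) x \<in> L" if y: "y \<in> g" for y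
  proof -
    obtain k where k: "y - glV_scale k x \<in> L"
      using y unfolding g glV.span_insert glV.span_eq_iff[THEN iffD2, OF L] by blast
    have "\<xi> (y - glV_scale k x + glV_scale k x) = k" unfolding \<xi>(1) \<xi>(2) using \<xi>(3,4) k by simp
    then show ?thesis using k by simp
  qed
  have ideal: "bracket n y z \<in> L" if y: "y \<in> g" and z: "z \<in> L" for y z
  proof -
    let ?y = "y - glV_scale (\<xi> y) x"
    have "bracket n y z = bracket n ?y z + glV_scale (\<xi> y) (bracket n x z)"
      using bracket_add_left[of n ?y "glV_scale (\<xi> y) x" z] by (simp add: bracket_scale_left)
    then show ?thesis
      using closed[OF complement[OF y] z] x z L by (simp add: normalizes_def glV.subspace_add glV.subspace_scale)
  qed
  have closed_g: "bracket n y z \<in> g" if y: "y \<in> g" and z: "z \<in> g" for y z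
  proof -
    let ?y = "y - glV_scale (\<xi> y) x" and ?z = "z - glV_scale (\<xi> z) x"
    have "bracket n y x = bracket n ?y x"
      using bracket_add_left[of n ?y "glV_scale (\<xi> y) x" x] by (simp add: bracket_scale_left bracket_self)
    also have "\<dots> = - bracket n x ?y" by (rule bracket_anticomm)
    also have "\<dots> \<in> g"
      using ideal[OF sub(2) complement[OF y]] sub(1,3) by (simp add: glV.subspace_neg subsetD)
    finally have yx: "bracket n y x \<in> g" .
    have "bracket n y z = bracket n y ?z + glV_scale (\<xi> z) (bracket n y x)"
      using bracket_add_right[of n y ?z "glV_scale (\<xi> z) x"] by (simp add: bracket_scale_right)
    then show ?thesis
      using ideal[OF y complement[OF z]] yx sub by (simp add: glV.subspace_add glV.subspace_scale subsetD)
  qed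
  show ?thesis
  proof unfold_locales
    show "glV.subspace g" "glV.subspace L" "L \<subseteq> g" "x \<in> g" "\<xi> x = 1" by (fact sub L \<xi>)+
  qed (fact closed_g l ideal \<xi> complement | (rule closed_g l ideal \<xi> complement; assumption))+
qed

text \<open>
  The coefficients of an upper triangular matrix in \<open>E\<close>, \<open>I\<close> and \<open>H\<close>.
\<close>

definition xi_E :: "'k::field glV \<Rightarrow> 'k" where "xi_E y = fst y $ 1 $ 2"
definition xi_I :: "'k::field glV \<Rightarrow> 'k" where "xi_I y = (fst y $ 1 $ 1 + fst y $ 2 $ 2) / 2"
definition xi_H :: "'k::field glV \<Rightarrow> 'k" where "xi_H y = (fst y $ 1 $ 1 - fst y $ 2 $ 2) / 2"

lemmas xi_defs = xi_E_def xi_I_def xi_H_def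

lemma xi_linear:
  "xi_E (y + z) = xi_E y + xi_E z" "xi_E (glV_scale c y) = c * xi_E y"
  "xi_I (y + z) = xi_I y + xi_I z" "xi_I (glV_scale c y) = c * xi_I y"
  "xi_H (y + z) = xi_H y + xi_H z" "xi_H (glV_scale c y) = c * xi_H y"
  by (simp_all add: xi_defs glV_scale_def map_matrix_def add_divide_distrib diff_divide_distrib algebra_simps)

lemma xi_values:
  "xi_E (E_el :: 'k::field_char_0 glV) = 1" "xi_E (I_el :: 'k glV) = 0" "xi_E (H_el :: 'k glV) = 0"
  "xi_I (E_el :: 'k glV) = 0" "xi_I (I_el :: 'k glV) = 1" "xi_I (H_el :: 'k glV) = 0"
  "xi_H (E_el :: 'k glV) = 0" "xi_H (I_el :: 'k glV) = 0" "xi_H (H_el :: 'k glV) = 1"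
  "y \<in> V n \<Longrightarrow> xi_E y = 0" "y \<in> V n \<Longrightarrow> xi_I y = 0" "y \<in> V n \<Longrightarrow> xi_H y = 0"
  by (auto simp: xi_defs E_mat_def I_mat_def H_mat_def mat_def V_def)

lemma vanish_on_span:
  assumes "\<And>y z. \<xi> (y + z) = \<xi> y + (\<xi> z :: 'k::field)" "\<And>c y. \<xi> (glV_scale c y) = c * \<xi> y"
    and "\<And>s. s \<in> S \<Longrightarrow> \<xi> s = 0" "y \<in> glV.span S"
  shows "\<xi> y = 0"
  using assms(4)
proof (induction rule: glV.span_induct_alt)
  case base
  show ?case using assms(2)[of 0 0] by simp
qed (simp add: assms)

lemma xi_filiform:
  assumes "y \<in> (filiform n :: 'k::field_char_0 glV set)"
  shows "xi_I y = 0" "xi_H y = 0"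
  by (rule vanish_on_span[OF xi_linear(3,4) _ assms[unfolded filiform_def]]; elim insertE; simp add: xi_values)
    (rule vanish_on_span[OF xi_linear(5,6) _ assms[unfolded filiform_def]]; elim insertE; simp add: xi_values)

lemma xi_filiform_I:
  assumes "y \<in> (filiform_I n :: 'k::field_char_0 glV set)"
  shows "xi_H y = 0"
  by (rule vanish_on_span[OF xi_linear(5,6) _ assms[unfolded filiform_I_def]]; elim insertE;
      simp add: xi_values xi_filiform)

interpretation fil: extension n "filiform n" "0 :: 'k::field_char_0 glV \<Rightarrow> 'k" "V n" E_el xi_E for n
proof (rule extensionI)
  show "filiform n = glV.span (insert E_el (V n))" by (rule filiform_def)
qed (simp_all add: subspace_V V_ideal normalizes_V xi_linear xi_values)

section \<open>The cohomology of the filiform algebra in coordinates\<close>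

lemma lie_der_zero: "lie_der n L 0 x = contra n L x"
  by (simp add: lie_der_def fun_eq_iff)

lemma CE_d_V: "\<omega> \<in> cochains (V n) p \<Longrightarrow> CE_d n (V n) 0 \<omega> = 0"
proof
  fix xs assume \<omega>: "\<omega> \<in> cochains (V n) p"
  have "\<omega> (bracket n (xs ! i) (xs ! j) # ys) = 0" if "set xs \<subseteq> V n" "i < j" "j < length xs" for i j ys
  proof -
    have "xs ! i \<in> V n" "xs ! j \<in> V n" using that nth_mem[of i xs] nth_mem[of j xs] by auto
    then show ?thesis using cochain_zero_arg[OF \<omega>] by (simp add: bracket_V_V)
  qed
  then show "CE_d n (V n) 0 \<omega> xs = 0 xs" by (simp add: CE_d_def)
qed

lemma subspace_image:
  assumes "fun_linear T" "funs.subspace M"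
  shows "funs.subspace (T ` M)"
proof (rule funs.subspaceI)
  show "0 \<in> T ` M" using module_hom.zero[OF assms(1)] funs.subspace_0[OF assms(2)] by (metis image_eqI)
  show "x + y \<in> T ` M" if xy: "x \<in> T ` M" "y \<in> T ` M" for x y
  proof -
    obtain a b where "a \<in> M" "b \<in> M" "x = T a" "y = T b" using xy by blast
    then show ?thesis using module_hom.add[OF assms(1), of a b] funs.subspace_add[OF assms(2)] by (metis image_eqI)
  qed
  show "fun_scale c x \<in> T ` M" if x: "x \<in> T ` M" for c x
  proof -
    obtain a where "a \<in> M" "x = T a" using x by blast
    then show ?thesis using module_hom.scale[OF assms(1), of c a] funs.subspace_scale[OF assms(2)] by (metis image_eqI)
  qed
qed

lemma fun_linear_contra: "fun_linear (contra n L x)"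
  by (rule fun_linearI) (simp_all add: contra_linear)

lemma subspace_coboundaries: "funs.subspace (coboundaries n L l p)"
  unfolding coboundaries_def by (rule subspace_image[OF fun_linear_CE_d subspace_cochains])

lemma subspace_E_image: "funs.subspace (E_image n p)"
  unfolding E_image_def by (rule subspace_image[OF fun_linear_contra subspace_cochains])

text \<open>
  In coordinates \<open>d (u, w) = (0, E u)\<close>, since \<open>d = 0\<close> on \<open>\<Lambda>V\<^sub>n\<^sup>*\<close>.
\<close>

lemma coords_d:
  assumes "\<omega> \<in> cochains (filiform n) p"
  shows "restrict_form (V n) (CE_d n (filiform n) 0 \<omega>) = 0"
    and "fil.head n (CE_d n (filiform n) 0 \<omega>) = contra n (V n) E_el (restrict_form (V n) \<omega>)"
  unfolding fil.restrict_CE_d fil.head_CE_d[OF assms] lie_der_zero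
    CE_d_V[OF fil.coords_cochain(1)[OF assms]] CE_d_V[OF fil.coords_cochain(2)[OF assms]]
  by simp_all

lemma cocycles_filiform:
  fixes z :: "'k::field_char_0 form"
  shows
  "z \<in> cocycles n (filiform n) 0 p \<longleftrightarrow>
    z \<in> cochains (filiform n) p \<and> contra n (V n) E_el (restrict_form (V n) z) = 0"
proof (cases "z \<in> cochains (filiform n) p")
  case z: True
  have "CE_d n (filiform n) 0 z = 0 \<longleftrightarrow> contra n (V n) E_el (restrict_form (V n) z) = 0"
  proof
    assume "CE_d n (filiform n) 0 z = 0"
    then show "contra n (V n) E_el (restrict_form (V n) z) = 0"
      using coords_d(2)[OF z] fil.head_linear(4) by metis
  next
    assume "contra n (V n) E_el (restrict_form (V n) z) = 0"
    then have "fil.head n (CE_d n (filiform n) 0 z) = fil.head n 0"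
      using coords_d(2)[OF z] fil.head_linear(4) by metis
    moreover have "restrict_form (V n) (CE_d n (filiform n) 0 z) = restrict_form (V n) 0"
      using coords_d(1)[OF z] restrict_form_linear(4) by metis
    ultimately show "CE_d n (filiform n) 0 z = 0"
      using fil.form_eqI[OF fil.cochain_CE_d[OF z] cochain_zero_form] by blast
  qed
  then show ?thesis using z by (simp add: cocycles_def)
qed (simp add: cocycles_def)

lemma coboundaries_filiform:
  fixes z :: "'k::field_char_0 form"
  shows
  "z \<in> Bfil n p \<longleftrightarrow>
    z \<in> cochains (filiform n) p \<and> restrict_form (V n) z = 0 \<and> fil.head n z \<in> E_image n (p - 1)"
proof
  assume "z \<in> Bfil n p"
  then obtain \<eta> where \<eta>: "\<eta> \<in> cochains (filiform n) (p - 1)" "z = CE_d n (filiform n) 0 \<eta>"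
    by (auto simp: coboundaries_def)
  then have "z \<in> cochains (filiform n) p" using fil.cochain_CE_d[OF \<eta>(1)] by simp
  moreover have "restrict_form (V n) z = 0" unfolding \<eta>(2) by (rule coords_d(1)[OF \<eta>(1)])
  moreover have "fil.head n z \<in> E_image n (p - 1)"
    unfolding \<eta>(2) coords_d(2)[OF \<eta>(1)] E_image_def using fil.coords_cochain(1)[OF \<eta>(1)] by blast
  ultimately show "z \<in> cochains (filiform n) p \<and> restrict_form (V n) z = 0 \<and> fil.head n z \<in> E_image n (p - 1)"
    by blast
next
  assume z: "z \<in> cochains (filiform n) p \<and> restrict_form (V n) z = 0 \<and> fil.head n z \<in> E_image n (p - 1)"
  then obtain u where u: "u \<in> Lam n (p - 1)" "fil.head n z = contra n (V n) E_el u"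
    by (auto simp: E_image_def)
  obtain \<eta> where \<eta>: "\<eta> \<in> cochains (filiform n) (p - 1)" "restrict_form (V n) \<eta> = u"
    using fil.coords_surj[OF u(1) cochain_zero_form] by blast
  have d: "CE_d n (filiform n) 0 \<eta> \<in> cochains (filiform n) p" using fil.cochain_CE_d[OF \<eta>(1)] by simp
  have "z = CE_d n (filiform n) 0 \<eta>"
    by (rule fil.form_eqI[OF conjunct1[OF z] d])
      (use z u \<eta> coords_d[OF \<eta>(1)] in metis)+
  then show "z \<in> Bfil n p" using \<eta>(1) by (auto simp: coboundaries_def)
qed

lemma extend_eq_pull:
  fixes u :: "'k::field_char_0 form"
  shows "extend n u = fil.pull n u"
proof
  fix xs :: "'k glV list"
  have "(0, snd y) = fil.proj y" if y: "y \<in> filiform n" for y :: "'k glV"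
  proof -
    obtain v where "y - glV_scale (xi_E y) E_el = (0, v)" using fil.complement[OF y] by (auto simp: V_def)
    then have "fst (fil.proj y) = 0" unfolding fil.proj_def by (simp only: fst_conv)
    moreover have "snd (fil.proj y) = snd y" by (simp add: fil.proj_def glV_scale_def fun_eq_iff)
    ultimately show ?thesis by (metis prod.collapse)
  qed
  then show "extend n u xs = fil.pull n u xs"
    by (auto simp: extend_def fil.pull_def intro!: arg_cong[where f = u] map_cong)
qed

lemma tensor_eq_wedge:
  fixes w :: "'k::field_char_0 form"
  shows "tensor_E_star n w = fil.wedge n w"
proof -
  have "E_star n = (one_form (filiform n) xi_E :: 'k form)"
    by (rule ext) (simp add: E_star_def one_form_def xi_E_def)
  then show ?thesis by (simp add: tensor_E_star_def fil.wedge_def extend_eq_pull)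
qed

lemma fun_linear_extend: "fun_linear (extend n)"
  by (rule fun_linearI) (simp_all add: fun_eq_iff extend_def)

lemma fun_linear_tensor: "fun_linear (tensor_E_star n :: ('k::field form) \<Rightarrow> _)"
proof -
  have "extend n (a + b) = extend n a + extend n b" "extend n (fun_scale c a) = fun_scale c (extend n a)"
    for a b :: "'k form" and c
    by (rule module_hom.add[OF fun_linear_extend] module_hom.scale[OF fun_linear_extend])+
  then show ?thesis unfolding tensor_E_star_def by (intro fun_linearI) (simp_all add: wedge1_linear)
qed

lemma coords_extend:
  fixes u :: "'k::field_char_0 form"
  assumes "u \<in> Lam n p"
  shows "extend n u \<in> cochains (filiform n) p" "restrict_form (V n) (extend n u) = u"
    "fil.head n (extend n u) = 0"
  unfolding extend_eq_pull using fil.cochain_pull[OF assms] fil.coords_pull[OF assms] by auto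

lemma coords_tensor:
  fixes w :: "'k::field_char_0 form"
  assumes "w \<in> Lam n (p - 1)"
  shows "tensor_E_star n w \<in> cochains (filiform n) p" "restrict_form (V n) (tensor_E_star n w) = 0"
    "fil.head n (tensor_E_star n w) = fun_scale ((- 1) ^ nat (p - 1)) w"
  unfolding tensor_eq_wedge using fil.cochain_wedge[OF assms] fil.coords_wedge[OF assms] by simp_all

subsection \<open>Cosets\<close>

lemma coset_eq_iff:
  assumes "funs.subspace B"
  shows "z +o B = z' +o B \<longleftrightarrow> z - z' \<in> B"
proof
  assume eq: "z +o B = z' +o B"
  have "z \<in> z +o B" using funs.subspace_0[OF assms] by (auto simp: elt_set_plus_def intro!: bexI[of _ 0])
  then obtain b where "b \<in> B" "z = z' + b" unfolding eq by (auto simp: elt_set_plus_def)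
  then show "z - z' \<in> B" by simp
next
  assume d: "z - z' \<in> B"
  have 1: "z + b = z' + ((z - z') + b)" "z' + b = z + (b - (z - z'))" for b by simp_all
  have "(z - z') + b \<in> B" "b - (z - z') \<in> B" if "b \<in> B" for b
    using d that assms by (simp_all add: funs.subspace_add funs.subspace_diff)
  then show "z +o B = z' +o B" unfolding elt_set_plus_def using 1 by blast
qed

lemma coset_plus_coset:
  assumes "funs.subspace B"
  shows "(z +o B) + (z' +o B) = (z + z') +o B"
proof -
  have "B + B = B"
    using funs.subspace_add[OF assms] funs.subspace_0[OF assms] by (force simp: set_plus_def)
  then show ?thesis by (metis set_plus_rearrange)
qed

lemma quot_map_coset:
  assumes T: "fun_linear T" and B: "funs.subspace B" "funs.subspace B'" "T ` B \<subseteq> B'"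
  shows "quot_map T B' (z +o B) = T z +o B'"
proof -
  have "T ` (z +o B) = T z +o T ` B"
  proof -
    have "T ` (z +o B) = (\<lambda>b. T (z + b)) ` B" by (auto simp: elt_set_plus_def)
    also have "\<dots> = T z +o T ` B" unfolding module_hom.add[OF T] by (auto simp: elt_set_plus_def)
    finally show ?thesis .
  qed
  moreover have "T ` B + B' = B'"
  proof
    show "T ` B + B' \<subseteq> B'" using funs.subspace_add[OF B(2)] B(3) by (auto simp: set_plus_def)
    have "0 \<in> T ` B" using module_hom.zero[OF T] funs.subspace_0[OF B(1)] by (metis image_eqI)
    then show "B' \<subseteq> T ` B + B'" by (rule set_zero_plus2)
  qed
  ultimately show ?thesis by (simp add: quot_map_def set_plus_rearrange3)
qed

subsection \<open>The decomposition\<close>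

lemma tensor_E_image:
  "tensor_E_star n ` E_image n (p - 1) \<subseteq> (Bfil n p :: ('k::field_char_0 form) set)"
proof
  fix z :: "'k form" assume "z \<in> tensor_E_star n ` E_image n (p - 1)"
  then obtain w where w: "w \<in> E_image n (p - 1)" "z = tensor_E_star n w" by blast
  then have "w \<in> Lam n (p - 1)"
    using cochain_contra[OF _ subspace_V normalizes_V] by (auto simp: E_image_def)
  note c = coords_tensor[OF this]
  have "fil.head n z \<in> E_image n (p - 1)"
    unfolding w(2) c(3) using w(1) funs.subspace_scale[OF subspace_E_image] by blast
  then show "z \<in> Bfil n p" using w(2) c(1,2) by (simp add: coboundaries_filiform)
qed

lemma decomp_coset:
  fixes u :: "'k::field_char_0 form"
  shows
  "decomp n p (u, w +o E_image n (p - 1)) = (extend n u + tensor_E_star n w) +o Bfil n p"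
  by (simp add: decomp_def quot_map_coset[OF fun_linear_tensor subspace_E_image subspace_coboundaries tensor_E_image]
      coset_plus_coset[OF subspace_coboundaries])

text \<open>
  The sign comes from \<open>E\<^sup>*\<close> being the last factor of \<open>w \<and> E\<^sup>*\<close>, whereas \<open>head\<close> contracts
  in the first argument.
\<close>

lemma form_split:
  fixes z :: "'k::field_char_0 form"
  assumes "z \<in> cochains (filiform n) p"
  shows "z = extend n (restrict_form (V n) z) + tensor_E_star n (fun_scale ((- 1) ^ nat (p - 1)) (fil.head n z))"
proof (rule fil.form_eqI[OF assms])
  note c = fil.coords_cochain[OF assms]
  let ?w = "fun_scale ((- 1) ^ nat (p - 1)) (fil.head n z)"
  have w: "?w \<in> Lam n (p - 1)" using c(2) by (rule cochain_scale_form)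
  note u' = coords_extend[OF c(1)] and w' = coords_tensor[OF w]
  show "extend n (restrict_form (V n) z) + tensor_E_star n ?w \<in> cochains (filiform n) p"
    using u'(1) w'(1) by (rule cochain_add_form)
  show "restrict_form (V n) z = restrict_form (V n) (extend n (restrict_form (V n) z) + tensor_E_star n ?w)"
    unfolding restrict_form_linear u' w' by simp
  have "(- 1) ^ k * (- 1) ^ k = (1 :: 'k)" for k by (simp flip: power_mult_distrib)
  then show "fil.head n z = fil.head n (extend n (restrict_form (V n) z) + tensor_E_star n ?w)"
    unfolding fil.head_linear u' w' by simp
qed

lemma coords_sum:
  fixes u :: "'k::field_char_0 form"
  assumes "u \<in> Lam n p" "w \<in> Lam n (p - 1)"
  shows "extend n u + tensor_E_star n w \<in> cochains (filiform n) p"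
    "restrict_form (V n) (extend n u + tensor_E_star n w) = u"
    "fil.head n (extend n u + tensor_E_star n w) = fun_scale ((- 1) ^ nat (p - 1)) w"
  unfolding restrict_form_linear fil.head_linear coords_extend[OF assms(1)] coords_tensor[OF assms(2)]
  using coords_extend(1)[OF assms(1)] coords_tensor(1)[OF assms(2)] by (simp_all add: cochain_add_form)

lemma sum_in_coboundaries_iff:
  fixes u :: "'k::field_char_0 form"
  assumes "u \<in> Lam n p" "w \<in> Lam n (p - 1)"
  shows "extend n u + tensor_E_star n w \<in> Bfil n p \<longleftrightarrow> u = 0 \<and> w \<in> E_image n (p - 1)"
proof -
  have "fun_scale ((- 1) ^ k) w \<in> E_image n (p - 1) \<longleftrightarrow> w \<in> E_image n (p - 1)" for k
  proof
    assume "fun_scale ((- 1) ^ k) w \<in> E_image n (p - 1)"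
    then have "fun_scale ((- 1) ^ k) (fun_scale ((- 1) ^ k) w) \<in> E_image n (p - 1)"
      by (rule funs.subspace_scale[OF subspace_E_image])
    then show "w \<in> E_image n (p - 1)" by (simp flip: power_mult_distrib)
  qed (rule funs.subspace_scale[OF subspace_E_image])
  then show ?thesis by (simp add: coboundaries_filiform coords_sum[OF assms])
qed

lemma decomp_bij:
  "bij_betw (decomp n p) (E_invariants n p \<times> E_coinvariants n (p - 1))
    (Hfil n p :: ('k::field_char_0 form) set set)"
  unfolding bij_betw_def
proof
  show "inj_on (decomp n p) (E_invariants n p \<times> E_coinvariants n (p - 1) :: (('k form) \<times> _) set)"
  proof (rule inj_onI)
    fix x y :: "('k form) \<times> 'k form set" assume x: "x \<in> E_invariants n p \<times> E_coinvariants n (p - 1)"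
      and y: "y \<in> E_invariants n p \<times> E_coinvariants n (p - 1)" and eq: "decomp n p x = decomp n p y"
    obtain u w where uw: "x = (u, w +o E_image n (p - 1))" "u \<in> Lam n p" "w \<in> Lam n (p - 1)"
      using x by (auto simp: E_invariants_def E_coinvariants_def quot_def)
    obtain u' w' where uw': "y = (u', w' +o E_image n (p - 1))" "u' \<in> Lam n p" "w' \<in> Lam n (p - 1)"
      using y by (auto simp: E_invariants_def E_coinvariants_def quot_def)
    have "(extend n u + tensor_E_star n w) - (extend n u' + tensor_E_star n w') \<in> Bfil n p"
      using eq unfolding uw(1) uw'(1) decomp_coset coset_eq_iff[OF subspace_coboundaries] .
    also have "(extend n u + tensor_E_star n w) - (extend n u' + tensor_E_star n w')
        = extend n (u - u') + tensor_E_star n (w - w')"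
      unfolding module_hom.diff[OF fun_linear_extend] module_hom.diff[OF fun_linear_tensor] by simp
    finally have *: "extend n (u - u') + tensor_E_star n (w - w') \<in> Bfil n p" .
    have "u - u' \<in> Lam n p" "w - w' \<in> Lam n (p - 1)" using uw uw' by (simp_all add: cochain_diff_form)
    from sum_in_coboundaries_iff[OF this] * have "u - u' = 0 \<and> w - w' \<in> E_image n (p - 1)" by blast
    then show "x = y" by (simp add: uw(1) uw'(1) coset_eq_iff[OF subspace_E_image])
  qed
  show "decomp n p ` (E_invariants n p \<times> E_coinvariants n (p - 1)) = (Hfil n p :: 'k form set set)"
  proof
    show "decomp n p ` (E_invariants n p \<times> E_coinvariants n (p - 1)) \<subseteq> (Hfil n p :: 'k form set set)"
    proof
      fix C :: "'k form set" assume "C \<in> decomp n p ` (E_invariants n p \<times> E_coinvariants n (p - 1))"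
      then obtain u w where uw: "C = decomp n p (u, w +o E_image n (p - 1))" "u \<in> E_invariants n p"
          "w \<in> Lam n (p - 1)"
        by (auto simp: E_coinvariants_def quot_def)
      then have "extend n u + tensor_E_star n w \<in> cocycles n (filiform n) 0 p"
        using coords_sum[OF _ uw(3)] by (simp add: cocycles_filiform E_invariants_def)
      then show "C \<in> Hfil n p" unfolding uw(1) decomp_coset by (simp add: cohomology_def quot_def)
    qed
    show "(Hfil n p :: 'k form set set) \<subseteq> decomp n p ` (E_invariants n p \<times> E_coinvariants n (p - 1))"
    proof
      fix C :: "'k form set" assume "C \<in> Hfil n p"
      then obtain z where z: "C = z +o Bfil n p" "z \<in> cocycles n (filiform n) 0 p"
        by (auto simp: cohomology_def quot_def)
      then have zc: "z \<in> cochains (filiform n) p" and Ez: "contra n (V n) E_el (restrict_form (V n) z) = 0"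
        by (auto simp: cocycles_filiform)
      note c = fil.coords_cochain[OF zc]
      have "C = decomp n p (restrict_form (V n) z, fun_scale ((- 1) ^ nat (p - 1)) (fil.head n z) +o E_image n (p - 1))"
        unfolding decomp_coset form_split[OF zc, symmetric] by (rule z(1))
      moreover have "restrict_form (V n) z \<in> E_invariants n p" using c(1) Ez by (simp add: E_invariants_def)
      moreover have "fun_scale ((- 1) ^ nat (p - 1)) (fil.head n z) +o E_image n (p - 1) \<in> E_coinvariants n (p - 1)"
        unfolding E_coinvariants_def quot_def using cochain_scale_form[OF c(2)] by blast
      ultimately show "C \<in> decomp n p ` (E_invariants n p \<times> E_coinvariants n (p - 1))" by blast
    qed
  qed
qed

lemma coinvariantsE:
  fixes C :: "('k::field_char_0 form) set"
  assumes "C \<in> E_coinvariants n q"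
  obtains w where "w \<in> Lam n q" "C = w +o E_image n q"
  using assms by (auto simp: E_coinvariants_def quot_def)

lemma fun_linear_scale: "fun_linear (fun_scale c)"
  by (rule fun_linearI) (simp_all add: fun_eq_iff algebra_simps)

lemma decomp_add:
  fixes C :: "('k::field_char_0 form) set"
  assumes "C \<in> E_coinvariants n (p - 1)" "C' \<in> E_coinvariants n (p - 1)"
  shows "decomp n p (u + u', C + C') = decomp n p (u, C) + decomp n p (u', C')"
proof -
  obtain w where w: "C = w +o E_image n (p - 1)" using assms(1) by (rule coinvariantsE)
  obtain w' where w': "C' = w' +o E_image n (p - 1)" using assms(2) by (rule coinvariantsE)
  show ?thesis
    unfolding w w' coset_plus_coset[OF subspace_E_image] decomp_coset coset_plus_coset[OF subspace_coboundaries]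
      module_hom.add[OF fun_linear_extend] module_hom.add[OF fun_linear_tensor]
    by (simp only: ac_simps)
qed

lemma decomp_scale:
  fixes C :: "('k::field_char_0 form) set"
  assumes "C \<in> E_coinvariants n (p - 1)"
  shows "decomp n p (fun_scale c u, quot_map (fun_scale c) (E_image n (p - 1)) C)
    = quot_map (fun_scale c) (Bfil n p) (decomp n p (u, C))"
proof -
  obtain w where w: "C = w +o E_image n (p - 1)" using assms by (rule coinvariantsE)
  have sub: "fun_scale c ` B \<subseteq> B" if "funs.subspace B" for B :: "'k form set"
    using funs.subspace_scale[OF that] by blast
  show ?thesis
    unfolding w quot_map_coset[OF fun_linear_scale subspace_E_image subspace_E_image sub[OF subspace_E_image]]
      decomp_coset quot_map_coset[OF fun_linear_scale subspace_coboundaries subspace_coboundaries sub[OF subspace_coboundaries]]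
      module_hom.scale[OF fun_linear_extend] module_hom.scale[OF fun_linear_tensor]
    by (simp only: funs.scale_right_distrib)
qed

subsection \<open>The action of the torus\<close>

lemma contra_zero_left: "\<omega> \<in> cochains L p \<Longrightarrow> glV.subspace L \<Longrightarrow> contra n L 0 \<omega> = 0"
  using contra_scale_left[of \<omega> L p n 0 0] by (simp add: normalizes_def glV.subspace_0)

lemma contra_eigen:
  fixes x y :: "'k::field_char_0 glV"
  assumes "u \<in> cochains L p" "glV.subspace L" "normalizes n x L" "normalizes n y L" "bracket n x y = glV_scale c y"
  shows "contra n L x (contra n L y u) = contra n L y (contra n L x u) + fun_scale c (contra n L y u)"
proof -
  have "contra n L x (contra n L y u) - contra n L y (contra n L x u) = contra n L (bracket n x y) u"
    by (rule contra_commutator[OF assms(1-4)])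
  also have "\<dots> = fun_scale c (contra n L y u)"
    unfolding assms(5) by (rule contra_scale_left[OF assms(1,4)])
  finally show ?thesis by (metis add.commute diff_add_cancel)
qed

lemma torusE:
  fixes x :: "'k::field_char_0 glV"
  assumes "x \<in> torus"
  obtains c where "bracket n x E_el = glV_scale c E_el"
proof -
  obtain a b where "x = glV_scale a H_el + glV_scale b I_el"
    using assms unfolding torus_def glV.span_insert glV.span_empty
    by (auto simp: algebra_simps)
  then have "bracket n x E_el = glV_scale (a * 2) (E_el :: 'k glV)"
    by (simp add: bracket_add_left bracket_scale_left bracket_generators)
  then show ?thesis by (rule that)
qed

lemma coords_contra:
  fixes x :: "'k::field_char_0 glV"
  assumes "\<omega> \<in> cochains (filiform n) p" "bracket n x E_el = glV_scale c E_el"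
  shows "contra n (filiform n) x \<omega> \<in> cochains (filiform n) p"
    "restrict_form (V n) (contra n (filiform n) x \<omega>) = contra n (V n) x (restrict_form (V n) \<omega>)"
    "fil.head n (contra n (filiform n) x \<omega>) = contra n (V n) x (fil.head n \<omega>) - fun_scale c (fil.head n \<omega>)"
  using cochain_contra[OF assms(1) fil.subspace normalizes_filiform[OF assms(2)]]
    fil.restrict_lie_der[OF normalizes_V, of n x \<omega>] fil.head_lie_der[OF assms(1) normalizes_V assms(2)]
  by (simp_all add: lie_der_zero)

text \<open>
  Elements that have \<open>E\<close> as an eigenvector preserve the image of \<open>E\<close>.
\<close>

lemma contra_E_image:
  fixes x :: "'k::field_char_0 glV"
  assumes "bracket n x E_el = glV_scale c E_el" "w \<in> E_image n q"
  shows "contra n (V n) x w \<in> E_image n q"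
proof -
  obtain u where u: "u \<in> Lam n q" "w = contra n (V n) E_el u" using assms(2) by (auto simp: E_image_def)
  have "contra n (V n) x w = contra n (V n) E_el (contra n (V n) x u) + fun_scale c w"
    unfolding u(2) by (rule contra_eigen[OF u(1) subspace_V normalizes_V normalizes_V assms(1)])
  moreover have "contra n (V n) E_el (contra n (V n) x u) \<in> E_image n q"
    using cochain_contra[OF u(1) subspace_V normalizes_V] by (auto simp: E_image_def)
  ultimately show ?thesis
    using assms(2) subspace_E_image by (metis funs.subspace_add funs.subspace_scale)
qed

lemma contra_Bfil:
  fixes x :: "'k::field_char_0 glV"
  assumes "bracket n x E_el = glV_scale c E_el" "z \<in> Bfil n p"
  shows "contra n (filiform n) x z \<in> Bfil n p"
proof -
  have z: "z \<in> cochains (filiform n) p" "restrict_form (V n) z = 0" "fil.head n z \<in> E_image n (p - 1)"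
    using assms(2) by (auto simp: coboundaries_filiform)
  note c = coords_contra[OF z(1) assms(1)]
  have "restrict_form (V n) (contra n (filiform n) x z) = 0"
    unfolding c(2) z(2) by (rule contra_linear(4))
  moreover have "fil.head n (contra n (filiform n) x z) \<in> E_image n (p - 1)"
    unfolding c(3) using contra_E_image[OF assms(1) z(3)] funs.subspace_scale[OF subspace_E_image z(3)]
    by (rule funs.subspace_diff[OF subspace_E_image])
  ultimately show ?thesis using c(1) by (simp add: coboundaries_filiform)
qed

lemma decomp_torus:
  fixes x :: "'k::field_char_0 glV"
  assumes u: "u \<in> Lam n p" and C: "C \<in> E_coinvariants n (p - 1)" and x: "x \<in> torus"
  shows "decomp n p (contra n (V n) x u, coinv_act n (p - 1) x C)
    = quot_map (contra n (filiform n) x) (Bfil n p) (decomp n p (u, C))"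
proof -
  obtain c where c: "bracket n x E_el = glV_scale c E_el" using x by (rule torusE)
  obtain w where w: "w \<in> Lam n (p - 1)" "C = w +o E_image n (p - 1)" using C by (rule coinvariantsE)
  have E: "E_el \<in> (filiform n :: 'k glV set)" by (rule fil.x)
  have "glV_scale c E_el \<in> (filiform n :: 'k glV set)" using E fil.subspace by (rule glV.subspace_scale[rotated])
  then have "contra n (filiform n) x (E_star n) [E_el] = - c"
    using E by (simp add: contra_def E_star_def c) (simp add: glV_scale_def map_matrix_def E_mat_def)
  then have act: "coinv_act n (p - 1) x C = quot_map (\<lambda>w. contra n (V n) x w + fun_scale (- c) w) (E_image n (p - 1)) C"
    by (simp add: coinv_act_def)
  let ?T = "\<lambda>w. contra n (V n) x w + fun_scale (- c) w"
  have T: "fun_linear ?T" by (rule fun_linearI) (simp_all add: contra_linear fun_eq_iff algebra_simps)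
  have "?T ` E_image n (p - 1) \<subseteq> E_image n (p - 1)"
    using contra_E_image[OF c] subspace_E_image by (auto intro!: funs.subspace_add funs.subspace_diff funs.subspace_scale)
  then have act: "coinv_act n (p - 1) x C = ?T w +o E_image n (p - 1)"
    unfolding act unfolding w(2)
    by (rule quot_map_coset[OF T subspace_E_image subspace_E_image])
  let ?z = "extend n u + tensor_E_star n w"
  note z = coords_sum[OF u w(1)]
  have u': "contra n (V n) x u \<in> Lam n p" using u by (rule cochain_contra[OF _ subspace_V normalizes_V])
  have w': "?T w \<in> Lam n (p - 1)"
    using w(1) cochain_contra[OF w(1) subspace_V normalizes_V] by (simp only: cochain_add_form cochain_scale_form)
  note z' = coords_sum[OF u' w'] and cz = coords_contra[OF z(1) c]
  have "extend n (contra n (V n) x u) + tensor_E_star n (?T w) = contra n (filiform n) x ?z"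
  proof (rule fil.form_eqI[OF z'(1) cz(1)])
    show "restrict_form (V n) (extend n (contra n (V n) x u) + tensor_E_star n (?T w))
        = restrict_form (V n) (contra n (filiform n) x ?z)"
      unfolding z'(2) cz(2) z(2) ..
    show "fil.head n (extend n (contra n (V n) x u) + tensor_E_star n (?T w))
        = fil.head n (contra n (filiform n) x ?z)"
      unfolding z'(3) cz(3) z(3) unfolding contra_linear by (simp add: fun_eq_iff algebra_simps)
  qed
  then have "decomp n p (contra n (V n) x u, coinv_act n (p - 1) x C) = contra n (filiform n) x ?z +o Bfil n p"
    unfolding act decomp_coset by simp
  also have "\<dots> = quot_map (contra n (filiform n) x) (Bfil n p) (decomp n p (u, C))"
    unfolding w(2) decomp_coset
    by (rule quot_map_coset[OF fun_linear_contra subspace_coboundaries subspace_coboundaries, symmetric])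
      (use contra_Bfil[OF c] in blast)
  finally show ?thesis .
qed

subsection \<open>Representatives of weight classes\<close>

text \<open>
  An eigenvector modulo a stable subspace \<open>N\<close> lifts to an eigenvector.  The subspace \<open>N\<close> will be an image
  (a weight class is represented by a weight vector), the kernel of \<open>d\<close> (an invariant
  coboundary bounds an invariant form), or the forms vanishing at a given list (a form with a nonzero
  value at the list can be replaced by a weight vector).
\<close>

lemma joint_eigenvector:
  fixes M N :: "('x \<Rightarrow> 'k::field) set"
  assumes lin: "fun_linear S" "fun_linear T"
    and M: "funs.subspace M" "\<And>a. a \<in> M \<Longrightarrow> S a \<in> M" "\<And>a. a \<in> M \<Longrightarrow> T a \<in> M"
    and comm: "\<And>a. a \<in> M \<Longrightarrow> S (T a) = T (S a)"
    and diag: "\<And>a. a \<in> M \<Longrightarrow> S (kernel_proj S ss a) = 0" "\<And>a. a \<in> M \<Longrightarrow> T (kernel_proj T ts a) = 0"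
    and N: "funs.subspace N" "\<And>a. a \<in> N \<Longrightarrow> S a \<in> N" "\<And>a. a \<in> N \<Longrightarrow> T a \<in> N"
    and w: "w \<in> M" "S w \<in> N" "T w \<in> N"
  shows "\<exists>v\<in>M. S v = 0 \<and> T v = 0 \<and> w - v \<in> N"
proof
  let ?w = "kernel_proj S ss w" let ?v = "kernel_proj T ts ?w"
  have wM: "?w \<in> M" by (rule kernel_proj_in(1)[OF M(1,2) w(1)])
  show "?v \<in> M" by (rule kernel_proj_in(1)[OF M(1,3) wM])
  have 1: "w - ?w \<in> N" unfolding kernel_proj_eq[OF lin(1)] using kernel_proj_in(2)[OF N(1,2) w(2)] by simp
  have "T ?w = T w - T (w - ?w)" unfolding module_hom.diff[OF lin(2)] by simp
  then have "T ?w \<in> N" using w(3) N(3)[OF 1] funs.subspace_diff[OF N(1)] by metis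
  then have "?w - ?v \<in> N" unfolding kernel_proj_eq[OF lin(2), of ts ?w] using kernel_proj_in(2)[OF N(1,3)] by simp
  then have "(w - ?w) + (?w - ?v) \<in> N" using 1 by (rule funs.subspace_add[OF N(1), rotated])
  then have N': "w - ?v \<in> N" by simp
  have "S ?v = kernel_proj T ts (S ?w)"
    by (rule kernel_proj_commute(1)[OF lin(1) M(1)]; use M(3) comm wM in blast)
  also have "\<dots> = 0"
    unfolding diag(1)[OF w(1)] by (rule module_hom.zero[OF fun_linear_kernel_proj(1)[OF lin(2)]])
  finally show "S ?v = 0 \<and> T ?v = 0 \<and> w - ?v \<in> N" using N' diag(2)[OF wM] by blast
qed

text \<open>
  Each application of \<open>x\<close> lowers the total height \<open>m\<close> of the list of basis vectors on which the form is
  evaluated.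
\<close>

lemma contra_nilpotent:
  fixes b :: "nat \<Rightarrow> 'k::field glV" and m :: "nat \<Rightarrow> nat"
  assumes u: "u \<in> cochains L p" and L: "glV.subspace L" "normalizes n x L" "b ` A \<subseteq> L"
    and step: "\<And>j. j \<in> A \<Longrightarrow> bracket n x (b j) = 0 \<or>
      (\<exists>c. \<exists>i\<in>A. bracket n x (b j) = glV_scale c (b i) \<and> m i < m j)"
  shows "set js \<subseteq> A \<Longrightarrow> sum_list (map m js) < N \<Longrightarrow> (contra n L x ^^ N) u (map b js) = 0"
proof (induction N arbitrary: js)
  case (Suc N)
  let ?v = "(contra n L x ^^ N) u"
  have v: "?v \<in> cochains L p"
    by (induction N) (simp_all add: u cochain_contra L)
  have bL: "set (map b ks) \<subseteq> L" if "set ks \<subseteq> A" for ks using that L(3) by auto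
  have "?v ((map b js)[i := bracket n x (map b js ! i)]) = 0" if i: "i < length js" for i
  proof -
    have "js ! i \<in> A" using Suc.prems(1) nth_mem[OF i] by blast
    from step[OF this] show ?thesis
    proof (elim disjE exE bexE conjE)
      assume "bracket n x (b (js ! i)) = 0"
      then have "0 \<in> set ((map b js)[i := bracket n x (map b js ! i)])"
        using i by (simp add: set_update_memI)
      then show ?thesis by (rule cochain_zero_arg[OF v])
    next
      fix c k assume k: "k \<in> A" "bracket n x (b (js ! i)) = glV_scale c (b k)" "m k < m (js ! i)"
      have "?v ((map b js)[i := bracket n x (map b js ! i)]) = c * ?v ((map b js)[i := b k])"
        using cochain_scale_update[OF v bL[OF Suc.prems(1)], of i "b k" c] i k L(3) by auto
      also have "(map b js)[i := b k] = map b (js[i := k])" by (simp add: map_update)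
      also have "?v (map b (js[i := k])) = 0"
      proof (rule Suc.IH)
        show "set (js[i := k]) \<subseteq> A" using Suc.prems(1) k(1) by (rule set_update_subsetI)
        have "sum_list (map m (js[i := k])) = sum_list (map m js) + m k - m (js ! i)"
          using i by (simp add: map_update sum_list_update)
        then show "sum_list (map m (js[i := k])) < N"
          using k(3) Suc.prems(2) i elem_le_sum_list[of i "map m js"] by simp
      qed
      finally show ?thesis by simp
    qed
  qed
  then have "contra n L x ?v (map b js) = 0"
    unfolding contra_def[where \<omega> = ?v] by (simp add: sum.neutral)
  then show ?case by simp
qed simp

lemma Lam_E_F_nilpotent:
  fixes u :: "'k::field_char_0 form"
  assumes u: "u \<in> Lam n q"
  shows "\<exists>k. (contra n (V n) E_el ^^ k) u = 0" "\<exists>k. (contra n (V n) F_el ^^ k) u = 0"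
proof -
  let ?N = "nat q * n + 1"
  have pow: "(contra n (V n) x ^^ k) u \<in> Lam n q" for x k
    by (induction k) (simp_all add: u cochain_contra subspace_V normalizes_V)
  have eV: "basis_vec ` {..n} \<subseteq> V n" unfolding V_span by (rule glV.span_superset)
  have main: "(contra n (V n) x ^^ ?N) u = 0"
    if step: "\<And>j. j \<in> {..n} \<Longrightarrow> bracket n x (basis_vec j) = 0 \<or>
      (\<exists>c. \<exists>i\<in>{..n}. bracket n x (basis_vec j) = glV_scale c (basis_vec i) \<and> m i < m j)"
      and m: "\<And>j. j \<le> n \<Longrightarrow> m j \<le> n" for x and m :: "nat \<Rightarrow> nat"
  proof (rule cochain_eqI_span[where S = "basis_vec ` {..n}" and p = q])
    show "(contra n (V n) x ^^ ?N) u \<in> cochains (glV.span (basis_vec ` {..n})) q"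
      using pow[of ?N x] unfolding V_span .
    fix xs :: "'k glV list" assume "set xs \<subseteq> basis_vec ` {..n}"
    then have "xs \<in> lists (basis_vec ` {..n})" by auto
    then obtain js where js: "xs = map basis_vec js" "set js \<subseteq> {..n}" by (auto simp: lists_image)
    show "(contra n (V n) x ^^ ?N) u xs = 0 xs"
    proof (cases "int (length js) = q")
      case True
      have "sum_list (map m js) \<le> sum_list (map (\<lambda>_. n) js)"
        using js(2) m by (intro sum_list_mono) auto
      then have "sum_list (map m js) < ?N" using True by (auto simp: sum_list_triv)
      then show ?thesis
        unfolding js(1) zero_fun_apply
        by (intro contra_nilpotent[OF u subspace_V normalizes_V eV, where m = m] step js(2))
    next
      case False
      then show ?thesis using cochain_outside[OF pow, of xs ?N x] js(1) by simp
    qed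
  qed simp
  have "bracket n E_el (basis_vec j) = (0 :: 'k glV) \<or>
      (\<exists>c. \<exists>i\<in>{..n}. bracket n E_el (basis_vec j) = glV_scale c (basis_vec i :: 'k glV) \<and> i < j)" if "j \<in> {..n}" for j
  proof (cases j)
    case (Suc i)
    then have "bracket n E_el (basis_vec j) = glV_scale 1 (basis_vec i :: 'k glV)" by (simp add: bracket_basis_vec)
    then show ?thesis using Suc that by (intro disjI2 exI[of _ 1] bexI[of _ i]) auto
  qed (simp add: bracket_basis_vec)
  from main[of E_el "\<lambda>j. j", OF this] show "\<exists>k. (contra n (V n) E_el ^^ k) u = 0" by blast
  have "bracket n F_el (basis_vec j) = (0 :: 'k glV) \<or>
      (\<exists>c. \<exists>i\<in>{..n}. bracket n F_el (basis_vec j) = glV_scale c (basis_vec i :: 'k glV) \<and> n - i < n - j)"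
    if "j \<in> {..n}" for j
  proof (cases "j = n")
    case False
    then have "Suc j \<in> {..n}" "n - Suc j < n - j" using that by auto
    then show ?thesis using bracket_basis_vec(3) by blast
  qed (simp add: bracket_basis_vec)
  from main[of F_el "\<lambda>j. n - j", OF this] show "\<exists>k. (contra n (V n) F_el ^^ k) u = 0" by (metis diff_le_self)
qed

definition weight_space :: "nat \<Rightarrow> int \<Rightarrow> 'k::field \<times> 'k \<Rightarrow> 'k form set" where
  "weight_space n q \<mu> = {u \<in> Lam n q.
     contra n (V n) H_el u = fun_scale (fst \<mu>) u \<and> contra n (V n) I_el u = fun_scale (snd \<mu>) u}"

lemma subspace_weight_space: "funs.subspace (weight_space n q \<mu>)"
proof (rule funs.subspaceI)
  show "0 \<in> weight_space n q \<mu>" by (simp add: weight_space_def contra_linear)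
  show "x + y \<in> weight_space n q \<mu>" if "x \<in> weight_space n q \<mu>" "y \<in> weight_space n q \<mu>" for x y
    using that by (simp add: weight_space_def contra_linear cochain_add_form funs.scale_right_distrib)
  show "fun_scale c x \<in> weight_space n q \<mu>" if "x \<in> weight_space n q \<mu>" for c x
    using that by (simp add: weight_space_def contra_linear cochain_scale_form mult.commute)
qed

lemma contra_weight_space:
  fixes x :: "'k::field_char_0 glV"
  assumes u: "u \<in> weight_space n q (\<nu>, m)"
    and "bracket n H_el x = glV_scale c x" "bracket n I_el x = 0"
  shows "contra n (V n) x u \<in> weight_space n q (\<nu> + c, m)"
proof -
  have uL: "u \<in> Lam n q" and wt: "contra n (V n) H_el u = fun_scale \<nu> u" "contra n (V n) I_el u = fun_scale m u"
    using u by (auto simp: weight_space_def)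
  note eig = contra_eigen[OF uL subspace_V normalizes_V normalizes_V]
  have "contra n (V n) H_el (contra n (V n) x u) = fun_scale (\<nu> + c) (contra n (V n) x u)"
    unfolding eig[OF assms(2)] wt contra_linear(3) by (simp only: funs.scale_left_distrib)
  moreover have "bracket n I_el x = glV_scale 0 x" using assms(3) by simp
  then have "contra n (V n) I_el (contra n (V n) x u) = fun_scale m (contra n (V n) x u)"
    unfolding eig[OF \<open>bracket n I_el x = glV_scale 0 x\<close>] wt contra_linear(3) by simp
  ultimately show ?thesis
    using cochain_contra[OF uL subspace_V normalizes_V] by (simp add: weight_space_def)
qed

lemma sl2_rep_Lam:
  fixes m :: "'k::field_char_0"
  shows "sl2_rep (contra n (V n) E_el) (contra n (V n) F_el) (\<lambda>\<nu>. weight_space n q (\<nu>, m))"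
proof (intro sl2_rep.intro)
  fix \<nu> :: 'k and u :: "'k form"
  show "funs.subspace (weight_space n q (\<nu>, m))" by (rule subspace_weight_space)
  assume u: "u \<in> weight_space n q (\<nu>, m)"
  then have uL: "u \<in> Lam n q" and wt: "contra n (V n) H_el u = fun_scale \<nu> u" by (auto simp: weight_space_def)
  show "contra n (V n) E_el u \<in> weight_space n q (\<nu> + 2, m)"
    by (rule contra_weight_space[OF u bracket_generators(2,4)])
  show "contra n (V n) F_el u \<in> weight_space n q (\<nu> - 2, m)"
    using contra_weight_space[OF u bracket_generators(3,5)] by simp
  show "contra n (V n) E_el (contra n (V n) F_el u) - contra n (V n) F_el (contra n (V n) E_el u) = fun_scale \<nu> u"
    unfolding contra_commutator[OF uL subspace_V normalizes_V normalizes_V] bracket_generators by (rule wt)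
  show "\<exists>k. (contra n (V n) E_el ^^ k) u = 0" "\<exists>k. (contra n (V n) F_el ^^ k) u = 0"
    by (rule Lam_E_F_nilpotent[OF uL])+
qed (rule fun_linear_contra)+

lemma joint_weight_vector:
  fixes N :: "('k::field_char_0 form) set"
  assumes N: "funs.subspace N"
    "\<And>a. a \<in> N \<Longrightarrow> contra n (V n) H_el a - fun_scale \<nu> a \<in> N"
    "\<And>a. a \<in> N \<Longrightarrow> contra n (V n) I_el a - fun_scale m a \<in> N"
    and w: "w \<in> Lam n q" "contra n (V n) H_el w - fun_scale \<nu> w \<in> N" "contra n (V n) I_el w - fun_scale m w \<in> N"
  shows "\<exists>v\<in>weight_space n q (\<nu>, m). w - v \<in> N"
proof -
  define S T :: "('k form) \<Rightarrow> ('k form)"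
    where "S = lie_der n (V n) (\<lambda>_. - \<nu>) H_el" and "T = lie_der n (V n) (\<lambda>_. - m) I_el"
  have ST: "S a = contra n (V n) H_el a - fun_scale \<nu> a" "T a = contra n (V n) I_el a - fun_scale m a" for a
    by (simp_all add: S_def T_def lie_der_def)
  have eig: "\<exists>c. bracket n H_el s = glV_scale c (s :: 'k glV)" "\<exists>c. bracket n I_el s = glV_scale c (s :: 'k glV)"
    if "s \<in> basis_vec ` {..n}" for s
    using filiform_eigenbasis[of s n] that by simp_all
  have "\<exists>ss. \<forall>r\<le>q. \<forall>a\<in>Lam n r. S (kernel_proj S ss a) = 0" "\<exists>ts. \<forall>r\<le>q. \<forall>a\<in>Lam n r. T (kernel_proj T ts a) = 0"
    unfolding S_def T_def
    by (rule lie_der_diagonal[OF V_span _ eig(1)], simp_all) (rule lie_der_diagonal[OF V_span _ eig(2)], simp_all)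
  then obtain ss ts where ss: "\<And>a. a \<in> Lam n q \<Longrightarrow> S (kernel_proj S ss a) = 0"
    and ts: "\<And>a. a \<in> Lam n q \<Longrightarrow> T (kernel_proj T ts a) = 0"
    by (metis order_refl)
  have "\<exists>v\<in>Lam n q. S v = 0 \<and> T v = 0 \<and> w - v \<in> N"
  proof (rule joint_eigenvector[where ss = ss and ts = ts])
    show "fun_linear S" "fun_linear T" unfolding S_def T_def by (rule fun_linear_lie_der)+
    show "S a \<in> Lam n q" "T a \<in> Lam n q" if "a \<in> Lam n q" for a
      unfolding S_def T_def using that cochain_lie_der[OF _ subspace_V normalizes_V] by blast+
    show "S (T a) = T (S a)" if a: "a \<in> Lam n q" for a
    proof -
      have "contra n (V n) H_el (contra n (V n) I_el a) = contra n (V n) I_el (contra n (V n) H_el a)"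
        using contra_commutator[OF a subspace_V normalizes_V normalizes_V, of H_el I_el]
        by (simp add: bracket_generators contra_zero_left[OF a subspace_V])
      then show ?thesis unfolding ST contra_linear by (simp add: fun_eq_iff algebra_simps)
    qed
    show "S (kernel_proj S ss a) = 0" "T (kernel_proj T ts a) = 0" if "a \<in> Lam n q" for a
      using ss ts that by blast+
    show "S a \<in> N" "T a \<in> N" if "a \<in> N" for a
      unfolding ST using N(2,3)[OF that] by blast+
  qed (use w N(1) in \<open>simp_all only: ST subspace_cochains\<close>)
  then show ?thesis by (auto simp: weight_space_def ST)
qed

lemma lowest_weight_representative:
  fixes w :: "'k::field_char_0 form"
  assumes w: "w \<in> Lam n q"
    and H: "contra n (V n) H_el w - fun_scale \<nu> w \<in> E_image n q"
    and I: "contra n (V n) I_el w - fun_scale m w \<in> E_image n q"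
  shows "\<exists>b\<in>weight_space n q (\<nu>, m). contra n (V n) F_el b = 0 \<and> w - b \<in> E_image n q"
proof -
  have "bracket n I_el E_el = glV_scale 0 (E_el :: 'k glV)" by (simp add: bracket_generators)
  note stable = contra_E_image[OF bracket_generators(2)] contra_E_image[OF this]
  have "\<exists>v\<in>weight_space n q (\<nu>, m). w - v \<in> E_image n q"
    using stable by (intro joint_weight_vector[OF subspace_E_image _ _ w H I])
      (blast intro: funs.subspace_diff[OF subspace_E_image] funs.subspace_scale[OF subspace_E_image])+
  then obtain v where v: "v \<in> weight_space n q (\<nu>, m)" "w - v \<in> E_image n q" by blast
  interpret sl2_rep "contra n (V n) E_el" "contra n (V n) F_el" "\<lambda>\<nu>. weight_space n q (\<nu>, m)"
    by (rule sl2_rep_Lam)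
  obtain a b where ab: "a \<in> weight_space n q (\<nu> - 2, m)" "b \<in> weight_space n q (\<nu>, m)"
      "contra n (V n) F_el b = 0" "v = contra n (V n) E_el a + b"
    using image_plus_lowest[OF v(1)] by blast
  have "contra n (V n) E_el a \<in> E_image n q" using ab(1) by (auto simp: weight_space_def E_image_def)
  then have "(w - v) + contra n (V n) E_el a \<in> E_image n q"
    by (rule funs.subspace_add[OF subspace_E_image v(2)])
  then have "w - b \<in> E_image n q" using ab(4) by simp
  then show ?thesis using ab(2,3) by blast
qed

subsection \<open>Isotypic components\<close>

lemma isotypic_iff:
  fixes z :: "'k::field_char_0 form"
  shows "z +o Bfil n p \<in> isotypic n p \<mu> \<longleftrightarrow> z +o Bfil n p \<in> Hfil n p
    \<and> contra n (filiform n) H_el z - fun_scale (fst \<mu>) z \<in> Bfil n p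
    \<and> contra n (filiform n) I_el z - fun_scale (snd \<mu>) z \<in> Bfil n p"
proof -
  have B: "contra n (filiform n) H_el ` Bfil n p \<subseteq> (Bfil n p :: 'k form set)"
    "contra n (filiform n) I_el ` Bfil n p \<subseteq> (Bfil n p :: 'k form set)"
    using contra_Bfil[OF bracket_generators(2)] contra_Bfil[of n I_el 0] by (auto simp: bracket_generators)
  have S: "fun_scale c ` Bfil n p \<subseteq> (Bfil n p :: 'k form set)" for c
    using funs.subspace_scale[OF subspace_coboundaries] by blast
  show ?thesis
    unfolding isotypic_def mem_Collect_eq
      quot_map_coset[OF fun_linear_contra subspace_coboundaries subspace_coboundaries B(1)]
      quot_map_coset[OF fun_linear_contra subspace_coboundaries subspace_coboundaries B(2)]
      quot_map_coset[OF fun_linear_scale subspace_coboundaries subspace_coboundaries S]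
      coset_eq_iff[OF subspace_coboundaries] ..
qed

lemma Hfil_coset_iff: "z +o Bfil n p \<in> Hfil n p \<longleftrightarrow> z \<in> cocycles n (filiform n) 0 p"
  for z :: "'k::field_char_0 form"
proof
  assume "z +o Bfil n p \<in> Hfil n p"
  then obtain z' where z': "z' \<in> cocycles n (filiform n) 0 p" "z +o Bfil n p = z' +o Bfil n p"
    by (auto simp: cohomology_def quot_def)
  have b: "z - z' \<in> Bfil n p" using z'(2) unfolding coset_eq_iff[OF subspace_coboundaries] .
  then have "z - z' \<in> cochains (filiform n) p" "restrict_form (V n) (z - z') = 0"
    by (simp_all only: coboundaries_filiform)
  then have "(z - z') + z' \<in> cochains (filiform n) p" "restrict_form (V n) z = restrict_form (V n) z'"
    using z'(1) cochain_add_form[of "z - z'" _ p z']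
    by (simp_all only: cocycles_filiform restrict_form_linear right_minus_eq)
  then show "z \<in> cocycles n (filiform n) 0 p" using z'(1) by (simp add: cocycles_filiform)
qed (simp add: cohomology_def quot_def)

text \<open>
  The summand \<open>2\<close> occurs because \<open>H\<close> acts on \<open>E\<^sup>*\<close> by \<open>-2\<close>.
\<close>

lemma isotypic_coords:
  fixes u w :: "'k::field_char_0 form"
  assumes u: "u \<in> Lam n p" and w: "w \<in> Lam n (p - 1)"
  defines "z \<equiv> extend n u + tensor_E_star n w"
  shows "z +o Bfil n p \<in> isotypic n p \<mu> \<longleftrightarrow>
    contra n (V n) E_el u = 0 \<and> u \<in> weight_space n p \<mu>
    \<and> contra n (V n) H_el w - fun_scale (fst \<mu> + 2) w \<in> E_image n (p - 1)
    \<and> contra n (V n) I_el w - fun_scale (snd \<mu>) w \<in> E_image n (p - 1)"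
proof -
  have zc: "z \<in> cochains (filiform n) p" "restrict_form (V n) z = u"
    "fil.head n z = fun_scale ((- 1) ^ nat (p - 1)) w"
    unfolding z_def by (rule coords_sum[OF u w])+
  have eq: "contra n (filiform n) x z - fun_scale d z \<in> Bfil n p \<longleftrightarrow>
      contra n (V n) x u = fun_scale d u \<and> contra n (V n) x w - fun_scale (d + c) w \<in> E_image n (p - 1)"
    if c: "bracket n x E_el = glV_scale c E_el" for x :: "'k glV" and c d
  proof -
    let ?u = "contra n (V n) x u - fun_scale d u" and ?w = "contra n (V n) x w - fun_scale (d + c) w"
    have u': "?u \<in> Lam n p" and w': "?w \<in> Lam n (p - 1)"
      using u w by (simp_all add: cochain_diff_form cochain_scale_form cochain_contra subspace_V normalizes_V)
    note cz = coords_contra[OF zc(1) c] and s = coords_sum[OF u' w']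
    have "contra n (filiform n) x z - fun_scale d z = extend n ?u + tensor_E_star n ?w"
    proof (rule fil.form_eqI[OF _ s(1)])
      show "contra n (filiform n) x z - fun_scale d z \<in> cochains (filiform n) p"
        using cz(1) zc(1) by (simp add: cochain_diff_form cochain_scale_form)
      show "restrict_form (V n) (contra n (filiform n) x z - fun_scale d z)
          = restrict_form (V n) (extend n ?u + tensor_E_star n ?w)"
        unfolding s(2) unfolding restrict_form_linear cz(2) zc(2) ..
      show "fil.head n (contra n (filiform n) x z - fun_scale d z) = fil.head n (extend n ?u + tensor_E_star n ?w)"
        unfolding s(3) unfolding fil.head_linear cz(3) zc(3) unfolding contra_linear
        by (simp add: fun_eq_iff algebra_simps)
    qed
    then show ?thesis using sum_in_coboundaries_iff[OF u' w'] by simp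
  qed
  have "bracket n I_el E_el = glV_scale 0 (E_el :: 'k glV)" by (simp add: bracket_generators)
  from eq[OF bracket_generators(2), of "fst \<mu>"] eq[OF this, of "snd \<mu>"] show ?thesis
    unfolding isotypic_iff Hfil_coset_iff cocycles_filiform zc(2) using zc(1) u by (auto simp: weight_space_def)
qed

lemma isotypic_generated:
  fixes \<mu> :: "'k::field_char_0 \<times> 'k"
  shows "isotypic n p \<mu> = quot_span (Bfil n p)
    ((\<lambda>u. extend n u +o Bfil n p) ` highest_weight_vectors n p \<mu> \<union>
     (\<lambda>w. tensor_E_star n w +o Bfil n p) ` lowest_weight_vectors n (p - 1) (\<mu> + (2, 0)))"
    (is "_ = quot_span _ ?S")
proof
  have wt: "weight_vectors n q \<mu> = weight_space n q \<mu> - {0}" for q and \<mu> :: "'k \<times> 'k"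
    by (auto simp: weight_vectors_def weight_space_def)
  let ?N = "{z. z +o Bfil n p \<in> isotypic n p \<mu>}"
  have N: "funs.subspace ?N"
  proof (rule funs.subspaceI)
    show "0 \<in> ?N"
      by (simp add: isotypic_iff Hfil_coset_iff cocycles_def CE_d_linear contra_linear funs.subspace_0[OF subspace_coboundaries])
    show "x + y \<in> ?N" if "x \<in> ?N" "y \<in> ?N" for x y
    proof -
      have "contra n (filiform n) t (x + y) - fun_scale c (x + y)
          = (contra n (filiform n) t x - fun_scale c x) + (contra n (filiform n) t y - fun_scale c y)" for t c
        unfolding contra_linear funs.scale_right_distrib by simp
      then show ?thesis using that
        by (simp add: isotypic_iff Hfil_coset_iff cocycles_def CE_d_linear cochain_add_form
            funs.subspace_add[OF subspace_coboundaries])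
    qed
    show "fun_scale a x \<in> ?N" if "x \<in> ?N" for a x
    proof -
      have "contra n (filiform n) t (fun_scale a x) - fun_scale c (fun_scale a x)
          = fun_scale a (contra n (filiform n) t x - fun_scale c x)" for t c
        unfolding contra_linear by (simp add: fun_eq_iff algebra_simps)
      then show ?thesis using that
        by (simp add: isotypic_iff Hfil_coset_iff cocycles_def CE_d_linear cochain_scale_form
            funs.subspace_scale[OF subspace_coboundaries] del: funs.scale_scale)
    qed
  qed
  show "quot_span (Bfil n p) ?S \<subseteq> isotypic n p \<mu>"
  proof
    have hw: "z \<in> ?N" if "u \<in> highest_weight_vectors n p \<mu>" "z \<in> extend n u +o Bfil n p" for u z
    proof -
      have u: "u \<in> weight_space n p \<mu>" "contra n (V n) E_el u = 0"
        using that(1) by (auto simp: highest_weight_vectors_def wt)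
      have "z +o Bfil n p = extend n u +o Bfil n p"
        using that(2) unfolding coset_eq_iff[OF subspace_coboundaries] by (auto simp: elt_set_plus_def)
      moreover have "u \<in> Lam n p" using u by (simp add: weight_space_def)
      then have "(extend n u + tensor_E_star n 0) +o Bfil n p \<in> isotypic n p \<mu>"
        using u isotypic_coords[of u n p 0 \<mu>] by (simp add: contra_linear funs.subspace_0[OF subspace_E_image])
      ultimately show ?thesis by (simp add: module_hom.zero[OF fun_linear_tensor])
    qed
    have lw: "z \<in> ?N" if "w \<in> lowest_weight_vectors n (p - 1) (\<mu> + (2, 0))" "z \<in> tensor_E_star n w +o Bfil n p" for w z
    proof -
      have w: "w \<in> weight_space n (p - 1) (\<mu> + (2, 0))"
        using that(1) by (auto simp: lowest_weight_vectors_def wt)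
      have "z +o Bfil n p = tensor_E_star n w +o Bfil n p"
        using that(2) unfolding coset_eq_iff[OF subspace_coboundaries] by (auto simp: elt_set_plus_def)
      moreover have "(extend n 0 + tensor_E_star n w) +o Bfil n p \<in> isotypic n p \<mu>"
        using w isotypic_coords[of 0 n p w \<mu>] funs.subspace_0[OF subspace_E_image]
          funs.subspace_0[OF subspace_weight_space]
        by (simp add: contra_linear weight_space_def)
      ultimately show ?thesis by (simp add: module_hom.zero[OF fun_linear_extend])
    qed
    have "\<Union> ?S \<subseteq> ?N" using hw lw by blast
    then have "funs.span (\<Union> ?S) \<subseteq> ?N" using N by (rule funs.span_minimal)
    then show "C \<in> isotypic n p \<mu>" if "C \<in> quot_span (Bfil n p) ?S" for C
      using that by (auto simp: quot_span_def quot_def)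
  qed
  show "isotypic n p \<mu> \<subseteq> quot_span (Bfil n p) ?S"
  proof
    fix C assume C: "C \<in> isotypic n p \<mu>"
    then obtain z where z: "C = z +o Bfil n p" "z \<in> cochains (filiform n) p"
      by (auto simp: isotypic_def cohomology_def quot_def cocycles_def)
    define u w where "u = restrict_form (V n) z" and "w = fun_scale ((- 1) ^ nat (p - 1)) (fil.head n z)"
    have uw: "u \<in> Lam n p" "w \<in> Lam n (p - 1)"
      unfolding u_def w_def using fil.coords_cochain[OF z(2)] cochain_scale_form by blast+
    have zuw: "z = extend n u + tensor_E_star n w"
      unfolding u_def w_def by (rule form_split[OF z(2)])
    have "(extend n u + tensor_E_star n w) +o Bfil n p \<in> isotypic n p \<mu>"
      using C unfolding z(1) zuw .
    then have iso: "contra n (V n) E_el u = 0" "u \<in> weight_space n p \<mu>"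
      "contra n (V n) H_el w - fun_scale (fst \<mu> + 2) w \<in> E_image n (p - 1)"
      "contra n (V n) I_el w - fun_scale (snd \<mu>) w \<in> E_image n (p - 1)"
      using isotypic_coords[OF uw] by auto
    obtain b where b: "b \<in> weight_space n (p - 1) (fst \<mu> + 2, snd \<mu>)" "contra n (V n) F_el b = 0"
        "w - b \<in> E_image n (p - 1)"
      using lowest_weight_representative[OF uw(2) iso(3,4)] by blast
    have zero: "y \<in> y +o Bfil n p" for y :: "'k form"
      using funs.subspace_0[OF subspace_coboundaries] by (auto simp: elt_set_plus_def intro!: bexI[of _ 0])
    have "extend n u \<in> funs.span (\<Union> ?S)"
    proof (cases "u = 0")
      case True
      show ?thesis unfolding True module_hom.zero[OF fun_linear_extend] by (rule funs.span_zero)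
    next
      case False
      then have "u \<in> highest_weight_vectors n p \<mu>" using iso(1,2) by (simp add: highest_weight_vectors_def wt)
      then show ?thesis using zero by (intro funs.span_base) blast
    qed
    moreover have "tensor_E_star n b \<in> funs.span (\<Union> ?S)"
    proof (cases "b = 0")
      case True
      show ?thesis unfolding True module_hom.zero[OF fun_linear_tensor] by (rule funs.span_zero)
    next
      case False
      have "(fst \<mu> + 2, snd \<mu>) = \<mu> + (2, 0)" by (simp add: prod_eq_iff)
      then have "b \<in> lowest_weight_vectors n (p - 1) (\<mu> + (2, 0))"
        using b(1,2) False by (simp only: lowest_weight_vectors_def wt) simp
      then show ?thesis using zero by (intro funs.span_base) blast
    qed
    ultimately have mem: "extend n u + tensor_E_star n b \<in> funs.span (\<Union> ?S)" by (rule funs.span_add)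
    have eq: "C = (extend n u + tensor_E_star n b) +o Bfil n p"
    proof -
      have "(extend n u + tensor_E_star n w) - (extend n u + tensor_E_star n b) = tensor_E_star n (w - b)"
        unfolding module_hom.diff[OF fun_linear_tensor] by simp
      also have "\<dots> \<in> Bfil n p" using b(3) tensor_E_image by blast
      finally show ?thesis unfolding z(1) zuw coset_eq_iff[OF subspace_coboundaries] .
    qed
    show "C \<in> quot_span (Bfil n p) ?S"
      unfolding quot_span_def quot_def by (rule image_eqI[where f = "\<lambda>z. z +o Bfil n p", OF eq mem])
  qed
qed

section \<open>The solvable algebra\<close>

lemma kernel_subspace:
  assumes "fun_linear T" "funs.subspace M"
  shows "funs.subspace {a \<in> M. T a = 0}"
proof (rule funs.subspaceI)
  show "0 \<in> {a \<in> M. T a = 0}" using assms by (simp add: module_hom.zero[OF assms(1)] funs.subspace_0)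
  show "x + y \<in> {a \<in> M. T a = 0}" if "x \<in> {a \<in> M. T a = 0}" "y \<in> {a \<in> M. T a = 0}" for x y
    using that by (simp add: module_hom.add[OF assms(1)] funs.subspace_add[OF assms(2)])
  show "fun_scale c x \<in> {a \<in> M. T a = 0}" if "x \<in> {a \<in> M. T a = 0}" for c x
    using that by (simp add: module_hom.scale[OF assms(1)] funs.subspace_scale[OF assms(2)])
qed

lemma cohom_weights_coset:
  fixes \<mu> :: "'k::field_char_0 \<times> 'k"
  shows "\<mu> \<in> cohom_weights n p \<longleftrightarrow> (\<exists>z. z +o Bfil n p \<in> isotypic n p \<mu> \<and> z \<notin> Bfil n p)"
proof -
  have coset: "z +o Bfil n p = Bfil n p \<longleftrightarrow> z \<in> Bfil n p" for z :: "'k form"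
    using coset_eq_iff[OF subspace_coboundaries, of z n "filiform n" 0 p 0] by simp
  show ?thesis
  proof
    assume "\<mu> \<in> cohom_weights n p"
    then obtain C where C: "C \<in> isotypic n p \<mu>" "C \<noteq> Bfil n p" unfolding cohom_weights_def by blast
    then obtain z where z: "C = z +o Bfil n p" by (auto simp: isotypic_def cohomology_def quot_def)
    show "\<exists>z. z +o Bfil n p \<in> isotypic n p \<mu> \<and> z \<notin> Bfil n p"
      using C unfolding z coset by (intro exI conjI)
  next
    assume "\<exists>z. z +o Bfil n p \<in> isotypic n p \<mu> \<and> z \<notin> Bfil n p"
    then obtain z where z: "z +o Bfil n p \<in> isotypic n p \<mu>" "z \<notin> Bfil n p" by blast
    then have "z +o Bfil n p \<noteq> Bfil n p" unfolding coset by simp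
    then show "\<mu> \<in> cohom_weights n p" using z(1) unfolding cohom_weights_def by (intro CollectI bexI)
  qed
qed

lemma bracket_I_filiform: "normalizes n I_el (filiform n :: 'k::field_char_0 glV set)"
  by (rule normalizes_filiform[of _ _ 0]) (simp add: bracket_generators)

lemma filiform_I_eigenbasis:
  assumes "s \<in> insert I_el (insert E_el (basis_vec ` {..n}))"
  shows "\<exists>c. bracket n H_el s = glV_scale c (s :: 'k::field_char_0 glV)"
proof (cases "s = I_el")
  case True
  then have "bracket n H_el s = glV_scale 0 s" by (simp add: bracket_generators)
  then show ?thesis by blast
qed (use assms filiform_eigenbasis(1) in blast)

lemma normalizes_H: "normalizes n H_el (filiform_I n :: 'k::field_char_0 glV set)"
  unfolding filiform_I_span
proof (rule normalizes_span)
  fix s :: "'k glV" assume s: "s \<in> insert I_el (insert E_el (basis_vec ` {..n}))"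
  obtain c where "bracket n H_el s = glV_scale c s" using filiform_I_eigenbasis[OF s] by blast
  then show "bracket n H_el s \<in> glV.span (insert I_el (insert E_el (basis_vec ` {..n})))"
    using glV.span_scale[OF glV.span_base[OF s]] by metis
qed

text \<open>
  The form complex of \<open>\<ss>\<^sub>n\<close> with coefficients in \<open>l\<close>, as an iterated mapping cone of \<open>I\<close> and \<open>H\<close> over that
  of \<open>\<ff>\<^sub>n\<close>.
\<close>

locale solv_character =
  fixes n :: nat and l :: "'k::field_char_0 glV \<Rightarrow> 'k"
  assumes l: "l \<in> characters n (solv n)"
begin

lemma l_linear:
  "\<And>x y. x \<in> solv n \<Longrightarrow> y \<in> solv n \<Longrightarrow> l (x + y) = l x + l y"
  "\<And>c x. x \<in> solv n \<Longrightarrow> l (glV_scale c x) = c * l x"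
  "\<And>x y. x \<in> solv n \<Longrightarrow> y \<in> solv n \<Longrightarrow> l (bracket n x y) = 0"
  using l unfolding characters_def by blast+

lemma subsets: "V n \<subseteq> (filiform n :: 'k glV set)" "filiform n \<subseteq> (filiform_I n :: 'k glV set)"
  "filiform_I n \<subseteq> (solv n :: 'k glV set)"
  unfolding solv_span filiform_I_def using fil.sub(2) glV.span_superset by fastforce+

lemma elements: "E_el \<in> (solv n :: 'k glV set)" "H_el \<in> (solv n :: 'k glV set)" "I_el \<in> (solv n :: 'k glV set)"
  unfolding solv_def by (simp_all add: glV.span_base)

text \<open>
  Both \<open>2E = [H, E]\<close> and \<open>v = [I, v]\<close> are brackets, hence killed by a character.
\<close>

lemma l_filiform:
  assumes "y \<in> filiform n"
  shows "l y = 0"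
proof -
  have "l (glV_scale 2 E_el) = 0"
    using l_linear(3)[OF elements(2,1)] by (simp add: bracket_generators)
  then have E: "l E_el = 0" using l_linear(2)[OF elements(1), of 2] by simp
  let ?v = "y - glV_scale (xi_E y) E_el"
  have v: "?v \<in> V n" by (rule fil.complement[OF assms])
  then have vs: "?v \<in> solv n" using subsets by blast
  obtain v where "?v = (0, v)" using v by (auto simp: V_def)
  then have "bracket n I_el ?v = ?v" by (simp only: bracket_I_V)
  then have lv: "l ?v = 0" using l_linear(3)[OF elements(3) vs] by simp
  have "glV_scale (xi_E y) E_el \<in> (solv n :: 'k glV set)"
    using elements(1) unfolding solv_def by (rule glV.span_scale)
  then have "l (?v + glV_scale (xi_E y) E_el) = 0"
    unfolding l_linear(1)[OF vs \<open>glV_scale (xi_E y) E_el \<in> solv n\<close>] using lv E l_linear(2)[OF elements(1)] by simp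
  then show ?thesis by simp
qed

sublocale eI: extension n "filiform_I n" l "filiform n" I_el xi_I
proof (rule extensionI[OF fil.subspace fil.closed bracket_I_filiform filiform_I_def])
  show "l (y + z) = l y + l z" if "y \<in> filiform_I n" "z \<in> filiform_I n" for y z
    using that subsets(3) by (intro l_linear(1)) auto
  show "l (glV_scale c y) = c * l y" if "y \<in> filiform_I n" for c y
    using that subsets(3) by (intro l_linear(2)) auto
  show "l (bracket n y z) = 0" if "y \<in> filiform_I n" "z \<in> filiform_I n" for y z
    using that subsets(3) by (intro l_linear(3)) auto
qed (simp_all add: xi_linear xi_values xi_filiform)

sublocale eH: extension n "solv n" l "filiform_I n" H_el xi_H
  by (rule extensionI[OF eI.subspace eI.closed normalizes_H solv_span])
    (simp_all add: xi_linear xi_values xi_filiform_I l_linear)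

lemma CE_d_filiform: "CE_d n (filiform n) l = CE_d n (filiform n) 0"
proof (intro ext)
  fix \<omega> xs
  have "l (xs ! i) = 0" if "set xs \<subseteq> filiform n" "i < length xs" for i
    using l_filiform that nth_mem by blast
  then show "CE_d n (filiform n) l \<omega> xs = CE_d n (filiform n) 0 \<omega> xs" by (simp add: CE_d_def)
qed

abbreviation "\<theta>H \<equiv> lie_der n (filiform n) l H_el"
abbreviation "\<theta>I \<equiv> lie_der n (filiform n) l I_el"
abbreviation "d \<equiv> CE_d n (filiform n) l"

definition invariants :: "int \<Rightarrow> 'k form set" where
  "invariants q = {a \<in> cochains (filiform n) q. \<theta>H a = 0 \<and> \<theta>I a = 0}"

lemma torus_operators:
  assumes a: "a \<in> cochains (filiform n) q"
  shows "\<theta>H a \<in> cochains (filiform n) q" "\<theta>I a \<in> cochains (filiform n) q"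
    "\<theta>H (\<theta>I a) = \<theta>I (\<theta>H a)" "d (\<theta>H a) = \<theta>H (d a)" "d (\<theta>I a) = \<theta>I (d a)"
proof -
  have nH: "normalizes n H_el (filiform n :: 'k glV set)"
    by (rule normalizes_filiform[OF bracket_generators(2)])
  have nI: "normalizes n I_el (filiform n :: 'k glV set)" by (rule bracket_I_filiform)
  show "\<theta>H a \<in> cochains (filiform n) q" "\<theta>I a \<in> cochains (filiform n) q"
    using cochain_lie_der[OF a fil.subspace] nH nI by blast+
  have l0: "l (bracket n H_el I_el) = 0" using l_filiform[OF glV.subspace_0[OF fil.subspace]] by (simp add: bracket_generators)
  have "\<theta>H (\<theta>I a) - \<theta>I (\<theta>H a) = lie_der n (filiform n) l (bracket n H_el I_el) a"
    by (rule lie_der_commutator[where l = l, OF a fil.subspace nH nI l0])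
  also have "\<dots> = 0"
    using l0 by (simp add: lie_der_def bracket_generators contra_zero_left[OF a fil.subspace])
  finally show "\<theta>H (\<theta>I a) = \<theta>I (\<theta>H a)" by (simp only: right_minus_eq)
  show "d (\<theta>H a) = \<theta>H (d a)"
    by (rule eI.L.lie_der_CE_d[OF a nH, symmetric]) (use subsets elements l_linear(3) in blast)
  show "d (\<theta>I a) = \<theta>I (d a)"
    by (rule eI.L.lie_der_CE_d[OF a nI, symmetric]) (use subsets elements l_linear(3) in blast)
qed

lemma torus_diagonal:
  "\<exists>ts. \<forall>q\<le>p. \<forall>a\<in>cochains (filiform n) q. \<theta>H (kernel_proj \<theta>H ts a) = 0"
  "\<exists>ts. \<forall>q\<le>p. \<forall>a\<in>cochains (filiform n) q. \<theta>I (kernel_proj \<theta>I ts a) = 0"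
  by (rule lie_der_diagonal[OF filiform_span]; simp add: filiform_eigenbasis)+

abbreviation "ker_H q \<equiv> {a \<in> cochains (filiform n) q. \<theta>H a = 0}"
abbreviation "inv_H q \<equiv> {a \<in> cochains (filiform_I n) q. lie_der n (filiform_I n) l H_el a = 0}"

text \<open>
  The \<open>H\<close>-invariant forms on \<open>\<K>I \<ltimes> \<ff>\<^sub>n\<close> are the mapping cone of \<open>\<theta>I\<close> on the \<open>H\<close>-invariant forms on
  \<open>\<ff>\<^sub>n\<close>, because \<open>[H, I] = 0\<close>.
\<close>

lemma nontrivial_filiform_I:
  "nontrivial inv_H (CE_d n (filiform_I n) l) p \<longleftrightarrow> nontrivial invariants d p \<or> nontrivial invariants d (p - 1)"
proof -
  obtain ts where ts: "\<And>q a. q \<le> p \<Longrightarrow> a \<in> cochains (filiform n) q \<Longrightarrow> \<theta>I (kernel_proj \<theta>I ts a) = 0"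
    using torus_diagonal(2) by blast
  have br: "bracket n H_el I_el = glV_scale 0 (I_el :: 'k glV)" by (simp add: bracket_generators)
  have nH: "normalizes n H_el (filiform n :: 'k glV set)"
    by (rule normalizes_filiform[OF bracket_generators(2)])
  let ?\<theta> = "lie_der n (filiform_I n) l H_el" and ?D = "CE_d n (filiform_I n) l"
  have coords: "restrict_form (filiform n) (?\<theta> \<omega>) = \<theta>H (restrict_form (filiform n) \<omega>)"
    "eI.head (?\<theta> \<omega>) = \<theta>H (eI.head \<omega>)" if "\<omega> \<in> cochains (filiform_I n) q" for \<omega> q
    using eI.restrict_lie_der[OF nH] eI.head_lie_der[OF that nH br] by simp_all
  have \<theta>c: "?\<theta> \<omega> \<in> cochains (filiform_I n) q" if "\<omega> \<in> cochains (filiform_I n) q" for \<omega> q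
    by (rule cochain_lie_der[OF that eI.subspace normalizes_H])
  have linH: "fun_linear \<theta>H" "fun_linear ?\<theta>" by (rule fun_linear_lie_der)+
  have zero: "\<theta>H 0 = 0" by (rule lie_der_linear)
  have "nontrivial inv_H ?D p \<longleftrightarrow>
      nontrivial (\<lambda>q. {a \<in> ker_H q. \<theta>I a = 0}) d p \<or>
      nontrivial (\<lambda>q. {a \<in> ker_H q. \<theta>I a = 0}) d (p - 1)"
  proof (rule nontrivial_cone[where r = "restrict_form (filiform n)" and h = eI.head and ts = ts])
    show "funs.subspace (ker_H q)" for q
      by (rule kernel_subspace[OF linH(1) subspace_cochains])
    show "fun_linear d" "fun_linear \<theta>I" by (rule fun_linear_CE_d fun_linear_lie_der)+
    show "d a \<in> ker_H (q + 1)" if "a \<in> ker_H q" for q a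
    proof -
      have a: "a \<in> cochains (filiform n) q" "\<theta>H a = 0" using that by auto
      have "\<theta>H (d a) = d 0" unfolding torus_operators(4)[OF a(1), symmetric] a(2) ..
      then show ?thesis using eI.L.cochain_CE_d[OF a(1)] by (simp add: CE_d_linear)
    qed
    show "\<theta>I a \<in> ker_H q" if "a \<in> ker_H q" for q a
    proof -
      have a: "a \<in> cochains (filiform n) q" "\<theta>H a = 0" using that by auto
      have "\<theta>H (\<theta>I a) = \<theta>I 0" unfolding torus_operators(3)[OF a(1)] a(2) ..
      then show ?thesis using torus_operators(2)[OF a(1)] by (simp add: lie_der_linear)
    qed
    show "d (\<theta>I a) = \<theta>I (d a)" if "a \<in> ker_H q" for q a
      using that torus_operators(5) by blast
    show "\<theta>I (kernel_proj \<theta>I ts a) = 0" if "q \<le> p" "a \<in> ker_H q" for q a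
      using that ts by blast
    show "0 \<in> inv_H q" for q by (simp add: lie_der_linear)
    show "?D \<omega> \<in> inv_H (q + 1)" if "\<omega> \<in> inv_H q" for q \<omega>
    proof -
      have \<omega>: "\<omega> \<in> cochains (filiform_I n) q" "?\<theta> \<omega> = 0" using that by auto
      have "?\<theta> (?D \<omega>) = ?D (?\<theta> \<omega>)"
        by (rule eI.lie_der_CE_d[OF \<omega>(1) normalizes_H]) (use subsets elements l_linear(3) in blast)
      then have "?\<theta> (?D \<omega>) = 0" unfolding \<omega>(2) CE_d_linear .
      then show ?thesis using eI.cochain_CE_d[OF \<omega>(1)] by blast
    qed
    show "restrict_form (filiform n) \<omega> \<in> ker_H q"
      "eI.head \<omega> \<in> ker_H (q - 1)" if "\<omega> \<in> inv_H q" for q \<omega>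
    proof -
      have \<omega>: "\<omega> \<in> cochains (filiform_I n) q" "?\<theta> \<omega> = 0" using that by auto
      show "restrict_form (filiform n) \<omega> \<in> ker_H q"
        "eI.head \<omega> \<in> ker_H (q - 1)"
        using eI.coords_cochain[OF \<omega>(1)] coords[OF \<omega>(1), symmetric]
        by (simp_all add: \<omega>(2) restrict_form_linear eI.head_linear)
    qed
    show "restrict_form (filiform n) 0 = (0 :: 'k form)" "eI.head 0 = 0"
      by (rule restrict_form_linear eI.head_linear)+
    show "\<omega> = \<eta>" if "\<omega> \<in> inv_H q" "\<eta> \<in> inv_H q"
      "restrict_form (filiform n) \<omega> = restrict_form (filiform n) \<eta>" "eI.head \<omega> = eI.head \<eta>" for q \<omega> \<eta>
      using that by (intro eI.form_eqI[of \<omega> q \<eta>]) auto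
    show "\<exists>\<omega>\<in>inv_H q. restrict_form (filiform n) \<omega> = u \<and> eI.head \<omega> = w"
      if "u \<in> ker_H q" "w \<in> ker_H (q - 1)" for q u w
    proof -
      have uw: "u \<in> cochains (filiform n) q" "w \<in> cochains (filiform n) (q - 1)" "\<theta>H u = 0" "\<theta>H w = 0"
        using that by auto
      obtain \<omega> where \<omega>: "\<omega> \<in> cochains (filiform_I n) q" "restrict_form (filiform n) \<omega> = u" "eI.head \<omega> = w"
        using eI.coords_surj[OF uw(1,2)] by blast
      have "?\<theta> \<omega> = 0"
        by (rule eI.form_eqI[OF \<theta>c[OF \<omega>(1)] cochain_zero_form])
          (simp_all only: coords[OF \<omega>(1)] \<omega>(2,3) uw(3,4) restrict_form_linear eI.head_linear)
      then show ?thesis using \<omega> by blast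
    qed
    show "restrict_form (filiform n) (?D \<omega>) = d (restrict_form (filiform n) \<omega>)" for \<omega>
      by (rule eI.restrict_CE_d)
    show "eI.head (?D \<omega>) = \<theta>I (restrict_form (filiform n) \<omega>) - d (eI.head \<omega>)" if "\<omega> \<in> inv_H q" for q \<omega>
      using that by (intro eI.head_CE_d[of \<omega> q]) simp
  qed
  moreover have "(\<lambda>q. {a \<in> ker_H q. \<theta>I a = 0}) = invariants"
    by (auto simp: invariants_def)
  ultimately show ?thesis by (simp only:)
qed

lemma nontrivial_solv:
  "nontrivial (cochains (solv n)) (CE_d n (solv n) l) p \<longleftrightarrow>
    nontrivial inv_H (CE_d n (filiform_I n) l) p \<or> nontrivial inv_H (CE_d n (filiform_I n) l) (p - 1)"
proof -
  let ?\<theta> = "lie_der n (filiform_I n) l H_el" and ?D = "CE_d n (filiform_I n) l"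
  have "\<exists>ts. \<forall>q\<le>p. \<forall>a\<in>cochains (filiform_I n) q. ?\<theta> (kernel_proj ?\<theta> ts a) = 0"
    by (rule lie_der_diagonal[OF filiform_I_span]; simp add: filiform_I_eigenbasis)
  then obtain ts where ts: "\<And>q a. q \<le> p \<Longrightarrow> a \<in> cochains (filiform_I n) q \<Longrightarrow> ?\<theta> (kernel_proj ?\<theta> ts a) = 0"
    by blast
  show ?thesis
  proof (rule nontrivial_cone[where r = "restrict_form (filiform_I n)" and h = eH.head and ts = ts])
    show "funs.subspace (cochains (filiform_I n :: 'k glV set) q)" for q by (rule subspace_cochains)
    show "fun_linear ?D" "fun_linear ?\<theta>" by (rule fun_linear_CE_d fun_linear_lie_der)+
    show "?D (?\<theta> a) = ?\<theta> (?D a)" if "a \<in> cochains (filiform_I n) q" for q a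
      by (rule eI.lie_der_CE_d[OF that normalizes_H, symmetric]) (use subsets elements l_linear(3) in blast)
    show "restrict_form (filiform_I n) 0 = (0 :: 'k form)" "eH.head 0 = 0"
      by (rule restrict_form_linear eH.head_linear)+
    show "\<exists>\<omega>\<in>cochains (solv n) q. restrict_form (filiform_I n) \<omega> = u \<and> eH.head \<omega> = w"
      if "u \<in> cochains (filiform_I n) q" "w \<in> cochains (filiform_I n) (q - 1)" for q u w
      using eH.coords_surj[OF that] by blast
  qed (fact ts eI.cochain_CE_d cochain_zero_form eH.cochain_CE_d eH.coords_cochain eH.form_eqI eH.restrict_CE_d eH.head_CE_d
      | (rule ts eI.cochain_CE_d cochain_lie_der[OF _ eI.subspace normalizes_H] cochain_zero_form eH.cochain_CE_d eH.coords_cochain eH.form_eqI eH.restrict_CE_d eH.head_CE_d; assumption))+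
qed

lemma Gam_iff_nontrivial: "l \<in> Gam n p \<longleftrightarrow> nontrivial (cochains (solv n)) (CE_d n (solv n) l) p"
proof -
  let ?Z = "cocycles n (solv n) l p" and ?B = "coboundaries n (solv n) l p"
  have coset: "z +o ?B = ?B \<longleftrightarrow> z \<in> ?B" for z
    using coset_eq_iff[OF subspace_coboundaries, of z n "solv n" l p 0] by simp
  have "0 \<in> ?Z" by (simp add: cocycles_def CE_d_linear)
  then have "cohomology n (solv n) l p = {?B} \<longleftrightarrow> (\<forall>z\<in>?Z. z +o ?B = ?B)"
    unfolding cohomology_def quot_def by (auto simp: image_subset_iff set_eq_iff[of "_ ` _"] intro!: rev_image_eqI)
  also have "\<dots> \<longleftrightarrow> (\<forall>z\<in>?Z. z \<in> ?B)" unfolding coset ..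
  finally show ?thesis using l
    by (auto simp: Gam_def nontrivial_def cocycles_def coboundaries_def)
qed

lemma cohom_weights_iff:
  "- weight_pair l \<in> cohom_weights n p \<longleftrightarrow>
    (\<exists>z\<in>cocycles n (filiform n) 0 p. \<theta>H z \<in> Bfil n p \<and> \<theta>I z \<in> Bfil n p \<and> z \<notin> Bfil n p)"
proof -
  have \<theta>: "\<theta>H z = contra n (filiform n) H_el z - fun_scale (fst (- weight_pair l)) z"
    "\<theta>I z = contra n (filiform n) I_el z - fun_scale (snd (- weight_pair l)) z" for z
    by (simp_all add: lie_der_def weight_pair_def)
  show ?thesis unfolding cohom_weights_coset isotypic_iff Hfil_coset_iff \<theta> by blast
qed

text \<open>
  A class of weight \<open>-l\<close> is a class killed by both operators; by diagonalizability it contains an invariant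
  cocycle, and an invariant coboundary is the coboundary of an invariant form.
\<close>

lemma nontrivial_invariants_iff: "nontrivial invariants d p \<longleftrightarrow> - weight_pair l \<in> cohom_weights n p"
proof -
  let ?C = "cochains (filiform n) :: int \<Rightarrow> 'k form set" and ?Z = "cocycles n (filiform n) 0 p"
  have B: "Bfil n p = d ` ?C (p - 1)" unfolding coboundaries_def CE_d_filiform ..
  have Z: "?Z = {z \<in> ?C p. d z = 0}" unfolding cocycles_def CE_d_filiform ..
  obtain ts where ts: "\<And>q a. q \<le> p \<Longrightarrow> a \<in> ?C q \<Longrightarrow> \<theta>H (kernel_proj \<theta>H ts a) = 0"
    using torus_diagonal(1) by blast
  obtain ts' where ts': "\<And>q a. q \<le> p \<Longrightarrow> a \<in> ?C q \<Longrightarrow> \<theta>I (kernel_proj \<theta>I ts' a) = 0"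
    using torus_diagonal(2) by blast
  have d0: "d 0 = 0" by (rule CE_d_linear)
  have kernel: "\<theta>H a \<in> {a \<in> ?C q. d a = 0}" "\<theta>I a \<in> {a \<in> ?C q. d a = 0}" if "a \<in> {a \<in> ?C q. d a = 0}" for a q
  proof -
    have a: "a \<in> ?C q" "d a = 0" using that by auto
    have "d (\<theta>H a) = 0" "d (\<theta>I a) = 0"
      unfolding torus_operators(4,5)[OF a(1)] a(2) by (rule lie_der_linear)+
    then show "\<theta>H a \<in> {a \<in> ?C q. d a = 0}" "\<theta>I a \<in> {a \<in> ?C q. d a = 0}"
      using torus_operators(1,2)[OF a(1)] by blast+
  qed
  have kersub: "funs.subspace {a \<in> ?C q. d a = 0}" for q
    by (rule kernel_subspace[OF fun_linear_CE_d subspace_cochains])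
  show ?thesis unfolding cohom_weights_iff
  proof
    assume "nontrivial invariants d p"
    then obtain z where z: "z \<in> ?C p" "\<theta>H z = 0" "\<theta>I z = 0" "d z = 0" "z \<notin> d ` invariants (p - 1)"
      by (auto simp: nontrivial_def invariants_def)
    have "z \<notin> Bfil n p"
    proof
      assume "z \<in> Bfil n p"
      then obtain a where a: "a \<in> ?C (p - 1)" "z = d a" unfolding B by blast
      have "\<exists>v\<in>?C (p - 1). \<theta>H v = 0 \<and> \<theta>I v = 0 \<and> a - v \<in> {a \<in> ?C (p - 1). d a = 0}"
      proof (rule joint_eigenvector[where ss = ts and ts = ts'])
        show "\<theta>H (kernel_proj \<theta>H ts b) = 0" "\<theta>I (kernel_proj \<theta>I ts' b) = 0" if "b \<in> ?C (p - 1)" for b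
          using ts[of "p - 1"] ts'[of "p - 1"] that by simp_all
        have "d (\<theta>H a) = 0" "d (\<theta>I a) = 0"
          unfolding torus_operators(4,5)[OF a(1)] a(2)[symmetric] by (rule z)+
        then show "\<theta>H a \<in> {a \<in> ?C (p - 1). d a = 0}" "\<theta>I a \<in> {a \<in> ?C (p - 1). d a = 0}"
          using torus_operators(1,2)[OF a(1)] by blast+
        show "fun_linear \<theta>H" "fun_linear \<theta>I" by (rule fun_linear_lie_der)+
        show "\<theta>H (\<theta>I b) = \<theta>I (\<theta>H b)" if "b \<in> ?C (p - 1)" for b by (rule torus_operators(3)[OF that])
        show "\<theta>H b \<in> ?C (p - 1)" "\<theta>I b \<in> ?C (p - 1)" if "b \<in> ?C (p - 1)" for b
          by (rule torus_operators(1,2)[OF that])+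
      qed (fact subspace_cochains kersub a(1) | rule kernel; assumption)+
      then obtain v where v: "v \<in> invariants (p - 1)" "d (a - v) = 0"
        unfolding invariants_def by blast
      have "z = d v" using v(2) unfolding CE_d_linear a(2) by (simp only: right_minus_eq)
      then show False using z(5) v(1) by blast
    qed
    moreover have "0 \<in> Bfil n p" by (rule funs.subspace_0[OF subspace_coboundaries])
    ultimately show "\<exists>z\<in>?Z. \<theta>H z \<in> Bfil n p \<and> \<theta>I z \<in> Bfil n p \<and> z \<notin> Bfil n p"
      unfolding Z using z by (intro bexI[of _ z]) simp_all
  next
    assume "\<exists>z\<in>?Z. \<theta>H z \<in> Bfil n p \<and> \<theta>I z \<in> Bfil n p \<and> z \<notin> Bfil n p"
    then obtain z where z: "z \<in> {z \<in> ?C p. d z = 0}" "\<theta>H z \<in> Bfil n p" "\<theta>I z \<in> Bfil n p" "z \<notin> Bfil n p"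
      unfolding Z by blast
    have "\<exists>v\<in>{z \<in> ?C p. d z = 0}. \<theta>H v = 0 \<and> \<theta>I v = 0 \<and> z - v \<in> Bfil n p"
    proof (rule joint_eigenvector[where ss = ts and ts = ts'])
      show "\<theta>H (kernel_proj \<theta>H ts b) = 0" "\<theta>I (kernel_proj \<theta>I ts' b) = 0" if "b \<in> {z \<in> ?C p. d z = 0}" for b
        using ts[of p] ts'[of p] that by simp_all
      show "fun_linear \<theta>H" "fun_linear \<theta>I" by (rule fun_linear_lie_der)+
      show "\<theta>H (\<theta>I b) = \<theta>I (\<theta>H b)" if "b \<in> {z \<in> ?C p. d z = 0}" for b
        using that torus_operators(3) by blast
      show "\<theta>H b \<in> Bfil n p" "\<theta>I b \<in> Bfil n p" if b: "b \<in> Bfil n p" for b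
      proof -
        obtain a where a: "a \<in> ?C (p - 1)" "b = d a" using b unfolding B by blast
        show "\<theta>H b \<in> Bfil n p" "\<theta>I b \<in> Bfil n p"
          unfolding a(2) B torus_operators(4,5)[OF a(1), symmetric]
          using torus_operators(1,2)[OF a(1)] by blast+
      qed
    qed (fact kersub subspace_coboundaries z | rule kernel; assumption)+
    then obtain v where v: "v \<in> invariants p" "d v = 0" "z - v \<in> Bfil n p" unfolding invariants_def by blast
    have "v \<notin> Bfil n p"
      using z(4) v(3) funs.subspace_add[OF subspace_coboundaries v(3), of v] by auto
    then have "v \<notin> d ` invariants (p - 1)" unfolding B invariants_def by blast
    then show "nontrivial invariants d p" using v(1,2) by (auto simp: nontrivial_def)
  qed
qed

theorem Gam_iff:
  "l \<in> Gam n p \<longleftrightarrow> - weight_pair l \<in> cohom_weights n p \<union> cohom_weights n (p - 1) \<union> cohom_weights n (p - 2)"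
  unfolding Gam_iff_nontrivial nontrivial_solv nontrivial_filiform_I nontrivial_invariants_iff by auto

end

section \<open>The vertices of the polygon\<close>

lemma Lam_separates:
  assumes "distinct js" "set js \<subseteq> {..n}"
  shows "\<exists>u\<in>Lam n (int (length js)). u (map basis_vec js) \<noteq> (0 :: 'k::field_char_0)"
  using assms
proof (induction js)
  case Nil
  have "(\<lambda>xs. if xs = [] then 1 else 0 :: 'k) \<in> Lam n 0"
    by (rule cochainsI) auto
  then show ?case by (intro bexI) auto
next
  case (Cons j js)
  then obtain u where u: "u \<in> Lam n (int (length js))" "u (map basis_vec js) \<noteq> (0 :: 'k)" by auto
  let ?\<phi> = "one_form (V n) (\<lambda>y. snd y j) :: 'k form"
  have basis_vec: "basis_vec i \<in> (V n :: 'k glV set)" if "i \<le> n" for i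
    using that by (auto simp: basis_vec_def V_def)
  have "wedge1 u ?\<phi> \<in> Lam n (int (length js) + 1)"
    by (rule cochain_wedge1[OF u(1) subspace_V]) (simp_all add: glV_scale_def)
  moreover have "wedge1 (interior (basis_vec j) u) ?\<phi> (map basis_vec js) = 0"
    using Cons.prems by (intro wedge1_kernel) (auto simp: one_form_def basis_vec_def)
  then have "wedge1 u ?\<phi> (map basis_vec (j # js)) \<noteq> 0"
    using u(2) basis_vec[of j] Cons.prems(2) by (simp add: wedge1_Cons one_form_def) (simp add: basis_vec_def)
  ultimately show ?case by (auto intro!: bexI[of _ "wedge1 u ?\<phi>"] simp: add.commute)
qed

lemma contra_H_I_basis:
  fixes a :: "'k::field_char_0 form"
  assumes "a \<in> Lam n q" "set js \<subseteq> {..n}"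
  shows "contra n (V n) H_el a (map basis_vec js) = - (\<Sum>j\<leftarrow>js. of_nat n - 2 * of_nat j) * a (map basis_vec js)"
    "contra n (V n) I_el a (map basis_vec js) = - of_nat (length js) * a (map basis_vec js)"
proof -
  have basis_vec: "basis_vec ` set js \<subseteq> V n" using assms(2) by (auto simp: basis_vec_def V_def)
  show "contra n (V n) H_el a (map basis_vec js) = - (\<Sum>j\<leftarrow>js. of_nat n - 2 * of_nat j) * a (map basis_vec js)"
    by (rule contra_eigenbasis[OF assms(1) basis_vec bracket_basis_vec(4)])
  have "contra n (V n) I_el a (map basis_vec js) = - sum_list (map (\<lambda>_. 1) js) * a (map basis_vec js)"
    by (rule contra_eigenbasis[OF assms(1) basis_vec]) (simp add: bracket_basis_vec)
  then show "contra n (V n) I_el a (map basis_vec js) = - of_nat (length js) * a (map basis_vec js)"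
    by (simp add: sum_list_triv)
qed

text \<open>
  This replaces the explicit form \<open>\<And>\<^sub>j e\<^sub>j\<^sup>*\<close>: any form that does not vanish at the list can be projected to the
  weight that the list prescribes.
\<close>

lemma weight_vector_exists:
  fixes js :: "nat list"
  assumes "distinct js" "set js \<subseteq> {..n}"
  shows "\<exists>v\<in>weight_space n (int (length js)) (- (\<Sum>j\<leftarrow>js. beta n j)). v (map basis_vec js) \<noteq> (0 :: 'k::field_char_0)"
proof -
  let ?q = "int (length js)"
  define \<nu> m :: 'k where "\<nu> = - (\<Sum>j\<leftarrow>js. of_nat n - 2 * of_nat j)" and "m = - of_nat (length js)"
  have beta: "- (\<Sum>j\<leftarrow>js. beta n j) = (\<nu>, m)"
    unfolding \<nu>_def m_def by (induction js) (simp_all add: beta_def zero_prod_def)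
  obtain u where u: "u \<in> Lam n ?q" "u (map basis_vec js) \<noteq> (0 :: 'k)" using Lam_separates[OF assms] by blast
  let ?N = "{a \<in> Lam n ?q. a (map basis_vec js) = (0 :: 'k)}"
  have N: "contra n (V n) H_el a - fun_scale \<nu> a \<in> ?N" "contra n (V n) I_el a - fun_scale m a \<in> ?N"
    if "a \<in> Lam n ?q" for a
    using that contra_H_I_basis[OF that assms(2)]
    by (simp_all add: \<nu>_def m_def cochain_diff_form cochain_add_form cochain_scale_form cochain_contra subspace_V normalizes_V)
  have "\<exists>v\<in>weight_space n ?q (\<nu>, m). u - v \<in> ?N"
  proof (rule joint_weight_vector[OF _ _ _ u(1)])
    show "funs.subspace ?N"
      by (rule funs.subspaceI) (simp_all add: cochain_add_form cochain_scale_form)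
  qed (use N u(1) in blast)+
  then show ?thesis using u(2) unfolding beta by auto
qed

lemma isotypic_nonzero:
  fixes u w :: "'k::field_char_0 form"
  shows "\<lbrakk>u \<in> weight_space n p \<mu>; contra n (V n) E_el u = 0; u \<noteq> 0\<rbrakk> \<Longrightarrow> \<mu> \<in> cohom_weights n p"
    and "\<lbrakk>w \<in> weight_space n p (\<mu> + (2, 0)); w \<notin> E_image n p\<rbrakk> \<Longrightarrow> \<mu> \<in> cohom_weights n (p + 1)"
proof -
  have zero: "0 \<in> E_image n q" "0 \<in> weight_space n q \<mu>" for q
    by (rule funs.subspace_0[OF subspace_E_image] funs.subspace_0[OF subspace_weight_space])+
  show "\<mu> \<in> cohom_weights n p" if u: "u \<in> weight_space n p \<mu>" "contra n (V n) E_el u = 0" "u \<noteq> 0"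
  proof -
    have uL: "u \<in> Lam n p" using u(1) by (simp add: weight_space_def)
    have "(extend n u + tensor_E_star n 0) +o Bfil n p \<in> isotypic n p \<mu>"
      using u zero by (simp add: isotypic_coords[OF uL] contra_linear)
    moreover have "extend n u + tensor_E_star n 0 \<notin> Bfil n p"
      using u(3) by (simp only: sum_in_coboundaries_iff[OF uL cochain_zero_form] simp_thms)
    ultimately show ?thesis unfolding cohom_weights_coset by blast
  qed
  show "\<mu> \<in> cohom_weights n (p + 1)" if w: "w \<in> weight_space n p (\<mu> + (2, 0))" "w \<notin> E_image n p"
  proof -
    have wL: "w \<in> Lam n (p + 1 - 1)" using w(1) by (simp add: weight_space_def)
    have "(extend n 0 + tensor_E_star n w) +o Bfil n (p + 1) \<in> isotypic n (p + 1) \<mu>"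
      using w(1) zero by (simp add: isotypic_coords[OF cochain_zero_form wL] contra_linear weight_space_def)
    moreover have "extend n 0 + tensor_E_star n w \<notin> Bfil n (p + 1)"
      using w(2) by (simp add: sum_in_coboundaries_iff[OF cochain_zero_form wL])
    ultimately show ?thesis unfolding cohom_weights_coset by blast
  qed
qed

text \<open>
  Since \<open>E e\<^sub>0 = 0\<close> and \<open>E e\<^sub>i = e\<^bsub>i-1\<^esub>\<close>, replacing one of \<open>e\<^sub>0, \<dots>, e\<^bsub>k-1\<^esub>\<close> by its image gives zero or a
  repetition.
\<close>

lemma E_image_initial:
  fixes w :: "'k::field_char_0 form"
  assumes "w \<in> E_image n q" "k \<le> Suc n"
  shows "w (map basis_vec [0..<k]) = 0"
proof -
  obtain a where a: "a \<in> Lam n q" "w = contra n (V n) E_el a" using assms(1) by (auto simp: E_image_def)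
  have "a ((map basis_vec [0..<k])[i := bracket n E_el (map basis_vec [0..<k] ! i)]) = 0" if i: "i < k" for i
  proof (cases i)
    case 0
    then have "(0 :: 'k glV) \<in> set ((map basis_vec [0..<k])[i := bracket n E_el (map basis_vec [0..<k] ! i)])"
      using i by (simp add: bracket_basis_vec set_update_memI)
    then show ?thesis by (rule cochain_zero_arg[OF a(1)])
  next
    case (Suc h)
    show ?thesis
      by (rule cochain_repeat[OF a(1), of h i]) (use i Suc in \<open>simp_all add: bracket_basis_vec\<close>)
  qed
  then show ?thesis unfolding a(2) by (simp add: contra_def)
qed

lemma sum_le_top:
  fixes J :: "nat set"
  assumes "J \<subseteq> {..n}" "card J = Suc n - k" "k \<le> Suc n"
  shows "\<Sum> J \<le> \<Sum> {k..n}"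
proof -
  let ?K = "{k..n}"
  have fin: "finite J" using assms(1) finite_subset by blast
  have "card (J - ?K) = card (?K - J)"
    using card_Diff_subset_Int[of J ?K] card_Diff_subset_Int[of ?K J] fin assms(2,3) by (simp add: Int_commute)
  moreover have "\<Sum> (J - ?K) \<le> card (J - ?K) * k"
    using sum_bounded_above[of "J - ?K" "\<lambda>x. x" k] assms(1) by fastforce
  moreover have "card (?K - J) * k \<le> \<Sum> (?K - J)"
    using sum_bounded_below[of "?K - J" k "\<lambda>x. x"] by simp
  ultimately have "\<Sum> (J - ?K) \<le> \<Sum> (?K - J)" by (metis order_trans)
  moreover have "\<Sum> J = \<Sum> (J \<inter> ?K) + \<Sum> (J - ?K)" "\<Sum> ?K = \<Sum> (?K \<inter> J) + \<Sum> (?K - J)"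
    using fin by (simp_all add: sum.Int_Diff)
  ultimately show ?thesis by (simp add: Int_commute)
qed

text \<open>
  The weight of \<open>E u\<close> prescribes the sum of the indices of the basis vectors on which \<open>E u\<close> can be nonzero, and it
  is one more than the largest sum that distinct indices can have.
\<close>

lemma top_form_invariant:
  fixes u :: "'k::field_char_0 form"
  assumes k: "k \<le> Suc n" and u: "u \<in> weight_space n (int (Suc n - k)) (- (\<Sum>i=k..n. beta n i))"
  shows "contra n (V n) E_el u = 0"
proof -
  let ?q = "int (Suc n - k)" and ?v = "contra n (V n) E_el u"
  define \<nu> m :: 'k where "\<nu> = - (\<Sum>i=k..n. of_nat n - 2 * of_nat i)" and "m = - of_nat (card {k..n})"
  have "- (\<Sum>i=k..n. beta n i) = (\<nu>, m)"
    by (simp add: \<nu>_def m_def beta_def prod_eq_iff fst_sum snd_sum)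
  then have v: "?v \<in> weight_space n ?q (\<nu> + 2, m)"
    using contra_weight_space[OF _ bracket_generators(2,4)] u by metis
  then have vL: "?v \<in> Lam n ?q" and Hv: "contra n (V n) H_el ?v = fun_scale (\<nu> + 2) ?v"
    by (auto simp: weight_space_def)
  show ?thesis
  proof (rule cochain_eqI_span[where S = "basis_vec ` {..n}" and p = ?q])
    show "?v \<in> cochains (glV.span (basis_vec ` {..n})) ?q" using vL unfolding V_span .
    fix xs :: "'k glV list" assume "set xs \<subseteq> basis_vec ` {..n}"
    then have "xs \<in> lists (basis_vec ` {..n})" by auto
    then obtain js where js: "xs = map basis_vec js" "set js \<subseteq> {..n}" by (auto simp: lists_image)
    have "?v (map basis_vec js) = 0" if len: "length js = Suc n - k" and dist: "distinct js"
    proof -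
      have card: "card (set js) = Suc n - k" using dist len by (simp add: distinct_card)
      have "(\<Sum>j\<leftarrow>js. of_nat n - 2 * of_nat j) = (\<Sum>j\<in>set js. of_nat n - 2 * of_nat j :: 'k)"
        using dist by (simp add: sum_list_distinct_conv_sum_set)
      also have "\<dots> = of_nat (Suc n - k) * of_nat n - 2 * of_nat (\<Sum> (set js))"
        by (simp add: sum_subtractf card sum_distrib_left)
      finally have 1: "(\<Sum>j\<leftarrow>js. of_nat n - 2 * of_nat j)
          = (of_nat (Suc n - k) * of_nat n - 2 * of_nat (\<Sum> (set js)) :: 'k)" .
      have 2: "\<nu> = 2 * of_nat (\<Sum> {k..n}) - of_nat (Suc n - k) * of_nat n"
        by (simp add: \<nu>_def sum_subtractf sum_distrib_left)
      have "- (\<Sum>j\<leftarrow>js. of_nat n - 2 * of_nat j) * ?v (map basis_vec js) = (\<nu> + 2) * ?v (map basis_vec js)"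
        using contra_H_I_basis(1)[OF vL js(2)] fun_cong[OF Hv, of "map basis_vec js"] by simp
      then have "2 * (of_nat (\<Sum> (set js)) - of_nat (\<Sum> {k..n} + 1)) * ?v (map basis_vec js) = 0"
        unfolding 1 2 by (simp add: algebra_simps)
      moreover have "of_nat (\<Sum> (set js)) \<noteq> (of_nat (\<Sum> {k..n} + 1) :: 'k)"
        using sum_le_top[OF js(2) card k] by (simp only: of_nat_eq_iff)
      moreover have "2 * (x - y) * z = 0 \<Longrightarrow> x \<noteq> y \<Longrightarrow> z = 0" for x y z :: 'k by auto
      ultimately show ?thesis by blast
    qed
    moreover have "?v (map basis_vec js) = 0" if "length js \<noteq> Suc n - k"
      using cochain_outside[OF vL, of "map basis_vec js"] that by auto
    moreover have "?v (map basis_vec js) = 0" if "\<not> distinct js"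
      using cochain_not_distinct[OF vL] that by (simp add: distinct_map)
    ultimately show "?v xs = 0 xs" unfolding js(1) by auto
  qed simp
qed

lemma upper_vertex_weight:
  assumes "k \<le> Suc n"
  shows "- (\<Sum>i=k..n. beta n i) \<in> (cohom_weights n (int (Suc n - k)) :: ('k::field_char_0 \<times> 'k) set)"
proof -
  have js: "set [k..<Suc n] \<subseteq> {..n}" by auto
  have eq: "(\<Sum>j\<leftarrow>[k..<Suc n]. beta n j) = (\<Sum>i=k..n. beta n i :: 'k \<times> 'k)"
    unfolding interv_sum_list_conv_sum_set_nat set_upt atLeastLessThanSuc_atLeastAtMost ..
  obtain v where v: "v \<in> weight_space n (int (Suc n - k)) (- (\<Sum>i=k..n. beta n i))"
      "v (map basis_vec [k..<Suc n]) \<noteq> (0 :: 'k)"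
    using weight_vector_exists[where 'k = 'k, OF distinct_upt js] unfolding eq length_upt by blast
  then have "v \<noteq> 0" by auto
  then show ?thesis using isotypic_nonzero(1)[OF v(1) top_form_invariant[OF assms v(1)]] by blast
qed

lemma lower_vertex_weight:
  assumes "k \<le> Suc n"
  shows "- (alpha + (\<Sum>i<k. beta n i)) \<in> (cohom_weights n (int k + 1) :: ('k::field_char_0 \<times> 'k) set)"
proof -
  have js: "set [0..<k] \<subseteq> {..n}" using assms by auto
  have eq: "(\<Sum>j\<leftarrow>[0..<k]. beta n j) = (\<Sum>i<k. beta n i :: 'k \<times> 'k)"
    unfolding interv_sum_list_conv_sum_set_nat set_upt atLeast0LessThan ..
  obtain v where v: "v \<in> weight_space n (int k) (- (\<Sum>i<k. beta n i))" "v (map basis_vec [0..<k]) \<noteq> (0 :: 'k)"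
    using weight_vector_exists[where 'k = 'k, OF distinct_upt js] unfolding eq length_upt diff_zero by blast
  have "- (alpha + (\<Sum>i<k. beta n i)) + (2, 0) = (- (\<Sum>i<k. beta n i) :: 'k \<times> 'k)"
    by (simp add: alpha_def prod_eq_iff)
  then show ?thesis
    using isotypic_nonzero(2)[of v n "int k" "- (alpha + (\<Sum>i<k. beta n i))"] v E_image_initial[OF _ assms]
    by metis
qed

lemma character_exists:
  fixes \<nu> :: "'k::field_char_0 \<times> 'k"
  shows "\<exists>l\<in>characters n (solv n). weight_pair l = \<nu>"
proof
  let ?l = "\<lambda>y. if y \<in> solv n then fst \<nu> * xi_H y + snd \<nu> * xi_I y else (0 :: 'k)"
  have triangular: "fst y $ 2 $ 1 = 0" if "y \<in> solv n" for y :: "'k glV"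
    using that unfolding solv_def
    by (rule vanish_on_span[rotated 3])
      (auto simp: glV_scale_def map_matrix_def H_mat_def I_mat_def E_mat_def mat_def V_def)
  have bracket: "xi_H (bracket n y z) = 0" "xi_I (bracket n y z) = 0" if "y \<in> solv n" "z \<in> solv n" for y z :: "'k glV"
    using triangular[OF that(1)] triangular[OF that(2)]
    by (simp_all add: xi_defs bracket_def matrix_matrix_mult_def sum_2)
  have "y + z \<in> solv n" "glV_scale c y \<in> solv n" if "y \<in> solv n" "z \<in> solv n" for y z :: "'k glV" and c
    using that unfolding solv_def by (auto intro: glV.span_add glV.span_scale)
  then show "?l \<in> characters n (solv n)"
    unfolding characters_def by (simp add: xi_linear bracket algebra_simps)
  show "weight_pair ?l = \<nu>"
    by (simp add: weight_pair_def xi_values prod_eq_iff solv_def glV.span_base)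
qed

lemma vertex_in_Gam_all:
  fixes \<nu> :: "'k::field_char_0 \<times> 'k"
  assumes "- \<nu> \<in> cohom_weights n p"
  shows "\<nu> \<in> weight_pair ` Gam_all n"
proof -
  obtain l where lw: "l \<in> characters n (solv n)" "weight_pair l = \<nu>" using character_exists by blast
  interpret solv_character n l by unfold_locales (rule lw(1))
  have "l \<in> Gam n p" unfolding Gam_iff lw(2) using assms by blast
  then show ?thesis using lw(2) by (auto simp: Gam_all_def)
qed

lemma polygon_vertices_in_Gam_all:
  "set (polygon_vertices n) \<subseteq> weight_pair ` (Gam_all n :: ('k::field_char_0 glV \<Rightarrow> 'k) set)"
proof
  fix \<nu> :: "'k \<times> 'k" assume "\<nu> \<in> set (polygon_vertices n)"
  then have "\<nu> = 0 \<or> (\<exists>k\<in>{0..<n + 2}. \<nu> = alpha + (\<Sum>i<k. beta n i)) \<or> (\<exists>k\<in>{0..<n + 1}. \<nu> = (\<Sum>i=k..n. beta n i))"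
    unfolding polygon_vertices_def by (simp only: list.set set_append set_map set_upt) blast
  then show "\<nu> \<in> weight_pair ` Gam_all n"
  proof (elim disjE bexE)
    \<comment> \<open>the vertex \<open>0\<close> is the empty sum, from \<open>\<Lambda>\<^sup>0V\<^sub>n\<^sup>*\<close>\<close>
    assume "\<nu> = 0"
    then show ?thesis using vertex_in_Gam_all[OF upper_vertex_weight[of "Suc n" n, where 'k = 'k]] by simp
  next
    fix k assume "k \<in> {0..<n + 2}" "\<nu> = alpha + (\<Sum>i<k. beta n i)"
    then show ?thesis using vertex_in_Gam_all[OF lower_vertex_weight[of k n]] by simp
  next
    fix k assume "k \<in> {0..<n + 1}" "\<nu> = (\<Sum>i=k..n. beta n i)"
    then show ?thesis using vertex_in_Gam_all[OF upper_vertex_weight[of k n]] by simp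
  qed
qed

theorem mainTheorem7:
  fixes n :: nat
  shows
    "(\<forall>p.
        bij_betw (decomp n p)
          (E_invariants n p \<times> E_coinvariants n (p - 1))
          (Hfil n p :: ('k::{alg_closed_field, field_char_0} glV list \<Rightarrow> 'k) set set) \<and>
        (\<forall>u \<in> (E_invariants n p :: ('k glV list \<Rightarrow> 'k) set). \<forall>C \<in> E_coinvariants n (p - 1).
           (\<forall>u' \<in> E_invariants n p. \<forall>C' \<in> E_coinvariants n (p - 1).
              decomp n p (u + u', C + C') = decomp n p (u, C) + decomp n p (u', C')) \<and>
           (\<forall>c. decomp n p (fun_scale c u, quot_map (fun_scale c) (E_image n (p - 1)) C)
              = quot_map (fun_scale c) (Bfil n p) (decomp n p (u, C))) \<and>
           (\<forall>x \<in> torus. decomp n p (contra n (V n) x u, coinv_act n (p - 1) x C)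
              = quot_map (contra n (filiform n) x) (Bfil n p) (decomp n p (u, C)))) \<and>
        (\<forall>\<mu> :: 'k \<times> 'k.
           isotypic n p \<mu> = quot_span (Bfil n p)
             ((\<lambda>u. extend n u +o Bfil n p) ` highest_weight_vectors n p \<mu> \<union>
              (\<lambda>w. tensor_E_star n w +o Bfil n p) ` lowest_weight_vectors n (p - 1) (\<mu> + (2, 0)))))
     \<and>
     (\<forall>p. \<forall>l \<in> characters n (solv n :: 'k glV set).
        l \<in> Gam n p \<longleftrightarrow>
          - weight_pair l \<in> cohom_weights n p \<union> cohom_weights n (p - 1) \<union> cohom_weights n (p - 2))
     \<and>
     set (polygon_vertices n :: ('k \<times> 'k) list) \<subseteq> weight_pair ` (Gam_all n :: ('k glV \<Rightarrow> 'k) set)"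
proof (intro conjI allI ballI)
  fix p :: int
  show "bij_betw (decomp n p) (E_invariants n p \<times> E_coinvariants n (p - 1))
      (Hfil n p :: ('k glV list \<Rightarrow> 'k) set set)"
    by (rule decomp_bij)
next
  fix p :: int and u u' :: "'k glV list \<Rightarrow> 'k" and C C' :: "('k glV list \<Rightarrow> 'k) set"
  assume "C \<in> E_coinvariants n (p - 1)" "C' \<in> E_coinvariants n (p - 1)"
  then show "decomp n p (u + u', C + C') = decomp n p (u, C) + decomp n p (u', C')"
    by (rule decomp_add)
next
  fix p :: int and u :: "'k glV list \<Rightarrow> 'k" and C :: "('k glV list \<Rightarrow> 'k) set" and c :: 'k
  assume "C \<in> E_coinvariants n (p - 1)"
  then show "decomp n p (fun_scale c u, quot_map (fun_scale c) (E_image n (p - 1)) C)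
      = quot_map (fun_scale c) (Bfil n p) (decomp n p (u, C))"
    by (rule decomp_scale)
next
  fix p :: int and u :: "'k glV list \<Rightarrow> 'k" and C :: "('k glV list \<Rightarrow> 'k) set" and x :: "'k glV"
  assume "u \<in> E_invariants n p" "C \<in> E_coinvariants n (p - 1)" "x \<in> torus"
  then show "decomp n p (contra n (V n) x u, coinv_act n (p - 1) x C)
      = quot_map (contra n (filiform n) x) (Bfil n p) (decomp n p (u, C))"
    by (intro decomp_torus) (simp_all add: E_invariants_def)
next
  fix p :: int and \<mu> :: "'k \<times> 'k"
  show "isotypic n p \<mu> = quot_span (Bfil n p)
      ((\<lambda>u. extend n u +o Bfil n p) ` highest_weight_vectors n p \<mu> \<union>
       (\<lambda>w. tensor_E_star n w +o Bfil n p) ` lowest_weight_vectors n (p - 1) (\<mu> + (2, 0)))"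
    by (rule isotypic_generated)
next
  fix p :: int and l :: "'k glV \<Rightarrow> 'k" assume "l \<in> characters n (solv n)"
  then interpret solv_character n l by unfold_locales
  show "l \<in> Gam n p \<longleftrightarrow>
      - weight_pair l \<in> cohom_weights n p \<union> cohom_weights n (p - 1) \<union> cohom_weights n (p - 2)"
    by (rule Gam_iff)
qed (rule polygon_vertices_in_Gam_all)

end
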